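(* Let $\gamma\in(-2,-1)$ be fixed. Let $\beta$ be a nonnegative symmetric (even) measure on $[-\pi/2,\pi/2]\setminus\{0\}$ with total mass $\Lambda=\beta([-\pi/2,\pi/2])\in(0,\infty)$, and assume that there is $\theta_0\in(0,\pi/2)$ such that $\beta((-\theta_0,\theta_0))=0$. Assume that for some $r_0>0$, $f_0$ is the uniform probability distribution on the circle $\{v\in\mathbb{R}^2:|v|=r_0\}$. Then there exists a solution $(f_t)_{t\ge 0}$ to $LB(f_0,\gamma,\beta)$ such that $f_t$ has a density with respect to the Lebesgue measure on $\mathbb{R}^2$ for almost every $t>0$.
   Context: For $\theta\in\mathbb{R}$ let $R_\theta$ denote the rotation of $\mathbb{R}^2$ of angle $\theta$, and for $v,v_*\in\mathbb{R}^2$ put $$v'=v'(v,v_*,\theta)=\frac{v+v_*}{2}+R_\theta\frac{v-v_*}{2}.$$ $Lip(\mathbb{R}^2)$ is the set of globally Lipschitz functions from $\mathbb{R}^2$ to $\mathbb{R}$. For $\varphi\in Lip(\mathbb{R}^2)$ set $$\mathcal{A}\varphi(v,v_* )=\mathbf{1}_{\{v\ne v_*\}}|v-v_*|^\gamma\int_{-\pi/2}^{\pi/2}\beta(d\theta)\,[\varphi(v')-\varphi(v)].$$ A family $(f_t)_{t\ge0}$ of probability measures on $\mathbb{R}^2$ is said to solve $LB(f_0,\gamma,\beta)$ (the Boltzmann equation linearized around its initial condition) if for all $\varphi\in Lip(\mathbb{R}^2)$ and all $t\ge 0$, $$\int_{\mathbb{R}^2} f_t(dv)\varphi(v)=\int_{\mathbb{R}^2}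 f_0(dv)\varphi(v)+\int_0^t ds\int_{\mathbb{R}^2} f_s(dv)\int_{\mathbb{R}^2} f_0(dv_* )\,\mathcal{A}\varphi(v,v_* ).$$ *)

theory Defs
  imports "HOL-Probability.Probability"
begin

definition rotation :: "real \<Rightarrow> real ^ 2 \<Rightarrow> real ^ 2" where
  "rotation \<theta> v =
     vector [cos \<theta> * v $ 1 - sin \<theta> * v $ 2, sin \<theta> * v $ 1 + cos \<theta> * v $ 2]"

definition post_velocity :: "real ^ 2 \<Rightarrow> real ^ 2 \<Rightarrow> real \<Rightarrow> real ^ 2" where
  "post_velocity v w \<theta> = (1 / 2) *\<^sub>R (v + w) + rotation \<theta> ((1 / 2) *\<^sub>R (v - w))"

definition Lip :: "(real ^ 2 \<Rightarrow> real) set" where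
  "Lip = {\<phi>. \<exists>L. L-lipschitz_on UNIV \<phi>}"

text \<open>The space of angles; an angular measure \<open>\<beta>\<close> lives on its Borel sets, so that an
  integral against \<open>\<beta>\<close> is an integral over \<open>[-\<pi>/2, \<pi>/2]\<close> without the origin.\<close>

definition angles :: "real measure" where
  "angles = restrict_space borel ({- pi / 2 .. pi / 2} - {0})"

definition collision_op ::
  "real \<Rightarrow> real measure \<Rightarrow> (real ^ 2 \<Rightarrow> real) \<Rightarrow> real ^ 2 \<Rightarrow> real ^ 2 \<Rightarrow> real" where
  "collision_op \<gamma> \<beta> \<phi> v w =
     (if v \<noteq> w
      then norm (v - w) powr \<gamma> * (LINT \<theta>|\<beta>. \<phi> (post_velocity v w \<theta>) - \<phi> v)
      else 0)"

text \<open>The Bochner integral of a non-integrable function is \<open>0\<close> by convention. The weak equation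
  is meant with all its integrals well defined, so integrability at each level of integration
  is part of the definition.\<close>

definition solves_LB ::
  "(real ^ 2) measure \<Rightarrow> real \<Rightarrow> real measure \<Rightarrow> (real \<Rightarrow> (real ^ 2) measure) \<Rightarrow> bool" where
  "solves_LB f0 \<gamma> \<beta> f \<longleftrightarrow>
     f 0 = f0 \<and>
     (\<forall>t\<ge>0. prob_space (f t) \<and> sets (f t) = sets borel) \<and>
     (\<forall>\<phi>\<in>Lip. \<forall>t\<ge>0.
        integrable (f t) \<phi> \<and>
        (\<forall>v w. v \<noteq> w \<longrightarrow> integrable \<beta> (\<lambda>\<theta>. \<phi> (post_velocity v w \<theta>) - \<phi> v)) \<and>
        integrable (f t \<Otimes>\<^sub>M f0) (\<lambda>(v, w). collision_op \<gamma> \<beta> \<phi> v w) \<and>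
        set_integrable lborel {0..t}
          (\<lambda>s. LINT v|f s. LINT w|f0. collision_op \<gamma> \<beta> \<phi> v w) \<and>
        (LINT v|f t. \<phi> v) =
          (LINT v|f0. \<phi> v) +
          (LINT s:{0..t}|lborel. LINT v|f s. LINT w|f0. collision_op \<gamma> \<beta> \<phi> v w))"

text \<open>Normalised arc length on the circle of radius \<open>r\<close> centred at the origin.\<close>

definition uniform_circle :: "real \<Rightarrow> (real ^ 2) measure" where
  "uniform_circle r =
     distr (uniform_measure lborel {0..2 * pi}) borel
       (\<lambda>\<alpha>. vector [r * cos \<alpha>, r * sin \<alpha>])"

definition has_lebesgue_density :: "(real ^ 2) measure \<Rightarrow> bool" where
  "has_lebesgue_density \<mu> \<longleftrightarrow> (\<exists>g\<in>borel_measurable lborel. \<mu> = density lborel g)"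

lemma norm_rotation: "norm (rotation \<theta> v) = norm v"
proof -
  have "(cos \<theta> * a - sin \<theta> * b)\<^sup>2 + (sin \<theta> * a + cos \<theta> * b)\<^sup>2 = a\<^sup>2 + b\<^sup>2" for a b :: real
  proof -
    have "(cos \<theta> * a - sin \<theta> * b)\<^sup>2 + (sin \<theta> * a + cos \<theta> * b)\<^sup>2
        = ((cos \<theta>)\<^sup>2 + (sin \<theta>)\<^sup>2) * (a\<^sup>2 + b\<^sup>2)"
      by algebra
    then show ?thesis by simp
  qed
  then show ?thesis
    by (simp add: rotation_def norm_vec_def L2_set_def sum_2)
qed

lemma circle_measurable:
  "(\<lambda>\<alpha>. vector [r * cos \<alpha>, r * sin \<alpha>] :: real ^ 2) \<in> borel_measurable borel"
proof (rule borel_measurable_continuous_onI)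
  have "(\<lambda>\<alpha>. vector [r * cos \<alpha>, r * sin \<alpha>] :: real ^ 2) =
        (\<lambda>\<alpha>. \<chi> i. if i = 1 then r * cos \<alpha> else r * sin \<alpha>)"
    by (auto simp: vec_eq_iff forall_2)
  moreover have "continuous_on UNIV
      (\<lambda>\<alpha>. (\<chi> i. if i = 1 then r * cos \<alpha> else r * sin \<alpha>) :: real ^ 2)"
  proof (rule continuous_on_vec_lambda)
    show "continuous_on UNIV (\<lambda>\<alpha>. if i = 1 then r * cos \<alpha> else r * sin \<alpha>)" for i :: 2
      by (cases "i = 1") (auto intro!: continuous_intros)
  qed
  ultimately show "continuous_on UNIV (\<lambda>\<alpha>. vector [r * cos \<alpha>, r * sin \<alpha>] :: real ^ 2)"
    by (simp only:)
qed

lemma prob_space_uniform_circle: "prob_space (uniform_circle r)"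
proof -
  interpret prob_space "uniform_measure lborel {0..2 * pi}"
    by (rule prob_space_uniform_measure) auto
  show ?thesis
    unfolding uniform_circle_def
    by (rule prob_space_distr) (use circle_measurable in simp)
qed

end

theory Submission
  imports Defs "HOL-Library.Diagonal_Subsequence"
begin

text \<open>
  Write \<open>C\<close> for the circle of radius \<open>r0\<close>, which carries \<open>f0\<close>. The total collision rate is infinite on
  \<open>C\<close> because \<open>\<gamma> < -1\<close>, and finite off \<open>C\<close>. A particle started on \<open>C\<close> therefore leaves it at once, through
  infinitely many small collisions, and each collision has a smoothing effect.

  Existence rests on the fact that a collision moves \<open>v\<close> by at most \<open>|v - v\<^sub>*|\<close>. On Lipschitz functions
  the generator is thus controlled by the potential of \<open>f0\<close> with exponent \<open>\<gamma> + 1 > -1\<close>, which is bounded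
  (\<open>gen_bound\<close>). The rates are truncated, and the truncated equation is discretised in time as a Markov chain
  (\<open>chain_step\<close>), which inherits rotation invariance from \<open>f0\<close>. Its laws are determined by the laws of the
  modulus on the real line, so Helly's selection theorem, Levy's continuity theorem and equicontinuity in time
  give a limit at all times (\<open>helly_selection_equicontinuous\<close>), which solves the equation
  (\<open>ex_radial_solution\<close>, \<open>flow_solves_LB\<close>).

  The density comes from two arguments that apply to every rotation invariant solution.
  Off \<open>C\<close>, mass can only arrive through a collision. By rotation invariance, the velocity after a collision is
  the sum of two independent uniform points on circles with nonzero radii, unless \<open>v = 0\<close>. Such a sum has an
  absolutely continuous law (\<open>nn_integral_two_circles_null\<close>), and the origin is not charged either. So null
  sets off \<open>C\<close> have no mass at any time (\<open>flow_null_off_circle\<close>).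
  On \<open>C\<close>, consider the test function \<open>dist(v, C) powr (- \<gamma> - 1)\<close>. Its exponent is critical. The loss term at
  distance \<open>x\<close> from \<open>C\<close> is of order \<open>x powr (- \<gamma> - 1)\<close> times the total rate \<open>x powr (\<gamma> + 1)\<close>, hence
  bounded; the gain term on \<open>C\<close> is a logarithmically divergent integral. Lipschitz approximations of this
  function (\<open>lyapunov_function\<close>) show that almost every time the solution gives no mass to \<open>C\<close>
  (\<open>AE_flow_circle\<close>). The two statements together give absolute continuity for almost every time.
\<close>

section \<open>Rotations of the plane and collisions\<close>

lemma rotation_component [simp]:
  "rotation \<theta> v $ 1 = cos \<theta> * v $ 1 - sin \<theta> * v $ 2"
  "rotation \<theta> v $ 2 = sin \<theta> * v $ 1 + cos \<theta> * v $ 2"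
  by (simp_all add: rotation_def)

lemma rotation_rotation: "rotation a (rotation b v) = rotation (a + b) v"
  by (simp add: vec_eq_iff forall_2 cos_add sin_add algebra_simps)

lemma rotation_0 [simp]: "rotation 0 v = v"
  by (simp add: vec_eq_iff forall_2)

lemma rotation_of_0 [simp]: "rotation a 0 = 0"
  by (simp add: vec_eq_iff forall_2)

lemma rotation_periodic: "rotation (a + 2 * pi) v = rotation a v"
  by (simp add: vec_eq_iff forall_2)

lemma rotation_add: "rotation a (v + w) = rotation a v + rotation a w"
  and rotation_diff: "rotation a (v - w) = rotation a v - rotation a w"
  and rotation_scaleR: "rotation a (c *\<^sub>R v) = c *\<^sub>R rotation a v"
  by (simp_all add: vec_eq_iff forall_2 algebra_simps)

text \<open>Writing a rotation through the single linear map \<open>rotation (pi/2)\<close> reduces joint continuity and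
joint measurability in the angle and the vector to those of \<open>cos\<close>, \<open>sin\<close> and a linear map.\<close>

lemma rotation_decompose: "rotation \<theta> v = cos \<theta> *\<^sub>R v + sin \<theta> *\<^sub>R rotation (pi/2) v"
  by (simp add: vec_eq_iff forall_2 algebra_simps)

lemma linear_rotation: "linear (rotation a)"
  by (intro linearI rotation_add rotation_scaleR)

lemma continuous_on_rotation [continuous_intros]:
  fixes f :: "'a::t2_space \<Rightarrow> real"
  assumes "continuous_on S f" "continuous_on S g"
  shows "continuous_on S (\<lambda>x. rotation (f x) (g x))"
proof -
  have J: "continuous_on UNIV (rotation (pi/2))"
    using linear_continuous_on linear_conv_bounded_linear linear_rotation by blast
  have "continuous_on S (\<lambda>x. cos (f x) *\<^sub>R g x + sin (f x) *\<^sub>R rotation (pi/2) (g x))"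
    by (intro continuous_intros assms continuous_on_compose2[OF J]) auto
  then show ?thesis by (simp add: rotation_decompose[symmetric])
qed

lemma borel_measurable_rotation [measurable]:
  assumes [measurable]: "f \<in> borel_measurable M" "g \<in> borel_measurable M"
  shows "(\<lambda>x. rotation (f x) (g x)) \<in> borel_measurable M"
proof -
  have [measurable]: "rotation (pi/2) \<in> borel_measurable borel"
    by (intro borel_measurable_continuous_onI continuous_intros)
  show ?thesis by (subst rotation_decompose) measurable
qed

lemma continuous_on_post_velocity [continuous_intros]:
  fixes f :: "'a::t2_space \<Rightarrow> real ^ 2"
  assumes "continuous_on S f" "continuous_on S g" "continuous_on S h"
  shows "continuous_on S (\<lambda>x. post_velocity (f x) (g x) (h x))"
  unfolding post_velocity_def by (intro continuous_intros assms)

lemma borel_measurable_post_velocity [measurable]: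
  assumes [measurable]: "f \<in> borel_measurable M" "g \<in> borel_measurable M" "h \<in> borel_measurable M"
  shows "(\<lambda>x. post_velocity (f x) (g x) (h x)) \<in> borel_measurable M"
  unfolding post_velocity_def by measurable

lemma rotation_post_velocity:
  "rotation a (post_velocity v w \<theta>) = post_velocity (rotation a v) (rotation a w) \<theta>"
  unfolding post_velocity_def
  by (simp add: rotation_add rotation_diff rotation_scaleR rotation_rotation add.commute)

lemma norm_rotation_diff: "norm (rotation a v - rotation a w) = norm (v - w)"
  by (metis rotation_diff norm_rotation)

text \<open>With \<open>d = (v - w) / 2\<close> the two differences are \<open>R d - d\<close> and \<open>R d + d\<close>. The second bound is what
makes the density argument local: a collision with a partner on the circle ends at distance at most
\<open>|v - w|\<close> from the circle, so that a collision that ends far from the circle has a bounded rate.\<close>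

lemma norm_post_velocity_minus:
  shows "norm (post_velocity v w \<theta> - v) \<le> norm (v - w)"
    and "norm (post_velocity v w \<theta> - w) \<le> norm (v - w)"
proof -
  let ?d = "(1/2) *\<^sub>R (v - w)"
  have n: "norm (rotation \<theta> ?d) = norm (v - w) / 2" "norm ?d = norm (v-w) / 2"
    by (simp_all add: norm_rotation)
  have *: "post_velocity v w \<theta> - v = rotation \<theta> ?d - ?d" "post_velocity v w \<theta> - w = rotation \<theta> ?d + ?d"
    by (simp_all add: post_velocity_def vec_eq_iff algebra_simps flip: add_divide_distrib)
  show "norm (post_velocity v w \<theta> - v) \<le> norm (v - w)"
    using norm_triangle_ineq4[of "rotation \<theta> ?d" ?d] n unfolding * by linarith
  show "norm (post_velocity v w \<theta> - w) \<le> norm (v - w)"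
    using norm_triangle_ineq[of "rotation \<theta> ?d" ?d] n unfolding * by linarith
qed

definition east :: "real ^ 2" where "east = vector [1, 0]"

lemma east_component [simp]: "east $ 1 = 1" "east $ 2 = 0"
  by (simp_all add: east_def)

lemma norm_east [simp]: "norm east = 1"
  by (simp add: norm_vec_def L2_set_def sum_2)

lemma polar_form: obtains a where "v = rotation a (norm v *\<^sub>R east)"
proof -
  have "norm v ^ 2 = (v$1)^2 + (v$2)^2"
    by (simp add: norm_vec_def L2_set_def sum_2)
  then have "norm v = sqrt ((v$1)^2 + (v$2)^2)"
    by (metis norm_ge_zero real_sqrt_unique)
  moreover obtain r a where ra: "v$1 = r * cos a" "v$2 = r * sin a"
    using polar_Ex by blast
  moreover have "(r * cos a)^2 + (r * sin a)^2 = r^2"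
    by (simp add: power_mult_distrib flip: distrib_left)
  ultimately have "norm v = \<bar>r\<bar>"
    by simp
  then have "v = rotation (if r < 0 then a + pi else a) (norm v *\<^sub>R east)"
    using ra by (simp add: vec_eq_iff forall_2 mult.commute)
  then show ?thesis by (rule that)
qed

section \<open>The uniform law on a circle and its potentials\<close>

definition angle_law :: "real measure" where
  "angle_law = uniform_measure lborel {0..2 * pi}"

lemma prob_space_angle_law: "prob_space angle_law"
  unfolding angle_law_def by (rule prob_space_uniform_measure) auto

lemma sets_angle_law [measurable_cong]: "sets angle_law = sets borel"
  by (simp add: angle_law_def)

lemma space_angle_law [simp]: "space angle_law = UNIV"
  by (simp add: angle_law_def)

lemma nn_integral_angle_law:
  assumes [measurable]: "f \<in> borel_measurable borel"
  shows "(\<integral>\<^sup>+x. f x \<partial>angle_law) = (\<integral>\<^sup>+x. f x * indicator {0..2*pi} x \<partial>lborel) / ennreal (2*pi)"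
  unfolding angle_law_def by (subst nn_integral_uniform_measure) auto

lemma nn_integral_angle_law_shift:
  fixes f :: "real \<Rightarrow> ennreal"
  assumes f [measurable]: "f \<in> borel_measurable borel" and per: "\<And>x. f (x + 2*pi) = f x"
  shows "(\<integral>\<^sup>+x. f (x + a) \<partial>angle_law) = (\<integral>\<^sup>+x. f x \<partial>angle_law)"
proof -
  have per': "f (2*pi + x) = f x" for x
    using per[of x] by (simp add: add.commute)
  have perk: "f (x + 2*pi * real n) = f x" for x n
  proof (induction n)
    case (Suc n)
    then show ?case using per[of "x + 2*pi * real n"] by (simp add: algebra_simps)
  qed simp
  have peri: "f (x + 2*pi * of_int k) = f x" for x k
  proof (cases k rule: int_cases2)
    case (nonneg n) then show ?thesis using perk[of x n] by simp
  next
    case (nonpos n) then show ?thesis using perk[of "x - 2*pi * real n" n] by simp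
  qed
  \<comment> \<open>reduction of the shift modulo the period to \<open>c \<in> [0, 2\<pi>]\<close>\<close>
  define c where "c = a - 2*pi * of_int \<lfloor>a/(2*pi)\<rfloor>"
  have c: "0 \<le> c" "c \<le> 2*pi"
    using floor_divide_lower[of "2*pi" a] floor_divide_upper[of "2*pi" a]
    by (simp_all add: c_def algebra_simps)
  have fa: "f (x + a) = f (x + c)" for x
    using peri[of "x + c" "\<lfloor>a/(2*pi)\<rfloor>"] by (simp add: c_def algebra_simps)
  have "(\<integral>\<^sup>+x. f (x + a) * indicator {0..2*pi} x \<partial>lborel)
      = (\<integral>\<^sup>+x. f (x + c) * indicator {0..2*pi} x \<partial>lborel)" by (simp only: fa)
  also have "\<dots> = (\<integral>\<^sup>+y. f y * indicator {c..c+2*pi} y \<partial>lborel)"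
    by (subst nn_integral_real_affine[where t=c and c=1])
       (auto simp: indicator_def algebra_simps one_ennreal_def[symmetric] intro!: nn_integral_cong)
  also have "\<dots> = (\<integral>\<^sup>+y. f y * indicator {c..2*pi} y + f y * indicator {2*pi<..2*pi+c} y \<partial>lborel)"
    using c by (intro nn_integral_cong) (auto simp: indicator_def)
  also have "\<dots> = (\<integral>\<^sup>+y. f y * indicator {c..2*pi} y \<partial>lborel) + (\<integral>\<^sup>+y. f y * indicator {2*pi<..2*pi+c} y \<partial>lborel)"
    by (rule nn_integral_add) auto
  also have "(\<integral>\<^sup>+y. f y * indicator {2*pi<..2*pi+c} y \<partial>lborel) = (\<integral>\<^sup>+y. f y * indicator {0<..c} y \<partial>lborel)"
    by (subst nn_integral_real_affine[where t="2*pi" and c=1])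
       (auto simp: indicator_def per' one_ennreal_def[symmetric] intro!: nn_integral_cong)
  also have "(\<integral>\<^sup>+y. f y * indicator {c..2*pi} y \<partial>lborel) + (\<integral>\<^sup>+y. f y * indicator {0<..c} y \<partial>lborel)
    = (\<integral>\<^sup>+y. f y * indicator {c..2*pi} y + f y * indicator {0<..c} y \<partial>lborel)"
    by (rule nn_integral_add[symmetric]) auto
  also have "\<dots> = (\<integral>\<^sup>+y. f y * indicator {0..2*pi} y \<partial>lborel)"
    using c AE_lborel_singleton[of 0] AE_lborel_singleton[of c]
    by (intro nn_integral_cong_AE) (auto simp: indicator_def elim!: eventually_rev_mp)
  finally show ?thesis by (simp add: nn_integral_angle_law)
qed

lemma uniform_circle_altdef:
  "uniform_circle r = distr angle_law borel (\<lambda>\<alpha>. rotation \<alpha> (r *\<^sub>R east))"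
proof -
  have "(\<lambda>\<alpha>. vector [r * cos \<alpha>, r * sin \<alpha>] :: real^2) = (\<lambda>\<alpha>. rotation \<alpha> (r *\<^sub>R east))"
    by (auto simp: fun_eq_iff vec_eq_iff forall_2)
  then show ?thesis unfolding uniform_circle_def angle_law_def by simp
qed

lemma sets_uniform_circle [measurable_cong]: "sets (uniform_circle r) = sets borel"
  by (simp add: uniform_circle_def)

lemma space_uniform_circle [simp]: "space (uniform_circle r) = UNIV"
  by (simp add: uniform_circle_def)

lemma nn_integral_uniform_circle:
  assumes [measurable]: "f \<in> borel_measurable borel"
  shows "(\<integral>\<^sup>+w. f w \<partial>uniform_circle r) = (\<integral>\<^sup>+b. f (rotation b (r *\<^sub>R east)) \<partial>angle_law)"
  unfolding uniform_circle_altdef by (subst nn_integral_distr) auto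

text \<open>Rotation invariance of the law of the collision partner is what makes the whole dynamics
commute with rotations.\<close>

lemma uniform_circle_rotation:
  "distr (uniform_circle r) borel (rotation a) = uniform_circle r"
proof (rule measure_eqI)
  fix A assume "A \<in> sets (distr (uniform_circle r) borel (rotation a))"
  then have [measurable]: "A \<in> sets borel" by simp
  let ?f = "\<lambda>b. indicator A (rotation b (r *\<^sub>R east)) :: ennreal"
  have "emeasure (distr (uniform_circle r) borel (rotation a)) A
      = (\<integral>\<^sup>+w. indicator A (rotation a w) \<partial>uniform_circle r)"
    by (subst nn_integral_indicator[symmetric], simp, subst nn_integral_distr) auto
  also have "\<dots> = (\<integral>\<^sup>+b. ?f (b + a) \<partial>angle_law)"
    by (subst nn_integral_uniform_circle) (simp_all add: rotation_rotation add.commute)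
  also have "\<dots> = (\<integral>\<^sup>+b. ?f b \<partial>angle_law)"
    by (rule nn_integral_angle_law_shift) (auto simp: rotation_periodic)
  also have "\<dots> = emeasure (uniform_circle r) A"
    by (subst nn_integral_uniform_circle[symmetric]) auto
  finally show "emeasure (distr (uniform_circle r) borel (rotation a)) A = emeasure (uniform_circle r) A" .
qed (simp add: uniform_circle_def)

lemma AE_uniform_circle_norm: "0 \<le> r \<Longrightarrow> AE w in uniform_circle r. norm w = r"
  unfolding uniform_circle_altdef by (subst AE_distr_iff) (auto simp: norm_rotation)

text \<open>The constant \<open>1/3\<close> comes from \<open>sin x \<ge> x - x^3 / 6\<close> and \<open>x \<le> 2\<close>.\<close>

lemma sin_ge_third:
  assumes "0 \<le> x" "x \<le> 2" shows "x / 3 \<le> sin (x::real)"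
proof -
  have "\<bar>sin x - x\<bar> \<le> x ^ 3 / 6"
    using Maclaurin_sin_bound[of x 3] assms
    by (simp add: eval_nat_numeral sin_coeff_def mult_ac)
  moreover have "x ^ 3 \<le> 4 * x"
    using mult_mono[of x 2 x 2] assms mult_right_mono[of "x*x" 4 x] by (simp add: power3_eq_cube)
  ultimately show ?thesis by linarith
qed

lemma abs_sin_lower:
  fixes b :: real assumes "b \<in> {0..2*pi}"
  obtains c where "c \<in> {0, pi, 2*pi}" "\<bar>b - c\<bar> \<le> 2" "\<bar>b - c\<bar> / 3 \<le> \<bar>sin b\<bar>"
proof -
  have p: "pi / 2 \<le> 2" using pi_less_4 by simp
  have "\<bar>x\<bar> / 3 \<le> \<bar>sin x\<bar>" if "\<bar>x\<bar> \<le> 2" for x :: real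
    using sin_ge_third[of x] sin_ge_third[of "-x"] that by (cases "x \<ge> 0") (auto simp: abs_if)
  moreover have "\<bar>sin (b - pi)\<bar> = \<bar>sin b\<bar>" "\<bar>sin (b - 2*pi)\<bar> = \<bar>sin b\<bar>" by (simp_all add: sin_diff)
  moreover have "\<bar>b\<bar> \<le> pi/2 \<or> \<bar>b - pi\<bar> \<le> pi/2 \<or> \<bar>b - 2*pi\<bar> \<le> pi/2"
    using assms unfolding atLeastAtMost_iff by arith
  ultimately show ?thesis using that[of 0] that[of pi] that[of "2*pi"] p
    by (metis diff_zero insertCI order_trans)
qed

text \<open>A circle looks one-dimensional from every point of the plane. By rotation invariance \<open>v\<close> may be put on
the first axis; the distance from \<open>v\<close> to the point of angle \<open>b\<close> is then at least \<open>r |sin b|\<close>, which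
grows linearly away from the zeros \<open>0, \<pi>, 2\<pi>\<close> of the sine. These three zeros give three copies of the
integral on the right, and \<open>3 \<le> 2 \<pi>\<close> absorbs them.\<close>

lemma nn_integral_uniform_circle_potential:
  fixes F :: "real \<Rightarrow> ennreal"
  assumes r: "0 < r" and F [measurable]: "F \<in> borel_measurable borel"
    and anti: "\<And>x y. 0 \<le> x \<Longrightarrow> x \<le> y \<Longrightarrow> F y \<le> F x"
  shows "(\<integral>\<^sup>+w. F (norm (v - w)) \<partial>uniform_circle r)
     \<le> (\<integral>\<^sup>+y. F (r / 3 * \<bar>y\<bar>) * indicator {-2..2} y \<partial>lborel)" (is "_ \<le> ?I")
proof -
  obtain a where a: "v = rotation a (norm v *\<^sub>R east)" by (rule polar_form)
  let ?G = "\<lambda>b. F (norm (norm v *\<^sub>R east - rotation b (r *\<^sub>R east)))"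
  let ?J = "\<lambda>y. F (r / 3 * \<bar>y\<bar>) * indicator {-2..2} y"
  have "F (norm (v - rotation b (r *\<^sub>R east))) = ?G (b + (- a))" for b
    using norm_rotation_diff[of a "norm v *\<^sub>R east" "rotation (b - a) (r *\<^sub>R east)"] a
    by (simp add: rotation_rotation)
  then have "(\<integral>\<^sup>+w. F (norm (v - w)) \<partial>uniform_circle r) = (\<integral>\<^sup>+b. ?G (b + (- a)) \<partial>angle_law)"
    by (subst nn_integral_uniform_circle) auto
  also have "\<dots> = (\<integral>\<^sup>+b. ?G b \<partial>angle_law)"
    by (rule nn_integral_angle_law_shift) (auto simp: rotation_periodic)
  also have "\<dots> = (\<integral>\<^sup>+b. ?G b * indicator {0..2*pi} b \<partial>lborel) / ennreal (2*pi)"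
    by (rule nn_integral_angle_law) measurable
  finally have eq: "(\<integral>\<^sup>+w. F (norm (v - w)) \<partial>uniform_circle r)
      = (\<integral>\<^sup>+b. ?G b * indicator {0..2*pi} b \<partial>lborel) / ennreal (2*pi)" .
  have "(\<integral>\<^sup>+b. ?G b * indicator {0..2*pi} b \<partial>lborel)
      \<le> (\<integral>\<^sup>+b. ?J (b - 0) + (?J (b - pi) + ?J (b - 2*pi)) \<partial>lborel)"
  proof (rule nn_integral_mono)
    fix b :: real
    show "?G b * indicator {0..2*pi} b \<le> ?J (b - 0) + (?J (b - pi) + ?J (b - 2*pi))"
    proof (cases "b \<in> {0..2*pi}")
      case True
      then obtain c where c: "c \<in> {0, pi, 2*pi}" "\<bar>b - c\<bar> \<le> 2" "\<bar>b - c\<bar> / 3 \<le> \<bar>sin b\<bar>"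
        by (rule abs_sin_lower)
      have "r / 3 * \<bar>b - c\<bar> \<le> r * \<bar>sin b\<bar>"
        using mult_left_mono[OF c(3), of r] r by simp
      also have "\<dots> = \<bar>(norm v *\<^sub>R east - rotation b (r *\<^sub>R east)) $ 2\<bar>"
        using r by (simp add: abs_mult)
      also have "\<dots> \<le> norm (norm v *\<^sub>R east - rotation b (r *\<^sub>R east))"
        by (rule component_le_norm_cart)
      finally have "?G b \<le> F (r / 3 * \<bar>b - c\<bar>)" using r by (intro anti) auto
      then have le: "?G b * indicator {0..2*pi} b \<le> ?J (b - c)"
        using True c(2) by (auto simp: indicator_def abs_le_iff)
      have J: "?J (b - c) \<le> ?J (b - 0) + (?J (b - pi) + ?J (b - 2*pi))" if "c = 0 \<or> c = pi \<or> c = 2*pi"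
      proof -
        have "x \<le> x + (y + z)" "y \<le> x + (y + z)" "z \<le> x + (y + z)" for x y z :: ennreal
          by (simp_all add: add_increasing add_increasing2)
        with that show ?thesis by fast
      qed
      show ?thesis using le J c(1) by (meson insertE order_trans singletonD)
    qed simp
  qed
  also have "\<dots> = ?I + (?I + ?I)"
  proof -
    have "(\<integral>\<^sup>+b. ?J (b - c) \<partial>lborel) = ?I" for c
      by (subst nn_integral_real_affine[where t=c and c=1]) (auto simp: one_ennreal_def[symmetric])
    moreover have "(\<integral>\<^sup>+b. ?J (b - 0) + (?J (b - pi) + ?J (b - 2*pi)) \<partial>lborel)
       = (\<integral>\<^sup>+b. ?J (b - 0) \<partial>lborel) + ((\<integral>\<^sup>+b. ?J (b - pi) \<partial>lborel) + (\<integral>\<^sup>+b. ?J (b - 2*pi) \<partial>lborel))"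
      by (subst nn_integral_add; measurable; subst nn_integral_add; measurable; simp)
    ultimately show ?thesis by metis
  qed
  also have "\<dots> = ennreal 3 * ?I"
  proof -
    have "x + (x + x) = ennreal 3 * x" for x
    proof -
      have "x + (x + x) = (1 + (1 + 1)) * x" by (simp only: distrib_right mult_1_left)
      also have "1 + (1 + 1) = ennreal 3" by simp
      finally show ?thesis .
    qed
    then show ?thesis .
  qed
  also have "\<dots> \<le> ennreal (2*pi) * ?I"
    using pi_gt3 by (intro mult_right_mono ennreal_leI) auto
  finally show ?thesis
    unfolding eq by (intro divide_le_posI_ennreal) auto
qed


lemma nn_integral_lborel_even:
  fixes f :: "real \<Rightarrow> ennreal"
  assumes [measurable]: "f \<in> borel_measurable borel"
  shows "(\<integral>\<^sup>+x. f x + f (- x) \<partial>lborel) = 2 * (\<integral>\<^sup>+x. f x \<partial>lborel)"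
proof -
  have "(\<integral>\<^sup>+x. f (- x) \<partial>lborel) = (\<integral>\<^sup>+x. f x \<partial>lborel)"
    by (subst (2) nn_integral_real_affine[where t=0 and c="-1"]) (auto simp: one_ennreal_def[symmetric])
  then show ?thesis by (subst nn_integral_add) (auto simp: mult_2)
qed

text \<open>Powers above \<open>-1\<close> are integrable in dimension one. Giving the potential the value \<open>\<infinity>\<close> at distance \<open>0\<close>
makes the profile monotone and shows at the same time that the circle law has no atoms.\<close>

lemma uniform_circle_power_potential:
  assumes r: "0 < r" and p: "-1 < p" "p < 0"
  obtains \<kappa> where "0 \<le> \<kappa>"
    "\<And>v. (\<integral>\<^sup>+w. ennreal (norm (v - w) powr p) \<partial>uniform_circle r) \<le> ennreal \<kappa>"
    "\<And>v. AE w in uniform_circle r. w \<noteq> v"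
proof -
  define F where "F = (\<lambda>z::real. if z = 0 then \<infinity> else ennreal (z powr p))"
  have [measurable]: "F \<in> borel_measurable borel" unfolding F_def by measurable
  define f where "f = (\<lambda>y::real. ennreal ((r/3) powr p) * ennreal (indicator {0..2} y * y powr p))"
  have [measurable]: "f \<in> borel_measurable borel" unfolding f_def by measurable
  define \<kappa> where "\<kappa> = 2 * ((r/3) powr p * (2 powr (p+1) / (p+1)))"
  have f: "(\<integral>\<^sup>+y. f y \<partial>lborel) = ennreal ((r/3) powr p * (2 powr (p+1) / (p+1)))"
    unfolding f_def using p
    by (subst nn_integral_cmult, simp, subst nn_integral_has_integral_lebesgue[OF _ has_integral_powr_from_0])
       (auto simp: ennreal_mult[symmetric])
  have "(\<integral>\<^sup>+w. F (norm (v - w)) \<partial>uniform_circle r) \<le> ennreal \<kappa>" for v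
  proof -
    have "(\<integral>\<^sup>+w. F (norm (v - w)) \<partial>uniform_circle r)
     \<le> (\<integral>\<^sup>+y. F (r / 3 * \<bar>y\<bar>) * indicator {-2..2} y \<partial>lborel)"
      by (rule nn_integral_uniform_circle_potential[OF r])
         (use p in \<open>auto simp: F_def intro!: ennreal_leI powr_mono2'\<close>)
    also have "\<dots> \<le> (\<integral>\<^sup>+y. f y + f (- y) \<partial>lborel)"
    proof (rule nn_integral_mono_AE, use AE_lborel_singleton[of 0] in eventually_elim)
      fix y :: real assume "y \<noteq> 0"
      then show "F (r / 3 * \<bar>y\<bar>) * indicator {- 2..2} y \<le> f y + f (- y)"
        using r by (auto simp: F_def f_def indicator_def abs_if powr_mult powr_divide simp flip: ennreal_mult)
    qed
    also have "\<dots> = ennreal \<kappa>"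
      by (subst nn_integral_lborel_even, measurable, unfold f \<kappa>_def, subst (2) ennreal_mult') auto
    finally show ?thesis .
  qed
  note * = this
  show ?thesis
  proof (rule that[of \<kappa>])
    show "0 \<le> \<kappa>" using p by (simp add: \<kappa>_def)
    show "(\<integral>\<^sup>+w. ennreal (norm (v - w) powr p) \<partial>uniform_circle r) \<le> ennreal \<kappa>" for v
      using *[of v] by (rule order_trans[rotated]) (auto simp: F_def intro!: nn_integral_mono)
    show "AE w in uniform_circle r. w \<noteq> v" for v
    proof -
      have "AE w in uniform_circle r. F (norm (v - w)) \<noteq> \<infinity>"
        using *[of v] by (intro nn_integral_PInf_AE) (auto simp: top_unique)
      then show ?thesis by eventually_elim (auto simp: F_def)
    qed
  qed
qed

lemma AE_uniform_circle_neq: "0 < r \<Longrightarrow> AE w in uniform_circle r. w \<noteq> v"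
  by (rule uniform_circle_power_potential[of r "-1/2"]) auto

text \<open>Below the power \<open>-1\<close> the potential is infinite on the circle. At distance \<open>x\<close> from the circle all
distances are at least \<open>x\<close>, and the scaling \<open>y = (3 x / r) z\<close> of the integral of \<open>max x (r |y| / 3) powr g\<close>
yields the factor \<open>x powr (g + 1)\<close>.\<close>

lemma uniform_circle_singular_potential:
  assumes r: "0 < r" and g: "g < -1"
  obtains c where "0 \<le> c"
    "\<And>v. norm v \<noteq> r \<Longrightarrow> (\<integral>\<^sup>+w. ennreal (norm (v - w) powr g) \<partial>uniform_circle r)
         \<le> ennreal (c * \<bar>norm v - r\<bar> powr (g + 1))"
proof -
  define f where "f = (\<lambda>z::real. ennreal (indicator {0..1} z) + ennreal (indicator {1..} z * z powr g))"
  have [measurable]: "f \<in> borel_measurable borel" unfolding f_def by measurable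
  define D where "D = - (1 powr (g+1)) / (g+1)"
  have D: "0 \<le> D" using g by (simp add: D_def field_simps)
  define I where "I = 1 + D"
  have I0: "0 \<le> I" using D by (simp add: I_def)
  have "(\<integral>\<^sup>+z. ennreal (indicator {0..1::real} z) \<partial>lborel) = 1"
    by (simp add: ennreal_indicator)
  moreover have "(\<integral>\<^sup>+z. ennreal (indicator {1..} z * z powr g) \<partial>lborel) = ennreal D"
    unfolding D_def using g by (intro nn_integral_has_integral_lebesgue has_integral_powr_to_inf) auto
  ultimately have f: "(\<integral>\<^sup>+z. f z \<partial>lborel) = ennreal I"
    using D unfolding f_def I_def by (subst nn_integral_add) (auto simp: ennreal_plus simp flip: ennreal_1)
  define c where "c = 2 * (I * (3 / r))"
  have "(\<integral>\<^sup>+w. ennreal (norm (v - w) powr g) \<partial>uniform_circle r)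
         \<le> ennreal (c * \<bar>norm v - r\<bar> powr (g + 1))" if "norm v \<noteq> r" for v
  proof -
    define x where "x = \<bar>norm v - r\<bar>"
    have x: "0 < x" using that by (simp add: x_def)
    let ?F = "\<lambda>z. ennreal (max x z powr g)"
    have "(\<integral>\<^sup>+w. ennreal (norm (v - w) powr g) \<partial>uniform_circle r) \<le> (\<integral>\<^sup>+w. ?F (norm (v - w)) \<partial>uniform_circle r)"
    proof (rule nn_integral_mono_AE, use AE_uniform_circle_norm[OF less_imp_le[OF r]] in eventually_elim)
      fix w :: "real^2" assume "norm w = r"
      then have "x \<le> norm (v - w)" unfolding x_def using norm_triangle_ineq3 by metis
      then show "ennreal (norm (v - w) powr g) \<le> ?F (norm (v - w))" by (simp add: max_absorb2)
    qed
    also have "\<dots> \<le> (\<integral>\<^sup>+y. ?F (r / 3 * \<bar>y\<bar>) * indicator {-2..2} y \<partial>lborel)"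
      by (rule nn_integral_uniform_circle_potential[OF r])
         (use g x in \<open>auto intro!: ennreal_leI powr_mono2'\<close>)
    also have "\<dots> \<le> (\<integral>\<^sup>+y. ?F (r / 3 * \<bar>y\<bar>) \<partial>lborel)"
      by (intro nn_integral_mono) (auto simp: indicator_def)
    also have "\<dots> = ennreal (3 * x / r) * (\<integral>\<^sup>+z. ?F (x * \<bar>z\<bar>) \<partial>lborel)"
      using x r by (subst nn_integral_real_affine[where t=0 and c="3 * x / r"]) (auto simp: abs_mult)
    also have "\<dots> \<le> ennreal (3 * x / r) * (\<integral>\<^sup>+z. ennreal (x powr g) * (f z + f (- z)) \<partial>lborel)"
    proof (intro mult_left_mono nn_integral_mono)
      fix z :: real
      have "max x (x * \<bar>z\<bar>) = x * max 1 \<bar>z\<bar>" using x by (auto simp: max_def mult_le_cancel_left1)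
      then have "?F (x * \<bar>z\<bar>) = ennreal (x powr g) * ennreal (max 1 \<bar>z\<bar> powr g)"
        using x by (simp add: powr_mult ennreal_mult)
      also have "ennreal (max 1 \<bar>z\<bar> powr g) \<le> f z + f (- z)"
        by (auto simp: f_def indicator_def max_def abs_if split: if_splits)
      finally show "?F (x * \<bar>z\<bar>) \<le> ennreal (x powr g) * (f z + f (- z))" 
        by (simp add: mult_left_mono)
    qed auto
    also have "\<dots> = ennreal (c * x powr (g + 1))"
      using x r I0
      by (subst nn_integral_cmult, simp, subst nn_integral_lborel_even)
         (auto simp: f c_def powr_add ennreal_mult[symmetric] mult_ac simp del: ennreal_numeral simp flip: ennreal_numeral)
    finally show ?thesis by (simp add: x_def)
  qed
  then show ?thesis using that[of c] r I0 by (auto simp: c_def)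
qed

section \<open>Sums of two uniform points on circles\<close>

lemma borel_measurable_vec_nth [measurable]:
  fixes f :: "'a \<Rightarrow> real ^ 'n"
  assumes [measurable]: "f \<in> borel_measurable M"
  shows "(\<lambda>x. f x $ i) \<in> borel_measurable M"
  using borel_measurable_inner[OF assms borel_measurable_const[of "axis i 1"]] by (simp add: inner_axis)

lemma borel_measurable_vector2 [measurable]:
  fixes f g :: "'a \<Rightarrow> real"
  assumes [measurable]: "f \<in> borel_measurable M" "g \<in> borel_measurable M"
  shows "(\<lambda>x. vector [f x, g x] :: real ^ 2) \<in> borel_measurable M"
proof -
  have "(\<lambda>x. vector [f x, g x] :: real ^ 2) = (\<lambda>x. f x *\<^sub>R axis 1 1 + g x *\<^sub>R axis 2 1)"
    by (auto simp: fun_eq_iff vec_eq_iff forall_2 axis_def)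
  then show ?thesis by simp
qed

lemma lborel_vec2: "(lborel :: (real^2) measure) = distr (lborel \<Otimes>\<^sub>M lborel) borel (\<lambda>(x, y). vector [x, y])"
proof (rule lborel_eqI)
  fix l u :: "real^2"
  assume lu: "\<And>b. b \<in> Basis \<Longrightarrow> l \<bullet> b \<le> u \<bullet> b"
  have B: "Basis = {axis 1 1, axis 2 1 :: real^2}"
    by (auto simp: Basis_vec_def UNIV_2)
  have le: "l $ 1 \<le> u $ 1" "l $ 2 \<le> u $ 2"
    using lu[of "axis 1 1"] lu[of "axis 2 1"] by (auto simp: B inner_axis)
  have "(\<lambda>(x, y). vector [x, y] :: real^2) -` box l u \<inter> space (lborel \<Otimes>\<^sub>M lborel) = {l$1<..<u$1} \<times> {l$2<..<u$2}"
    by (auto simp: mem_box B inner_axis space_pair_measure)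
  then show "emeasure (distr (lborel \<Otimes>\<^sub>M lborel) borel (\<lambda>(x, y). vector [x, y])) (box l u) = ennreal (\<Prod>b\<in>Basis. (u - l) \<bullet> b)"
    using le by (subst emeasure_distr) 
      (auto simp: lborel.emeasure_pair_measure_Times B inner_axis axis_eq_axis ennreal_mult)
qed simp

text \<open>The points \<open>p e\<^sub>a + q e\<^sub>b\<close> in the coordinates \<open>a\<close> and \<open>b - a\<close>: in this moving frame the
modulus depends on the second coordinate only, which makes injectivity easy.\<close>

definition two_circles :: "real \<Rightarrow> real \<Rightarrow> real^2 \<Rightarrow> real^2" where
  "two_circles p q x = rotation (x $ 1) (p *\<^sub>R east + rotation (x $ 2) (q *\<^sub>R east))"

lemma two_circles_component:
  "two_circles p q x $ 1 = p * cos (x $ 1) + q * cos (x $ 1 + x $ 2)"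
  "two_circles p q x $ 2 = p * sin (x $ 1) + q * sin (x $ 1 + x $ 2)"
  by (simp_all add: two_circles_def cos_add sin_add algebra_simps)

definition two_circles_deriv :: "real \<Rightarrow> real \<Rightarrow> real^2 \<Rightarrow> real^2 \<Rightarrow> real^2" where
  "two_circles_deriv p q x h = vector
     [- p * sin (x $ 1) * h $ 1 - q * sin (x $ 1 + x $ 2) * (h $ 1 + h $ 2),
      p * cos (x $ 1) * h $ 1 + q * cos (x $ 1 + x $ 2) * (h $ 1 + h $ 2)]"

lemma two_circles_has_derivative:
  "(two_circles p q has_derivative two_circles_deriv p q x) (at x within S)"
proof -
  have B: "Basis = {axis 1 1, axis 2 1 :: real^2}"
    by (auto simp: Basis_vec_def UNIV_2)
  have [derivative_intros]: "((\<lambda>x. x $ i) has_derivative (\<lambda>h. h $ i)) (at x within S)" for i :: 2 and x :: "real^2"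
    by (rule bounded_linear_imp_has_derivative[OF bounded_linear_vec_nth])
  show ?thesis
    by (subst has_derivative_componentwise_within)
       (auto simp: B inner_axis two_circles_component two_circles_deriv_def algebra_simps
         intro!: derivative_eq_intros)
qed

text \<open>The map is degenerate only where the two summands are parallel.\<close>

lemma det_two_circles_deriv: "det (matrix (two_circles_deriv p q x)) = p * q * sin (x $ 2)"
proof -
  have "det (matrix (two_circles_deriv p q x))
      = p * q * (sin (x $ 1 + x $ 2) * cos (x $ 1) - cos (x $ 1 + x $ 2) * sin (x $ 1))"
    by (simp add: det_2 matrix_def two_circles_deriv_def axis_def algebra_simps)
  then show ?thesis by (simp flip: sin_diff)
qed

lemma rotation_inj:
  assumes "z \<noteq> 0" "rotation a z = rotation b z" "\<bar>a - b\<bar> < 2 * pi"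
  shows "a = b"
proof -
  have "rotation (a - b) z = z"
    using arg_cong[OF assms(2), of "rotation (-b)"] by (simp add: rotation_rotation)
  moreover have "norm (rotation (a - b) z - z)^2 = (2 - 2 * cos (a - b)) * norm z ^ 2"
  proof -
    have "(cos t * x - sin t * y - x)^2 + (sin t * x + cos t * y - y)^2
        = ((sin t)^2 + (cos t)^2 + 1 - 2 * cos t) * (x^2 + y^2)" for t x y :: real
      by algebra
    then show ?thesis by (simp add: norm_vec_def L2_set_def sum_2)
  qed
  ultimately have "cos (a - b) = 1" using assms(1) by simp
  then obtain n :: int where "a - b = of_int n * 2 * pi" using cos_one_2pi_int by blast
  with assms(3) have "n = 0"
    by (simp add: abs_mult)
  with \<open>a - b = _\<close> show ?thesis by simp
qed

text \<open>The law of cosines recovers the angle between the summands from the modulus of the sum, once a half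
period is fixed; the direction of the sum then recovers the first angle.\<close>

lemma two_circles_inj:
  assumes "p \<noteq> 0" "q \<noteq> 0"
    and S: "\<And>x. x \<in> S \<Longrightarrow> x $ 1 \<in> {0<..<2*pi}"
    and c: "(\<forall>x\<in>S. x $ 2 \<in> {0<..<pi}) \<or> (\<forall>x\<in>S. x $ 2 \<in> {pi<..<2*pi})"
  shows "inj_on (two_circles p q) S"
proof (rule inj_onI)
  fix x y assume x: "x \<in> S" and y: "y \<in> S" and eq: "two_circles p q x = two_circles p q y"
  have n: "norm (two_circles p q x)^2 = p^2 + q^2 + 2 * p * q * cos (x$2)" for x
  proof -
    have "norm (two_circles p q x)^2 = (p + q * cos (x$2))^2 + (q * sin (x$2))^2"
      unfolding two_circles_def norm_rotation by (simp add: norm_vec_def L2_set_def sum_2 mult.commute)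
    also have "\<dots> = p^2 + q^2 * ((sin (x$2))^2 + (cos (x$2))^2) + 2 * p * q * cos (x$2)" by algebra
    finally show ?thesis by simp
  qed
  have cc: "cos (x$2) = cos (y$2)" using n[of x] n[of y] eq assms(1,2) by simp
  have 2: "x$2 = y$2"
    using c
  proof
    assume "\<forall>x\<in>S. x $ 2 \<in> {0<..<pi}"
    then have "0 < x$2" "x$2 < pi" "0 < y$2" "y$2 < pi" using x y by auto
    with cc show ?thesis using cos_inj_pi[of "x$2" "y$2"] by linarith
  next
    assume *: "\<forall>x\<in>S. x $ 2 \<in> {pi<..<2*pi}"
    then have "pi < x$2" "x$2 < 2*pi" "pi < y$2" "y$2 < 2*pi" using x y by auto
    moreover have "cos (2*pi - x$2) = cos (2*pi - y$2)" using cc by (simp add: cos_diff)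
    ultimately show ?thesis using cos_inj_pi[of "2*pi - x$2" "2*pi - y$2"] by linarith
  qed
  have "sin (x$2) \<noteq> 0"
    using c x sin_gt_zero[of "x$2"] sin_lt_zero[of "x$2"] by fastforce
  then have "(p *\<^sub>R east + rotation (x $ 2) (q *\<^sub>R east)) $ 2 \<noteq> 0" using assms(2) by simp
  then have "p *\<^sub>R east + rotation (x $ 2) (q *\<^sub>R east) \<noteq> 0" by (metis zero_index)
  then have "x$1 = y$1"
    using eq 2 S[OF x] S[OF y] by (intro rotation_inj) (auto simp: two_circles_def)
  with 2 show "x = y" by (simp add: vec_eq_iff forall_2)
qed

text \<open>The image of the preimage lies in the null set \<open>K\<close>, so the change of variables formula makes the
integral of the Jacobian over the preimage vanish, while the Jacobian is positive there.\<close>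

lemma two_circles_preimage_null:
  assumes pq: "p \<noteq> 0" "q \<noteq> 0" and K: "K \<in> null_sets lborel"
    and S: "\<And>x. x \<in> S \<Longrightarrow> x $ 1 \<in> {0<..<2*pi}" "S \<in> sets borel"
    and c: "(\<forall>x\<in>S. x $ 2 \<in> {0<..<pi}) \<or> (\<forall>x\<in>S. x $ 2 \<in> {pi<..<2*pi})"
  shows "{x \<in> S. two_circles p q x \<in> K} \<in> null_sets lborel"
proof -
  let ?T = "{x \<in> S. two_circles p q x \<in> K}"
  have [measurable]: "two_circles p q \<in> borel_measurable borel"
    by (intro borel_measurable_continuous_onI has_derivative_continuous_on[OF two_circles_has_derivative])
  have T [measurable]: "?T \<in> sets borel"
  proof -
    have "?T = S \<inter> (two_circles p q -` K \<inter> space borel)" by auto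
    also have "\<dots> \<in> sets borel" using K S(2) by (intro sets.Int measurable_sets[of _ borel borel]) auto
    finally show ?thesis .
  qed
  have inj: "inj_on (two_circles p q) ?T"
    by (rule inj_on_subset[OF two_circles_inj[OF pq S(1) c]]) auto
  have "two_circles p q ` ?T \<in> null_sets lebesgue"
    using K by (auto intro: null_sets_completion_subset[of _ K] null_sets_completionI)
  then have "two_circles p q ` ?T \<in> lmeasurable \<and> measure lebesgue (two_circles p q ` ?T) = 0"
    by (auto simp: fmeasurable_def measure_def null_sets_def)
  then have "((\<lambda>x. \<bar>det (matrix (two_circles_deriv p q x))\<bar>) has_integral 0) ?T"
    by (subst (asm) has_measure_differentiable_image[OF _ two_circles_has_derivative inj]) (use T in auto)
  then have "((\<lambda>x. if x \<in> ?T then \<bar>det (matrix (two_circles_deriv p q x))\<bar> else 0) has_integral 0) UNIV"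
    by (subst has_integral_restrict_UNIV)
  then have "(\<integral>\<^sup>+x. ennreal (if x \<in> ?T then \<bar>det (matrix (two_circles_deriv p q x))\<bar> else 0) \<partial>lborel) = 0"
    by (subst (asm) has_integral_iff_nn_integral_lebesgue) (auto simp: nn_integral_completion)
  then have "AE x in lborel. ennreal (if x \<in> ?T then \<bar>det (matrix (two_circles_deriv p q x))\<bar> else 0) = 0"
    using T by (subst (asm) nn_integral_0_iff_AE) (simp_all only: det_two_circles_deriv, measurable)
  then have "AE x in lborel. x \<notin> ?T"
  proof eventually_elim
    case (elim x)
    have "sin (x$2) \<noteq> 0" if "x \<in> ?T"
      using c that sin_gt_zero[of "x$2"] sin_lt_zero[of "x$2"] by fastforce
    then show ?case using elim pq by (auto simp: det_two_circles_deriv split: if_splits)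
  qed
  then show ?thesis using T by (simp add: AE_iff_null_sets)
qed

text \<open>The sum of independent uniform points on two circles centred at the origin has a law that is
absolutely continuous: this is the only source of densities in the whole argument.\<close>

lemma nn_integral_two_circles_null:
  assumes pq: "p \<noteq> 0" "q \<noteq> 0" and K: "K \<in> null_sets lborel"
  shows "(\<integral>\<^sup>+a. \<integral>\<^sup>+b. indicator K (rotation a (p *\<^sub>R east) + rotation b (q *\<^sub>R east)) \<partial>angle_law \<partial>angle_law) = 0"
proof -
  have [measurable]: "K \<in> sets borel" using K by auto
  have [measurable]: "two_circles p q \<in> borel_measurable borel"
    by (intro borel_measurable_continuous_onI has_derivative_continuous_on[OF two_circles_has_derivative])
  interpret A: prob_space angle_law by (rule prob_space_angle_law)
  let ?S = "{x::real^2. x $ 1 \<in> {0..2*pi} \<and> x $ 2 \<in> {0..2*pi}}"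
  let ?S1 = "{x::real^2. x $ 1 \<in> {0<..<2*pi} \<and> x $ 2 \<in> {0<..<pi}}"
  let ?S2 = "{x::real^2. x $ 1 \<in> {0<..<2*pi} \<and> x $ 2 \<in> {pi<..<2*pi}}"
  have line: "AE x in lborel. x $ i \<noteq> c" for i :: 2 and c :: real
  proof -
    have "negligible {x::real^2. axis i 1 \<bullet> x = c}"
      by (rule negligible_hyperplane) (simp add: axis_eq_0_iff)
    then have "AE x in lebesgue. x $ i \<noteq> c"
      by (subst (asm) negligible_iff_null_sets, intro AE_I'[where N="{x::real^2. axis i 1 \<bullet> x = c}"])
         (auto simp: inner_axis')
    then show ?thesis by (simp add: AE_completion_iff)
  qed
  have 1: "AE x in lborel. x \<notin> {x \<in> ?S1. two_circles p q x \<in> K}"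
    by (rule AE_not_in, rule two_circles_preimage_null[OF pq K]) auto
  have 2: "AE x in lborel. x \<notin> {x \<in> ?S2. two_circles p q x \<in> K}"
    by (rule AE_not_in, rule two_circles_preimage_null[OF pq K]) auto
  have "AE x in lborel. x \<in> ?S \<longrightarrow> two_circles p q x \<notin> K"
    using 1 2 line[of 1 0] line[of 1 "2*pi"] line[of 2 0] line[of 2 pi] line[of 2 "2*pi"]
    by eventually_elim (auto simp: less_le)
  then have "(\<integral>\<^sup>+x. indicator ?S x * indicator K (two_circles p q x) \<partial>lborel) = 0"
    by (subst nn_integral_0_iff_AE) (auto simp: indicator_def elim!: eventually_mono)
  then have 0: "(\<integral>\<^sup>+x. (\<integral>\<^sup>+y. indicator ?S (vector [x,y]) * indicator K (two_circles p q (vector [x,y])) \<partial>lborel) \<partial>lborel) = 0"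
    by (subst (asm) lborel_vec2, subst (asm) nn_integral_distr)
       (auto simp: lborel.nn_integral_fst[symmetric])
  let ?I = "\<lambda>a b. indicator K (rotation a (p *\<^sub>R east) + rotation b (q *\<^sub>R east)) :: ennreal"
  have "(\<integral>\<^sup>+b. ?I a b \<partial>angle_law) = (\<integral>\<^sup>+b. indicator K (two_circles p q (vector [a, b])) \<partial>angle_law)" for a
    by (subst nn_integral_angle_law_shift[of _ a, symmetric])
       (auto simp: rotation_periodic two_circles_def rotation_add rotation_rotation add.commute)
  then have "(\<integral>\<^sup>+a. \<integral>\<^sup>+b. ?I a b \<partial>angle_law \<partial>angle_law)
     = (\<integral>\<^sup>+a. \<integral>\<^sup>+b. indicator K (two_circles p q (vector [a, b])) \<partial>angle_law \<partial>angle_law)" by simp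
  also have "\<dots> = 0"
  proof -
    have "AE x in lborel. (\<integral>\<^sup>+y. indicator ?S (vector [x,y]) * indicator K (two_circles p q (vector [x,y])) \<partial>lborel) = 0"
      using 0 by (subst (asm) nn_integral_0_iff_AE) auto
    then have "AE a in lborel. (\<integral>\<^sup>+b. indicator K (two_circles p q (vector [a, b])) \<partial>angle_law) * indicator {0..2*pi} a = 0"
    proof eventually_elim
      case (elim a)
      show ?case
      proof (cases "a \<in> {0..2*pi}")
        case True
        then have "(\<integral>\<^sup>+b. indicator K (two_circles p q (vector [a, b])) * indicator {0..2*pi} b \<partial>lborel) = 0"
          by (subst elim[symmetric], intro nn_integral_cong) (auto simp: indicator_def)
        then show ?thesis by (subst nn_integral_angle_law) auto
      qed simp
    qed
    then have "(\<integral>\<^sup>+a. (\<integral>\<^sup>+b. indicator K (two_circles p q (vector [a, b])) \<partial>angle_law) * indicator {0..2*pi} a \<partial>lborel) = 0"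
      by (subst nn_integral_0_iff_AE) auto
    then show ?thesis by (subst nn_integral_angle_law) auto
  qed
  finally show ?thesis .
qed

section \<open>The collision generator\<close>

text \<open>The rates that are dominated by the true collision rate; the bound for the generator is uniform over
them, which is how it carries over from the truncated dynamics to the limit. At \<open>x = 0\<close> the value of
\<open>x powr \<gamma>\<close> is \<open>0\<close> by convention, hence the restriction to \<open>x > 0\<close>.\<close>

definition admissible :: "real \<Rightarrow> (real \<Rightarrow> real) \<Rightarrow> bool" where
  "admissible \<gamma> k \<longleftrightarrow> k \<in> borel_measurable borel \<and> (\<forall>x. 0 \<le> k x) \<and> (\<forall>x>0. k x \<le> x powr \<gamma>)"

definition cutoff :: "real \<Rightarrow> real \<Rightarrow> real \<Rightarrow> real" where
  "cutoff \<gamma> \<delta> x = max \<delta> x powr \<gamma>"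

locale lin_boltzmann =
  fixes \<gamma> \<Lambda> r0 :: real and \<beta> :: "real measure"
  assumes gamma: "- 2 < \<gamma>" "\<gamma> < - 1"
    and sets_beta: "sets \<beta> = sets angles"
    and mass_beta: "emeasure \<beta> (space \<beta>) = ennreal \<Lambda>"
    and Lambda_pos: "0 < \<Lambda>" and r0_pos: "0 < r0"
begin

abbreviation f0 :: "(real ^ 2) measure" where "f0 \<equiv> uniform_circle r0"

definition marks :: "((real ^ 2) \<times> real) measure" where "marks = f0 \<Otimes>\<^sub>M \<beta>"

text \<open>The generator of the dynamics, with a general function \<open>k\<close> of the relative speed as the collision rate.\<close>

definition gen :: "(real \<Rightarrow> real) \<Rightarrow> (real ^ 2 \<Rightarrow> real) \<Rightarrow> real ^ 2 \<Rightarrow> real" where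
  "gen k \<phi> v = (LINT z|marks. k (norm (v - fst z)) * (\<phi> (post_velocity v (fst z) (snd z)) - \<phi> v))"

abbreviation full :: "real \<Rightarrow> real" where "full x \<equiv> x powr \<gamma>"

lemma space_beta: "space \<beta> = {- pi / 2 .. pi / 2} - {0}"
  using sets_eq_imp_space_eq[OF sets_beta] by (simp add: angles_def space_restrict_space)

lemma measurable_beta [measurable]: "(\<lambda>\<theta>. \<theta>) \<in> \<beta> \<rightarrow>\<^sub>M borel"
  unfolding measurable_cong_sets[OF sets_beta refl] angles_def by (rule measurable_restrict_space1) simp

sublocale f0: prob_space f0 by (rule prob_space_uniform_circle)

sublocale beta: finite_measure \<beta>
  by (rule finite_measureI) (simp add: mass_beta)

sublocale f0_beta: pair_sigma_finite f0 \<beta> ..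

lemma emeasure_marks: "emeasure marks (space marks) = ennreal \<Lambda>"
  unfolding marks_def space_pair_measure
  by (subst beta.emeasure_pair_measure_Times) (auto simp: mass_beta f0.emeasure_space_1[simplified])

sublocale marks: finite_measure marks
  by (rule finite_measureI) (simp add: emeasure_marks)

lemma measure_marks: "measure marks (space marks) = \<Lambda>"
  using emeasure_marks Lambda_pos by (simp add: measure_def)

lemma sets_marks [measurable_cong]: "sets marks = sets (borel \<Otimes>\<^sub>M \<beta>)"
  unfolding marks_def by (intro sets_pair_measure_cong) (simp_all add: sets_uniform_circle)

lemma measurable_snd_marks [measurable]: "snd \<in> marks \<rightarrow>\<^sub>M borel"
proof -
  have "snd \<in> marks \<rightarrow>\<^sub>M \<beta>" by measurable
  from measurable_comp[OF this measurable_beta] show ?thesis by (simp add: o_def)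
qed

lemma nn_integral_marks_fst:
  assumes [measurable]: "f \<in> borel_measurable borel"
  shows "(\<integral>\<^sup>+z. f (fst z) \<partial>marks) = ennreal \<Lambda> * (\<integral>\<^sup>+w. f w \<partial>f0)"
  unfolding marks_def
  by (subst beta.nn_integral_fst[symmetric]) (auto simp: mass_beta nn_integral_cmult mult.commute)

lemma AE_marks_fst:
  assumes [measurable]: "Measurable.pred borel P" and "AE w in f0. P w"
  shows "AE z in marks. P (fst z)"
  unfolding marks_def
proof (rule f0_beta.AE_pair_measure)
  show "AE x in f0. AE y in \<beta>. P (fst (x, y))" using assms(2) by (auto elim: eventually_mono)
qed simp

definition kappa :: "real \<Rightarrow> real" where
  "kappa p = (SOME c. 0 \<le> c \<and> (\<forall>v. (\<integral>\<^sup>+w. ennreal (norm (v - w) powr p) \<partial>f0) \<le> ennreal c))"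

lemma kappa:
  assumes "-1 < p" "p < 0"
  shows "0 \<le> kappa p" "(\<integral>\<^sup>+w. ennreal (norm (v - w) powr p) \<partial>f0) \<le> ennreal (kappa p)"
proof -
  have "\<exists>c. 0 \<le> c \<and> (\<forall>v. (\<integral>\<^sup>+w. ennreal (norm (v - w) powr p) \<partial>f0) \<le> ennreal c)"
    by (rule uniform_circle_power_potential[OF r0_pos assms]) blast
  from someI_ex[OF this, folded kappa_def]
  show "0 \<le> kappa p" "(\<integral>\<^sup>+w. ennreal (norm (v - w) powr p) \<partial>f0) \<le> ennreal (kappa p)" by auto
qed

lemma marks_power:
  assumes p: "-1 < p" "p < 0"
  shows "integrable marks (\<lambda>z. norm (v - fst z) powr p)"
    and "(LINT z|marks. norm (v - fst z) powr p) \<le> \<Lambda> * kappa p"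
proof -
  have le: "(\<integral>\<^sup>+z. ennreal (norm (v - fst z) powr p) \<partial>marks) \<le> ennreal (\<Lambda> * kappa p)"
    using kappa[OF p] Lambda_pos
    by (subst nn_integral_marks_fst) (auto simp: ennreal_mult intro!: mult_left_mono)
  show int: "integrable marks (\<lambda>z. norm (v - fst z) powr p)"
    using le by (intro integrableI_nonneg) (auto simp: less_top[symmetric] top_unique)
  show "(LINT z|marks. norm (v - fst z) powr p) \<le> \<Lambda> * kappa p"
    using le kappa(1)[OF p] Lambda_pos by (subst (asm) nn_integral_eq_integral[OF int]) auto
qed

lemma admissible_full: "admissible \<gamma> full"
  by (simp add: admissible_def)

lemma admissible_cutoff: "0 < \<delta> \<Longrightarrow> admissible \<gamma> (cutoff \<gamma> \<delta>)"
  using gamma by (auto simp: admissible_def cutoff_def[abs_def] intro!: powr_mono2')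

lemma post_velocity_same [simp]: "post_velocity v v \<theta> = v"
  by (simp add: post_velocity_def flip: scaleR_2)

text \<open>A collision moves \<open>v\<close> by at most \<open>|v - w|\<close>. This gains one power, and \<open>\<gamma> + 1 > -1\<close> is integrable
against the circle law: the generator is bounded on Lipschitz functions although the total collision
rate is infinite on the circle.\<close>

lemma collision_integrand_bound:
  assumes L: "L-lipschitz_on UNIV \<phi>" and k: "admissible \<gamma> k"
  shows "\<bar>k (norm (v - w)) * (\<phi> (post_velocity v w \<theta>) - \<phi> v)\<bar> \<le> L * norm (v - w) powr (\<gamma> + 1)"
proof (cases "v = w")
  case False
  then have n: "0 < norm (v - w)" by simp
  have "\<bar>\<phi> (post_velocity v w \<theta>) - \<phi> v\<bar> \<le> L * norm (post_velocity v w \<theta> - v)"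
    using lipschitz_onD[OF L, of "post_velocity v w \<theta>" v] by (simp add: dist_norm)
  also have "\<dots> \<le> L * norm (v - w)"
    using norm_post_velocity_minus(1) lipschitz_on_nonneg[OF L] by (intro mult_left_mono)
  finally have 1: "\<bar>\<phi> (post_velocity v w \<theta>) - \<phi> v\<bar> \<le> L * norm (v - w)" .
  have "\<bar>k (norm (v - w)) * (\<phi> (post_velocity v w \<theta>) - \<phi> v)\<bar> \<le> norm (v - w) powr \<gamma> * (L * norm (v - w))"
    unfolding abs_mult using k n 1 by (intro mult_mono) (auto simp: admissible_def)
  also have "\<dots> = L * norm (v - w) powr (\<gamma> + 1)"
    using n by (simp add: powr_add)
  finally show ?thesis .
qed simp

lemma lipschitz_borel_measurable: "L-lipschitz_on UNIV \<phi> \<Longrightarrow> \<phi> \<in> borel_measurable borel"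
  by (intro borel_measurable_continuous_onI lipschitz_on_continuous_on)

lemma collision_integrand_integrable:
  assumes L: "L-lipschitz_on UNIV \<phi>" and k: "admissible \<gamma> k"
  shows "integrable marks (\<lambda>z. k (norm (v - fst z)) * (\<phi> (post_velocity v (fst z) (snd z)) - \<phi> v))"
proof (rule Bochner_Integration.integrable_bound)
  show "integrable marks (\<lambda>z. L * norm (v - fst z) powr (\<gamma> + 1))"
    using gamma by (intro integrable_mult_right marks_power) auto
  have [measurable]: "\<phi> \<in> borel_measurable borel" "k \<in> borel_measurable borel"
    using lipschitz_borel_measurable[OF L] k by (auto simp: admissible_def)
  show "(\<lambda>z. k (norm (v - fst z)) * (\<phi> (post_velocity v (fst z) (snd z)) - \<phi> v)) \<in> borel_measurable marks"
    by measurable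
  show "AE z in marks. norm (k (norm (v - fst z)) * (\<phi> (post_velocity v (fst z) (snd z)) - \<phi> v)) \<le> norm (L * norm (v - fst z) powr (\<gamma> + 1))"
    using collision_integrand_bound[OF L k] lipschitz_on_nonneg[OF L] by auto
qed

definition gbound :: "real \<Rightarrow> real" where "gbound L = L * (\<Lambda> * kappa (\<gamma> + 1))"

lemma gbound_nonneg: "0 \<le> L \<Longrightarrow> 0 \<le> gbound L"
  using kappa(1)[of "\<gamma>+1"] gamma Lambda_pos by (simp add: gbound_def)

lemma gen_bound:
  assumes L: "L-lipschitz_on UNIV \<phi>" and k: "admissible \<gamma> k"
  shows "\<bar>gen k \<phi> v\<bar> \<le> gbound L"
proof -
  have "\<bar>gen k \<phi> v\<bar> \<le> (LINT z|marks. \<bar>k (norm (v - fst z)) * (\<phi> (post_velocity v (fst z) (snd z)) - \<phi> v)\<bar>)"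
    unfolding gen_def by (rule integral_abs_bound)
  also have "\<dots> \<le> (LINT z|marks. L * norm (v - fst z) powr (\<gamma> + 1))"
    using gamma by (intro integral_mono integrable_abs collision_integrand_integrable[OF L k]
      integrable_mult_right marks_power collision_integrand_bound[OF L k]) auto
  also have "\<dots> \<le> gbound L"
    using gamma lipschitz_on_nonneg[OF L] marks_power(2)[of "\<gamma>+1" v]
    by (auto simp: gbound_def intro!: mult_left_mono)
  finally show ?thesis .
qed

lemma gen_measurable [measurable]:
  assumes [measurable]: "\<phi> \<in> borel_measurable borel" "k \<in> borel_measurable borel"
  shows "gen k \<phi> \<in> borel_measurable borel"
  unfolding gen_def[abs_def] by measurable

lemma marks_rotation: "distr marks marks (\<lambda>z. (rotation a (fst z), snd z)) = marks"
proof -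
  have [measurable]: "rotation a \<in> borel_measurable borel" by measurable
  have id: "distr \<beta> \<beta> (\<lambda>x. x) = \<beta>" by (rule distr_id2) simp
  have f: "distr f0 f0 (rotation a) = f0"
    using uniform_circle_rotation[of r0 a]
    by (simp add: distr_cong[OF refl sets_uniform_circle refl])
  have "distr f0 f0 (rotation a) \<Otimes>\<^sub>M distr \<beta> \<beta> (\<lambda>x. x) = distr (f0 \<Otimes>\<^sub>M \<beta>) (f0 \<Otimes>\<^sub>M \<beta>) (\<lambda>(x, y). (rotation a x, y))"
    by (rule pair_measure_distr) (auto simp: id intro: beta.sigma_finite_measure_axioms)
  then show ?thesis by (simp add: id f marks_def case_prod_unfold)
qed

text \<open>Rotating \<open>v\<close> and the partner simultaneously commutes with the collision and preserves the law of
the partner.\<close>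

lemma gen_rotation:
  assumes [measurable]: "\<phi> \<in> borel_measurable borel" "k \<in> borel_measurable borel"
  shows "gen k \<phi> (rotation a v) = gen k (\<lambda>v. \<phi> (rotation a v)) v"
proof -
  have "gen k \<phi> (rotation a v) = (LINT z|distr marks marks (\<lambda>z. (rotation a (fst z), snd z)).
       k (norm (rotation a v - fst z)) * (\<phi> (post_velocity (rotation a v) (fst z) (snd z)) - \<phi> (rotation a v)))"
    unfolding gen_def marks_rotation ..
  also have "\<dots> = gen k (\<lambda>v. \<phi> (rotation a v)) v"
    unfolding gen_def
    by (subst integral_distr) (auto simp: norm_rotation_diff rotation_post_velocity)
  finally show ?thesis .
qed

text \<open>The truncation only changes the collisions with \<open>|v - w| < \<delta>\<close>. Half of the available margin
\<open>\<gamma> + 2\<close> in the exponent is spent on the power of \<open>\<delta>\<close>; the other half keeps the exponent \<open>\<gamma> / 2\<close>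
above \<open>-1\<close>.\<close>

lemma cutoff_close:
  assumes L: "L-lipschitz_on UNIV \<phi>" and d: "0 < \<delta>"
  shows "\<bar>gen (cutoff \<gamma> \<delta>) \<phi> v - gen full \<phi> v\<bar> \<le> L * (\<Lambda> * kappa (\<gamma> / 2)) * \<delta> powr ((\<gamma> + 2) / 2)"
proof -
  let ?k = "cutoff \<gamma> \<delta>" and ?\<Delta> = "\<lambda>z. \<phi> (post_velocity v (fst z) (snd z)) - \<phi> v"
  have L0: "0 \<le> L" using lipschitz_on_nonneg[OF L] .
  have pt: "\<bar>?k (norm (v - fst z)) * ?\<Delta> z - full (norm (v - fst z)) * ?\<Delta> z\<bar>
      \<le> L * \<delta> powr ((\<gamma> + 2) / 2) * norm (v - fst z) powr (\<gamma> / 2)" for z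
  proof (cases "norm (v - fst z) < \<delta> \<and> v \<noteq> fst z")
    case True
    then have n: "0 < norm (v - fst z)" "norm (v - fst z) < \<delta>" by auto
    have "?k (norm (v - fst z)) * ?\<Delta> z - full (norm (v - fst z)) * ?\<Delta> z
       = (?k (norm (v - fst z)) - full (norm (v - fst z))) * ?\<Delta> z" by (simp add: algebra_simps)
    moreover have "admissible \<gamma> (\<lambda>x. full x - min (full x) (?k x))"
      by (auto simp: admissible_def cutoff_def[abs_def])
    moreover have "min (full (norm (v - fst z))) (?k (norm (v - fst z))) = ?k (norm (v - fst z))"
      using admissible_cutoff[OF d] n by (intro min_absorb2) (auto simp: admissible_def)
    ultimately have "\<bar>?k (norm (v - fst z)) * ?\<Delta> z - full (norm (v - fst z)) * ?\<Delta> z\<bar>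
       \<le> L * norm (v - fst z) powr (\<gamma> + 1)"
      using collision_integrand_bound[OF L, of "\<lambda>x. full x - min (full x) (?k x)" v "fst z" "snd z"]
      by (simp add: abs_mult abs_minus_commute)
    also have "norm (v - fst z) powr (\<gamma> + 1) = norm (v - fst z) powr ((\<gamma> + 2) / 2) * norm (v - fst z) powr (\<gamma> / 2)"
      by (simp add: powr_add[symmetric] add_divide_distrib)
    also have "L * \<dots> \<le> L * (\<delta> powr ((\<gamma> + 2) / 2) * norm (v - fst z) powr (\<gamma> / 2))"
      using n gamma L0 by (intro mult_left_mono mult_right_mono powr_mono2) auto
    finally show ?thesis by simp
  next
    case False
    then show ?thesis using L0 by (auto simp: cutoff_def max_absorb2)
  qed
  have i: "integrable marks (\<lambda>z. ?k (norm (v - fst z)) * ?\<Delta> z)" "integrable marks (\<lambda>z. full (norm (v - fst z)) * ?\<Delta> z)"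
    using collision_integrand_integrable[OF L] admissible_full admissible_cutoff[OF d] by auto
  have "\<bar>gen ?k \<phi> v - gen full \<phi> v\<bar> = \<bar>LINT z|marks. ?k (norm (v - fst z)) * ?\<Delta> z - full (norm (v - fst z)) * ?\<Delta> z\<bar>"
    unfolding gen_def by (subst Bochner_Integration.integral_diff[OF i]) simp
  also have "\<dots> \<le> (LINT z|marks. \<bar>?k (norm (v - fst z)) * ?\<Delta> z - full (norm (v - fst z)) * ?\<Delta> z\<bar>)"
    by (rule integral_abs_bound)
  also have "\<dots> \<le> (LINT z|marks. L * \<delta> powr ((\<gamma> + 2) / 2) * norm (v - fst z) powr (\<gamma> / 2))"
    using gamma by (intro integral_mono integrable_abs Bochner_Integration.integrable_diff i integrable_mult_right marks_power pt) auto
  also have "\<dots> \<le> (L * \<delta> powr ((\<gamma> + 2) / 2)) * (\<Lambda> * kappa (\<gamma> / 2))"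
    using gamma L0 marks_power(2)[of "\<gamma>/2" v] by (auto intro!: mult_left_mono)
  finally show ?thesis by (simp add: mult_ac)
qed

lemma continuous_gen_cutoff:
  assumes c: "continuous_on UNIV \<phi>" and B: "\<And>v. \<bar>\<phi> v\<bar> \<le> B" and d: "0 < \<delta>"
  shows "continuous_on UNIV (gen (cutoff \<gamma> \<delta>) \<phi>)"
    and "\<bar>gen (cutoff \<gamma> \<delta>) \<phi> v\<bar> \<le> 2 * B * \<delta> powr \<gamma> * \<Lambda>"
proof -
  let ?f = "\<lambda>v z. cutoff \<gamma> \<delta> (norm (v - fst z)) * (\<phi> (post_velocity v (fst z) (snd z)) - \<phi> v)"
  have [measurable]: "\<phi> \<in> borel_measurable borel" "cutoff \<gamma> \<delta> \<in> borel_measurable borel"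
    using c admissible_cutoff[OF d] by (auto intro: borel_measurable_continuous_onI simp: admissible_def)
  have bnd: "\<bar>?f v z\<bar> \<le> \<delta> powr \<gamma> * (2 * B)" for v z
    unfolding abs_mult
  proof (intro mult_mono)
    show "\<bar>cutoff \<gamma> \<delta> (norm (v - fst z))\<bar> \<le> \<delta> powr \<gamma>"
      using gamma d by (auto simp: cutoff_def intro!: powr_mono2')
    show "\<bar>\<phi> (post_velocity v (fst z) (snd z)) - \<phi> v\<bar> \<le> 2 * B"
      using B[of v] B[of "post_velocity v (fst z) (snd z)"] by (simp add: abs_le_iff)
  qed auto
  show "continuous_on UNIV (gen (cutoff \<gamma> \<delta>) \<phi>)"
    unfolding continuous_on_eq_continuous_at[OF open_UNIV]
  proof (intro ballI, unfold continuous_at_sequentially, intro allI impI)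
    fix a and x :: "nat \<Rightarrow> real^2" assume x: "x \<longlonglongrightarrow> a"
    show "(gen (cutoff \<gamma> \<delta>) \<phi> \<circ> x) \<longlonglongrightarrow> gen (cutoff \<gamma> \<delta>) \<phi> a"
      unfolding gen_def o_def
    proof (rule integral_dominated_convergence[where w="\<lambda>_. \<delta> powr \<gamma> * (2 * B)"])
      show "AE z in marks. (\<lambda>i. ?f (x i) z) \<longlonglongrightarrow> ?f a z"
      proof (rule AE_I2)
        fix z
        have "continuous_on UNIV (\<lambda>v. ?f v z)"
          unfolding cutoff_def using d
          by (intro continuous_intros continuous_on_compose2[OF c]) (auto simp: max_def)
        then have "isCont (\<lambda>v. ?f v z) a" by (simp add: continuous_on_eq_continuous_at)
        then show "(\<lambda>i. ?f (x i) z) \<longlonglongrightarrow> ?f a z"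
          using x by (rule isCont_tendsto_compose)
      qed
    qed (use bnd in auto)
  qed
  have "\<bar>gen (cutoff \<gamma> \<delta>) \<phi> v\<bar> \<le> (LINT z|marks. \<bar>?f v z\<bar>)"
    unfolding gen_def by (rule integral_abs_bound)
  also have "\<dots> \<le> (LINT z|marks. \<delta> powr \<gamma> * (2 * B))"
  proof (rule integral_mono)
    show "integrable marks (\<lambda>z. \<bar>?f v z\<bar>)"
      by (rule marks.integrable_const_bound[where B="\<delta> powr \<gamma> * (2 * B)"]) (use bnd in auto)
  qed (use bnd in auto)
  finally show "\<bar>gen (cutoff \<gamma> \<delta>) \<phi> v\<bar> \<le> 2 * B * \<delta> powr \<gamma> * \<Lambda>"
    by (simp add: measure_marks mult_ac)
qed

text \<open>A uniform limit of the truncated generators, whose kernels are bounded and which therefore preserve continuity.\<close>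

lemma continuous_gen_full:
  assumes L: "L-lipschitz_on UNIV \<phi>" and B: "\<And>v. \<bar>\<phi> v\<bar> \<le> B"
  shows "continuous_on UNIV (gen full \<phi>)"
proof (rule uniform_limit_theorem)
  let ?d = "\<lambda>n. inverse (real (Suc n))"
  let ?c = "L * (\<Lambda> * kappa (\<gamma> / 2))"
  show "\<forall>\<^sub>F n in sequentially. continuous_on UNIV (gen (cutoff \<gamma> (?d n)) \<phi>)"
    by (intro always_eventually allI continuous_gen_cutoff(1)[OF _ B] lipschitz_on_continuous_on[OF L]) auto
  have lim: "(\<lambda>n. ?c * ?d n powr ((\<gamma> + 2) / 2)) \<longlonglongrightarrow> ?c * 0"
    using gamma by (intro tendsto_mult tendsto_const tendsto_zero_powrI[OF LIMSEQ_inverse_real_of_nat]) auto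
  show "uniform_limit UNIV (\<lambda>n. gen (cutoff \<gamma> (?d n)) \<phi>) (gen full \<phi>) sequentially"
  proof (rule uniform_limitI)
    fix e :: real assume "0 < e"
    then have "\<forall>\<^sub>F n in sequentially. ?c * ?d n powr ((\<gamma> + 2) / 2) < e"
      using lim by (intro order_tendstoD) auto
    then show "\<forall>\<^sub>F n in sequentially. \<forall>v\<in>UNIV. dist (gen (cutoff \<gamma> (?d n)) \<phi> v) (gen full \<phi> v) < e"
    proof eventually_elim
      case (elim n)
      show ?case using cutoff_close[OF L, of "?d n"] elim
        by (auto simp: dist_real_def intro: le_less_trans)
    qed
  qed
qed auto

lemma collision_op_eq:
  "collision_op \<gamma> \<beta> \<phi> v w = (LINT \<theta>|\<beta>. full (norm (v - w)) * (\<phi> (post_velocity v w \<theta>) - \<phi> v))"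
  by (auto simp: collision_op_def)

lemma integral_collision_op:
  assumes L: "L-lipschitz_on UNIV \<phi>"
  shows "(LINT w|f0. collision_op \<gamma> \<beta> \<phi> v w) = gen full \<phi> v"
  using f0_beta.integral_fst'[OF collision_integrand_integrable[OF L admissible_full, of v, unfolded marks_def]]
  by (simp add: gen_def collision_op_eq marks_def)

end

section \<open>A Markov chain with truncated rates\<close>

lemma (in prob_space) abs_expectation_le:
  fixes f :: "'a \<Rightarrow> real"
  assumes [measurable]: "f \<in> borel_measurable M" and B: "\<And>x. \<bar>f x\<bar> \<le> B"
  shows "\<bar>expectation f\<bar> \<le> B"
proof -
  have "\<bar>expectation f\<bar> \<le> expectation (\<lambda>x. \<bar>f x\<bar>)" by (rule integral_abs_bound)
  also have "\<dots> \<le> expectation (\<lambda>x. B)"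
  proof (rule integral_mono)
    show "integrable M (\<lambda>x. \<bar>f x\<bar>)" using B by (intro integrable_const_bound[where B=B]) auto
  qed (use B in auto)
  finally show ?thesis by (simp add: prob_space)
qed

text \<open>For a rotation invariant law, the integral of a test function only depends on its means over circles.
This reduces weak convergence in the plane to weak convergence of laws of the modulus on the line.\<close>

definition circle_mean :: "(real ^ 2 \<Rightarrow> real) \<Rightarrow> real \<Rightarrow> real" where
  "circle_mean \<phi> \<rho> = (LINT v|uniform_circle \<rho>. \<phi> v)"

lemma circle_mean_altdef:
  assumes [measurable]: "\<phi> \<in> borel_measurable borel"
  shows "circle_mean \<phi> \<rho> = (LINT a|angle_law. \<phi> (rotation a (\<rho> *\<^sub>R east)))"
  unfolding circle_mean_def uniform_circle_altdef by (subst integral_distr) auto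

lemma circle_mean_polar:
  assumes [measurable]: "\<phi> \<in> borel_measurable borel"
  shows "(LINT a|angle_law. \<phi> (rotation a v)) = circle_mean \<phi> (norm v)"
proof -
  obtain b where b: "v = rotation b (norm v *\<^sub>R east)" by (rule polar_form)
  have "circle_mean \<phi> (norm v) = (LINT v|distr (uniform_circle (norm v)) borel (rotation b). \<phi> v)"
    unfolding uniform_circle_rotation circle_mean_def ..
  also have "\<dots> = circle_mean (\<lambda>v. \<phi> (rotation b v)) (norm v)"
    by (subst integral_distr) (auto simp: circle_mean_def)
  also have "\<dots> = (LINT a|angle_law. \<phi> (rotation a (rotation b (norm v *\<^sub>R east))))"
    by (subst circle_mean_altdef) (auto simp: rotation_rotation add.commute)
  also have "\<dots> = (LINT a|angle_law. \<phi> (rotation a v))"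
    unfolding b[symmetric] ..
  finally show ?thesis by simp
qed

lemma circle_mean_bound:
  assumes "\<phi> \<in> borel_measurable borel" "\<And>v. \<bar>\<phi> v\<bar> \<le> B"
  shows "\<bar>circle_mean \<phi> \<rho>\<bar> \<le> B"
proof -
  interpret prob_space "uniform_circle \<rho>" by (rule prob_space_uniform_circle)
  show ?thesis unfolding circle_mean_def using assms by (intro abs_expectation_le) auto
qed

lemma isCont_circle_mean:
  assumes c: "continuous_on UNIV \<phi>" and B: "\<And>v. \<bar>\<phi> v\<bar> \<le> B"
  shows "isCont (circle_mean \<phi>) \<rho>"
proof (unfold continuous_at_sequentially, intro allI impI)
  interpret prob_space angle_law by (rule prob_space_angle_law)
  have [measurable]: "\<phi> \<in> borel_measurable borel" using c by (rule borel_measurable_continuous_onI)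
  fix x :: "nat \<Rightarrow> real" assume x: "x \<longlonglongrightarrow> \<rho>"
  show "(circle_mean \<phi> \<circ> x) \<longlonglongrightarrow> circle_mean \<phi> \<rho>"
    unfolding o_def circle_mean_altdef[OF \<open>\<phi> \<in> borel_measurable borel\<close>]
  proof (rule integral_dominated_convergence[where w="\<lambda>_. B"])
    show "AE a in angle_law. (\<lambda>i. \<phi> (rotation a (x i *\<^sub>R east))) \<longlonglongrightarrow> \<phi> (rotation a (\<rho> *\<^sub>R east))"
    proof (rule AE_I2)
      fix a
      have "continuous_on UNIV (\<lambda>\<rho>. \<phi> (rotation a (\<rho> *\<^sub>R east)))"
        by (intro continuous_on_compose2[OF c] continuous_intros) auto
      then have "isCont (\<lambda>\<rho>. \<phi> (rotation a (\<rho> *\<^sub>R east))) \<rho>" by (simp add: continuous_on_eq_continuous_at)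
      then show "(\<lambda>i. \<phi> (rotation a (x i *\<^sub>R east))) \<longlonglongrightarrow> \<phi> (rotation a (\<rho> *\<^sub>R east))"
        using x by (rule isCont_tendsto_compose)
    qed
  qed (use B in auto)
qed

context lin_boltzmann
begin

definition cutoff_radius :: "nat \<Rightarrow> real" where "cutoff_radius m = inverse (real (Suc m))"

text \<open>The time step is chosen so small that the truncated rate times the time step is at most \<open>1 / \<Lambda>\<close>,
the total mass of the clock below; \<open>\<gamma> > -2\<close> makes the square of the truncation radius sufficient.\<close>

definition tick :: "nat \<Rightarrow> real" where "tick m = (cutoff_radius m)\<^sup>2 / \<Lambda>"

abbreviation kern :: "nat \<Rightarrow> real \<Rightarrow> real" where "kern m \<equiv> cutoff \<gamma> (cutoff_radius m)"

definition clock :: "real measure" where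
  "clock = density lborel (indicator {0..1 / \<Lambda>})"

abbreviation noise :: "(((real ^ 2) \<times> real) \<times> real) measure" where
  "noise \<equiv> marks \<Otimes>\<^sub>M clock"

text \<open>One step of the chain proposes a mark \<open>z = (w, \<theta>)\<close> under a measure of mass \<open>\<Lambda>\<close> and accepts it if the
clock \<open>u\<close>, of mass \<open>1 / \<Lambda>\<close>, lies below the rate times the time step. Marks and clock together form a
probability measure.\<close>

definition jump :: "nat \<Rightarrow> (real ^ 2) \<times> ((real ^ 2) \<times> real) \<times> real \<Rightarrow> real ^ 2" where
  "jump m = (\<lambda>(v, z, u). if u < tick m * kern m (norm (v - fst z))
     then post_velocity v (fst z) (snd z) else v)"

primrec chain :: "nat \<Rightarrow> nat \<Rightarrow> (real ^ 2) measure" where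
  "chain m 0 = f0"
| "chain m (Suc k) = distr (chain m k \<Otimes>\<^sub>M (marks \<Otimes>\<^sub>M clock)) borel (jump m)"

lemma cutoff_radius: "0 < cutoff_radius m" "cutoff_radius m \<le> 1"
  by (auto simp: cutoff_radius_def field_simps)

lemma cutoff_radius_tendsto: "cutoff_radius \<longlonglongrightarrow> 0"
  unfolding cutoff_radius_def[abs_def] by (rule LIMSEQ_inverse_real_of_nat)

lemma tick_pos: "0 < tick m"
  using cutoff_radius[of m] Lambda_pos by (simp add: tick_def)

lemma tick_tendsto: "tick \<longlonglongrightarrow> 0"
  unfolding tick_def[abs_def] using tendsto_divide[OF tendsto_power[OF cutoff_radius_tendsto, of 2] tendsto_const[of \<Lambda>]] Lambda_pos
  by simp

lemma admissible_kern: "admissible \<gamma> (kern m)"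
  by (rule admissible_cutoff) (rule cutoff_radius)

lemma kern_measurable [measurable]: "kern m \<in> borel_measurable borel"
  using admissible_kern by (simp add: admissible_def)

lemma tick_kern: "0 \<le> tick m * kern m x" "tick m * kern m x \<le> 1 / \<Lambda>"
proof -
  show "0 \<le> tick m * kern m x" using tick_pos[of m] by (simp add: cutoff_def)
  have "kern m x \<le> cutoff_radius m powr \<gamma>"
    using gamma cutoff_radius[of m] by (auto simp: cutoff_def intro!: powr_mono2')
  also have "\<dots> \<le> cutoff_radius m powr (- 2)"
    using gamma cutoff_radius[of m] by (intro powr_mono') auto
  also have "\<dots> = 1 / (cutoff_radius m)\<^sup>2"
    using cutoff_radius[of m] by (simp add: powr_minus_divide)
  finally have "tick m * kern m x \<le> tick m * (1 / (cutoff_radius m)\<^sup>2)"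
    using tick_pos[of m] by (intro mult_left_mono) auto
  then show "tick m * kern m x \<le> 1 / \<Lambda>" using cutoff_radius[of m] by (simp add: tick_def)
qed

lemma sets_clock [measurable_cong]: "sets clock = sets borel" and space_clock [simp]: "space clock = UNIV"
  by (simp_all add: clock_def)

lemma emeasure_clock: "emeasure clock UNIV = ennreal (1 / \<Lambda>)"
  using Lambda_pos by (simp add: clock_def emeasure_density)

lemma emeasure_clock_lessThan:
  assumes "0 \<le> x" "x \<le> 1 / \<Lambda>" shows "emeasure clock {..<x} = ennreal x"
proof -
  have "emeasure clock {..<x} = (\<integral>\<^sup>+u. indicator {0..<x} u \<partial>lborel)"
    unfolding clock_def using assms
    by (subst emeasure_density, simp, simp, intro nn_integral_cong) (auto simp: indicator_def)
  then show ?thesis using assms by simp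
qed

sublocale clock: finite_measure clock
  by (rule finite_measureI) (simp add: emeasure_clock)

sublocale mc: pair_sigma_finite marks clock ..

sublocale noise: prob_space "marks \<Otimes>\<^sub>M clock"
  by (rule prob_spaceI)
     (use Lambda_pos in \<open>simp add: space_pair_measure clock.emeasure_pair_measure_Times emeasure_marks emeasure_clock flip: ennreal_mult\<close>)

lemma jump_measurable [measurable]: "jump m \<in> borel_measurable (borel \<Otimes>\<^sub>M (marks \<Otimes>\<^sub>M clock))"
  unfolding jump_def case_prod_unfold by measurable

lemma sets_chain [measurable_cong]: "sets (chain m k) = sets borel"
  by (cases k) (simp_all add: sets_uniform_circle)

lemma space_chain [simp]: "space (chain m k) = UNIV"
  using sets_eq_imp_space_eq[OF sets_chain] by simp

lemma prob_space_chain: "prob_space (chain m k)"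
proof (induction k)
  case (Suc k)
  interpret M: prob_space "chain m k" by fact
  interpret pair_prob_space "chain m k" "marks \<Otimes>\<^sub>M clock" ..
  show ?case by (simp, rule prob_space_distr) measurable
qed (simp add: f0.prob_space_axioms)

lemma integral_noise_jump:
  assumes [measurable]: "\<phi> \<in> borel_measurable borel" and B: "\<And>v. \<bar>\<phi> v\<bar> \<le> B"
  shows "(LINT n|noise. \<phi> (jump m (v, n))) = \<phi> v + tick m * gen (kern m) \<phi> v"
proof -
  let ?\<Delta> = "\<lambda>z. \<phi> (post_velocity v (fst z) (snd z)) - \<phi> v"
  let ?k = "\<lambda>z. kern m (norm (v - fst z))"
  have int: "integrable (marks \<Otimes>\<^sub>M clock) (\<lambda>n. \<phi> (jump m (v, n)))"
    using B by (intro noise.integrable_const_bound[where B=B]) auto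
  have inner: "(LINT u|clock. \<phi> (jump m (v, z, u))) = \<phi> v / \<Lambda> + tick m * (?k z * ?\<Delta> z)" for z
  proof -
    have "(LINT u|clock. \<phi> (jump m (v, z, u))) = (LINT u|clock. \<phi> v + indicator {..< tick m * ?k z} u * ?\<Delta> z)"
      by (intro Bochner_Integration.integral_cong) (auto simp: jump_def indicator_def)
    also have "\<dots> = \<phi> v / \<Lambda> + tick m * ?k z * ?\<Delta> z"
    proof -
      have m1: "measure clock {..<tick m * ?k z} = tick m * ?k z"
        using emeasure_clock_lessThan[OF tick_kern] tick_kern(1) by (simp add: measure_def)
      have m2: "measure clock UNIV = 1 / \<Lambda>"
        using emeasure_clock Lambda_pos by (simp add: measure_def)
      have i: "integrable clock (\<lambda>u. indicator {..<tick m * ?k z} u * ?\<Delta> z)"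
        by (intro integrable_mult_left integrable_real_indicator) (auto simp: less_top[symmetric])
      show ?thesis
        by (subst Bochner_Integration.integral_add[OF _ i]) (simp_all add: m1 m2)
    qed
    finally show ?thesis by simp
  qed
  have "\<bar>?k z * ?\<Delta> z\<bar> \<le> cutoff_radius m powr \<gamma> * (2 * B)" for z
    unfolding abs_mult
  proof (intro mult_mono)
    show "\<bar>?k z\<bar> \<le> cutoff_radius m powr \<gamma>"
      using gamma cutoff_radius[of m] by (auto simp: cutoff_def intro!: powr_mono2')
    show "\<bar>?\<Delta> z\<bar> \<le> 2 * B"
      using B[of v] B[of "post_velocity v (fst z) (snd z)"] by (simp add: abs_le_iff)
  qed auto
  then have i: "integrable marks (\<lambda>z. ?k z * ?\<Delta> z)"
    by (intro marks.integrable_const_bound[where B="cutoff_radius m powr \<gamma> * (2 * B)"]) auto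
  have "(LINT n|noise. \<phi> (jump m (v, n))) = (LINT z|marks. LINT u|clock. \<phi> (jump m (v, z, u)))"
    using mc.integral_fst'[OF int] by simp
  also have "\<dots> = \<phi> v + tick m * gen (kern m) \<phi> v"
    unfolding inner using i Lambda_pos
    by (subst Bochner_Integration.integral_add) (auto simp: measure_marks gen_def)
  finally show ?thesis .
qed

lemma gen_kern_bounded:
  assumes [measurable]: "\<phi> \<in> borel_measurable borel" and B: "\<And>v. \<bar>\<phi> v\<bar> \<le> B"
  shows "\<bar>tick m * gen (kern m) \<phi> v\<bar> \<le> 2 * B"
proof -
  have "\<bar>LINT n|noise. \<phi> (jump m (v, n))\<bar> \<le> B"
    using B by (intro noise.abs_expectation_le) auto
  then have "\<bar>\<phi> v + tick m * gen (kern m) \<phi> v\<bar> \<le> B"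
    by (simp add: integral_noise_jump[OF assms])
  then show ?thesis using B[of v] by linarith
qed

text \<open>A step of the chain is an exact Euler step for the truncated equation.\<close>

lemma chain_step:
  assumes [measurable]: "\<phi> \<in> borel_measurable borel" and B: "\<And>v. \<bar>\<phi> v\<bar> \<le> B"
  shows "(LINT v|chain m (Suc k). \<phi> v) = (LINT v|chain m k. \<phi> v) + tick m * (LINT v|chain m k. gen (kern m) \<phi> v)"
proof -
  interpret M: prob_space "chain m k" by (rule prob_space_chain)
  interpret P: pair_prob_space "chain m k" "marks \<Otimes>\<^sub>M clock" ..
  have i: "integrable (chain m k \<Otimes>\<^sub>M (marks \<Otimes>\<^sub>M clock)) (\<lambda>x. \<phi> (jump m x))"
    using B by (intro P.integrable_const_bound[where B=B]) auto
  have "(LINT v|chain m (Suc k). \<phi> v) = (LINT x|(chain m k \<Otimes>\<^sub>M noise). \<phi> (jump m x))"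
    by (simp add: integral_distr)
  also have "\<dots> = (LINT v|chain m k. LINT n|noise. \<phi> (jump m (v, n)))"
    using P.integral_fst'[OF i] by simp
  also have "\<dots> = (LINT v|chain m k. \<phi> v + tick m * gen (kern m) \<phi> v)"
    unfolding integral_noise_jump[OF assms] ..
  also have "\<dots> = (LINT v|chain m k. \<phi> v) + (LINT v|chain m k. tick m * gen (kern m) \<phi> v)"
  proof (rule Bochner_Integration.integral_add)
    show "integrable (chain m k) \<phi>"
      using B by (intro M.integrable_const_bound[where B=B]) auto
    show "integrable (chain m k) (\<lambda>v. tick m * gen (kern m) \<phi> v)"
      using gen_kern_bounded[OF assms] by (intro M.integrable_const_bound[where B="2*B"]) auto
  qed
  finally show ?thesis by simp
qed

text \<open>By induction: the initial law is invariant and the truncated generator commutes with rotations and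
maps bounded continuous functions to bounded continuous functions.\<close>

lemma chain_rotation:
  fixes \<phi> :: "real ^ 2 \<Rightarrow> real"
  assumes "continuous_on UNIV \<phi>" "\<And>v. \<bar>\<phi> v\<bar> \<le> B"
  shows "(LINT v|chain m k. \<phi> (rotation a v)) = (LINT v|chain m k. \<phi> v)"
  using assms
proof (induction k arbitrary: \<phi> B)
  case 0
  have [measurable]: "\<phi> \<in> borel_measurable borel" using 0(1) by (rule borel_measurable_continuous_onI)
  have "(LINT v|f0. \<phi> (rotation a v)) = (LINT v|distr f0 borel (rotation a). \<phi> v)"
    by (rule integral_distr[symmetric]) auto
  then show ?case by (simp add: uniform_circle_rotation)
next
  case (Suc k)
  have [measurable]: "\<phi> \<in> borel_measurable borel" using Suc.prems(1) by (rule borel_measurable_continuous_onI)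
  have "gen (kern m) (\<lambda>v. \<phi> (rotation a v)) v = gen (kern m) \<phi> (rotation a v)" for v
    by (rule gen_rotation[symmetric]) auto
  then have g: "gen (kern m) (\<lambda>v. \<phi> (rotation a v)) = (\<lambda>v. gen (kern m) \<phi> (rotation a v))" by (rule ext)
  show ?case
    using Suc.IH[OF Suc.prems] Suc.IH[OF continuous_gen_cutoff[OF Suc.prems cutoff_radius(1)]]
    by (subst (1 2) chain_step[where B=B]) (use Suc.prems in \<open>auto simp: g\<close>)
qed

lemma chain_circle_mean:
  assumes c: "continuous_on UNIV \<phi>" and B: "\<And>v. \<bar>\<phi> v\<bar> \<le> B"
  shows "(LINT v|chain m k. \<phi> v) = (LINT v|chain m k. circle_mean \<phi> (norm v))"
proof -
  interpret M: prob_space "chain m k" by (rule prob_space_chain)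
  interpret A: prob_space angle_law by (rule prob_space_angle_law)
  interpret P: pair_prob_space "chain m k" angle_law ..
  have [measurable]: "\<phi> \<in> borel_measurable borel" using c by (rule borel_measurable_continuous_onI)
  have i: "integrable (chain m k \<Otimes>\<^sub>M angle_law) (\<lambda>(v, a). \<phi> (rotation a v))"
    using B by (intro P.integrable_const_bound[where B=B]) auto
  have "(LINT v|chain m k. \<phi> v) = (LINT a|angle_law. LINT v|chain m k. \<phi> (rotation a v))"
    by (simp add: chain_rotation[OF c B] A.prob_space[simplified])
  also have "\<dots> = (LINT v|chain m k. LINT a|angle_law. \<phi> (rotation a v))"
    by (rule P.Fubini_integral[OF i])
  finally show ?thesis by (simp add: circle_mean_polar)
qed

text \<open>The bound for the generator does not depend on the truncation, and neither does the modulus of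
continuity in time that it implies.\<close>

lemma chain_increment:
  assumes L: "L-lipschitz_on UNIV \<phi>" and B: "\<And>v. \<bar>\<phi> v\<bar> \<le> B" and kj: "k \<le> j"
  shows "\<bar>(LINT v|chain m j. \<phi> v) - (LINT v|chain m k. \<phi> v)\<bar> \<le> real (j - k) * (tick m * gbound L)"
  using kj
proof (induction j rule: dec_induct)
  case (step j)
  interpret M: prob_space "chain m j" by (rule prob_space_chain)
  have [measurable]: "\<phi> \<in> borel_measurable borel" using L by (rule lipschitz_borel_measurable)
  have "\<bar>LINT v|chain m j. gen (kern m) \<phi> v\<bar> \<le> gbound L"
    using gen_bound[OF L admissible_kern] by (intro M.abs_expectation_le) auto
  then have "\<bar>(LINT v|chain m (Suc j). \<phi> v) - (LINT v|chain m j. \<phi> v)\<bar> \<le> tick m * gbound L"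
    using tick_pos[of m] by (subst chain_step[OF _ B]) (auto simp: abs_mult)
  with step show ?case by (simp add: Suc_diff_le algebra_simps)
qed simp

end

section \<open>Compactness of the laws of the modulus\<close>

text \<open>A version of the Arzela-Ascoli argument for laws on the line. A diagonal subsequence makes the
characteristic functions converge at all rational times, equicontinuity extends the convergence to all
times, and at each time tightness identifies the limit as a characteristic function, so that Levy's
continuity theorem applies. The error \<open>\<epsilon> m\<close> allows for paths that are only piecewise constant.\<close>

lemma helly_selection_equicontinuous:
  fixes X :: "nat \<Rightarrow> real \<Rightarrow> real measure"
  assumes rd: "\<And>m t. real_distribution (X m t)"
    and tight: "\<And>t. tight (\<lambda>m. X m t)"
    and equi: "\<And>\<xi> m s t. cmod (char (X m t) \<xi> - char (X m s) \<xi>) \<le> C \<xi> * (\<bar>t - s\<bar> + \<epsilon> m)"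
    and eps: "\<epsilon> \<longlonglongrightarrow> 0" and eps0: "\<And>m. 0 \<le> \<epsilon> m"
  obtains r \<mu> where "strict_mono (r :: nat \<Rightarrow> nat)" "\<And>t. real_distribution (\<mu> t)"
    "\<And>t. weak_conv_m (\<lambda>i. X (r i) t) (\<mu> t)"
proof -
  define q where "q n = real_of_rat (nat_to_rat_surj n)" for n
  define P where "P n s \<longleftrightarrow> (\<forall>\<xi>. convergent (\<lambda>i. char (X (s i) (q n)) \<xi>))" for n and s :: "nat \<Rightarrow> nat"
  interpret subseqs P
  proof
    fix n and s :: "nat \<Rightarrow> nat" assume "strict_mono s"
    from tight_imp_convergent_subsubsequence[OF tight[of "q n"] this]
    obtain r M where r: "strict_mono r" "real_distribution M" "weak_conv_m ((\<lambda>m. X m (q n)) \<circ> s \<circ> r) M"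
      by blast
    have "(\<lambda>i. char (X (s (r i)) (q n)) \<xi>) \<longlonglongrightarrow> char M \<xi>" for \<xi>
      using levy_continuity1[OF rd r(2)] r(3) by (simp add: o_def)
    then show "\<exists>r'. strict_mono r' \<and> P n (s \<circ> r')"
      using r(1) by (auto simp: P_def convergent_def)
  qed
  define d where "d = diagseq"
  have d: "strict_mono d" unfolding d_def by (rule subseq_diagseq)
  have conv_q: "convergent (\<lambda>i. char (X (d i) (q n)) \<xi>)" for n \<xi>
  proof -
    have "P n (diagseq \<circ> ((+) (Suc n)))"
    proof (rule diagseq_holds)
      fix r s n assume "strict_mono (r :: nat \<Rightarrow> nat)" "P n s"
      then show "P n (s \<circ> r)"
        unfolding P_def using convergent_subseq_convergent[of "\<lambda>i. char (X (s i) (q n)) _" r] by (simp add: o_def)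
    qed
    then have "convergent (\<lambda>i. char (X (d (i + Suc n)) (q n)) \<xi>)"
      by (simp add: P_def d_def add.commute)
    then show ?thesis by (rule convergent_ignore_initial_segment[THEN iffD1])
  qed
  have conv: "convergent (\<lambda>i. char (X (d i) t) \<xi>)" for t \<xi>
  proof (rule Cauchy_convergent, rule CauchyI)
    fix e :: real assume e: "0 < e"
    define D where "D = \<bar>C \<xi>\<bar> + 1"
    have D: "0 < D" "C \<xi> \<le> D" by (simp_all add: D_def)
    define \<eta> where "\<eta> = e / (6 * D)"
    have \<eta>: "0 < \<eta>" using e D by (simp add: \<eta>_def)
    obtain u :: rat where u: "t - \<eta> < of_rat u" "of_rat u < t"
      using of_rat_dense[of "t - \<eta>" t] \<eta> by auto
    obtain n where n: "u = nat_to_rat_surj n" using surj_nat_to_rat_surj by (metis surjD)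
    have qt: "\<bar>t - q n\<bar> \<le> \<eta>" using u by (simp add: q_def n)
    have "Cauchy (\<lambda>i. char (X (d i) (q n)) \<xi>)" using conv_q by (rule convergent_Cauchy)
    then obtain N1 where N1: "\<And>i j. N1 \<le> i \<Longrightarrow> N1 \<le> j \<Longrightarrow> cmod (char (X (d i) (q n)) \<xi> - char (X (d j) (q n)) \<xi>) < e / 3"
      using e CauchyD[of _ "e/3"] by (metis divide_pos_pos zero_less_numeral)
    have "(\<lambda>i. \<epsilon> (d i)) \<longlonglongrightarrow> 0" using LIMSEQ_subseq_LIMSEQ[OF eps d] by (simp add: o_def)
    then have "\<forall>\<^sub>F i in sequentially. \<epsilon> (d i) < \<eta>" using \<eta> by (rule order_tendstoD)
    then obtain N2 where N2: "\<And>i. N2 \<le> i \<Longrightarrow> \<epsilon> (d i) < \<eta>" by (auto simp: eventually_sequentially)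
    have near: "cmod (char (X (d i) t) \<xi> - char (X (d i) (q n)) \<xi>) < e / 3" if "N2 \<le> i" for i
    proof -
      have "cmod (char (X (d i) t) \<xi> - char (X (d i) (q n)) \<xi>) \<le> C \<xi> * (\<bar>t - q n\<bar> + \<epsilon> (d i))" by (rule equi)
      also have "\<dots> \<le> D * (\<bar>t - q n\<bar> + \<epsilon> (d i))" using D eps0 by (intro mult_right_mono) auto
      also have "\<dots> < D * (\<eta> + \<eta>)" using D qt N2[OF that] by (intro mult_strict_left_mono) auto
      also have "\<dots> = e / 3" using D by (simp add: \<eta>_def field_simps)
      finally show ?thesis .
    qed
    show "\<exists>M. \<forall>m\<ge>M. \<forall>n\<ge>M. cmod (char (X (d m) t) \<xi> - char (X (d n) t) \<xi>) < e"
    proof (intro exI allI impI)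
      fix i j assume "max N1 N2 \<le> i" "max N1 N2 \<le> j"
      then have "cmod (char (X (d i) t) \<xi> - char (X (d i) (q n)) \<xi>) < e / 3"
        "cmod (char (X (d j) t) \<xi> - char (X (d j) (q n)) \<xi>) < e / 3"
        "cmod (char (X (d i) (q n)) \<xi> - char (X (d j) (q n)) \<xi>) < e / 3"
        using near[of i] near[of j] N1[of i j] by auto
      then show "cmod (char (X (d i) t) \<xi> - char (X (d j) t) \<xi>) < e"
        using norm_diff_triangle_less[of "char (X (d i) t) \<xi>" "char (X (d i) (q n)) \<xi>" "e/3" "char (X (d j) (q n)) \<xi>" "e/3"]
          norm_diff_triangle_less[of "char (X (d i) t) \<xi>" "char (X (d j) (q n)) \<xi>" "e/3 + e/3" "char (X (d j) t) \<xi>" "e/3"]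
        by (simp add: norm_minus_commute)
    qed
  qed
  have "\<exists>M. real_distribution M \<and> weak_conv_m (\<lambda>i. X (d i) t) M" for t
  proof -
    from tight_imp_convergent_subsubsequence[OF tight[of t] d]
    obtain r M where r: "strict_mono r" "real_distribution M" "weak_conv_m ((\<lambda>m. X m t) \<circ> d \<circ> r) M"
      by blast
    have "(\<lambda>i. char (X (d i) t) \<xi>) \<longlonglongrightarrow> char M \<xi>" for \<xi>
    proof -
      obtain l where l: "(\<lambda>i. char (X (d i) t) \<xi>) \<longlonglongrightarrow> l"
        using conv by (auto simp: convergent_def)
      moreover have "(\<lambda>i. char (X (d (r i)) t) \<xi>) \<longlonglongrightarrow> char M \<xi>"
        using levy_continuity1[OF rd r(2)] r(3) by (simp add: o_def)
      moreover have "(\<lambda>i. char (X (d (r i)) t) \<xi>) \<longlonglongrightarrow> l"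
        using LIMSEQ_subseq_LIMSEQ[OF l r(1)] by (simp add: o_def)
      ultimately show ?thesis using LIMSEQ_unique by blast
    qed
    then have "weak_conv_m (\<lambda>i. X (d i) t) M" by (intro levy_continuity rd r)
    with r(2) show ?thesis by blast
  qed
  then obtain \<mu> where "\<And>t. real_distribution (\<mu> t)" "\<And>t. weak_conv_m (\<lambda>i. X (d i) t) (\<mu> t)" by metis
  with d show ?thesis by (rule that)
qed

lemma iexp_lipschitz: "cmod (iexp x - iexp y) \<le> \<bar>x - y\<bar>"
proof -
  have "iexp x = iexp y * iexp (x - y)"
    by (simp add: algebra_simps flip: exp_add)
  then have "iexp x - iexp y = iexp y * (iexp (x - y) - 1)"
    by (simp only: right_diff_distrib mult_1_right)
  then have "cmod (iexp x - iexp y) = cmod (iexp (x - y) - 1)"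
    by (simp add: norm_mult)
  also have "\<dots> \<le> \<bar>x - y\<bar>" using iexp_approx1[of "x - y" 0] by simp
  finally show ?thesis .
qed

text \<open>These functions give the characteristic function of the law of the modulus.\<close>

lemma lipschitz_cos_norm: "\<bar>\<xi>\<bar>-lipschitz_on UNIV (\<lambda>v :: 'a :: real_normed_vector. cos (\<xi> * norm v))"
  and lipschitz_sin_norm: "\<bar>\<xi>\<bar>-lipschitz_on UNIV (\<lambda>v :: 'a :: real_normed_vector. sin (\<xi> * norm v))"
proof -
  have *: "cmod (iexp (\<xi> * norm v) - iexp (\<xi> * norm w)) \<le> \<bar>\<xi>\<bar> * norm (v - w)" for v w :: 'a
  proof -
    have "cmod (iexp (\<xi> * norm v) - iexp (\<xi> * norm w)) \<le> \<bar>\<xi>\<bar> * \<bar>norm v - norm w\<bar>"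
      using iexp_lipschitz[of "\<xi> * norm v" "\<xi> * norm w"] by (simp add: abs_mult flip: right_diff_distrib)
    also have "\<dots> \<le> \<bar>\<xi>\<bar> * norm (v - w)" by (intro mult_left_mono norm_triangle_ineq3) auto
    finally show ?thesis .
  qed
  show "\<bar>\<xi>\<bar>-lipschitz_on UNIV (\<lambda>v :: 'a. cos (\<xi> * norm v))"
  proof (rule lipschitz_onI)
    fix v w :: 'a
    show "dist (cos (\<xi> * norm v)) (cos (\<xi> * norm w)) \<le> \<bar>\<xi>\<bar> * dist v w"
      using abs_Re_le_cmod[of "iexp (\<xi> * norm v) - iexp (\<xi> * norm w)"] *[of v w]
      by (simp add: dist_norm Re_exp)
  qed simp
  show "\<bar>\<xi>\<bar>-lipschitz_on UNIV (\<lambda>v :: 'a. sin (\<xi> * norm v))"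
  proof (rule lipschitz_onI)
    fix v w :: 'a
    show "dist (sin (\<xi> * norm v)) (sin (\<xi> * norm w)) \<le> \<bar>\<xi>\<bar> * dist v w"
      using abs_Im_le_cmod[of "iexp (\<xi> * norm v) - iexp (\<xi> * norm w)"] *[of v w]
      by (simp add: dist_norm Im_exp)
  qed simp
qed

context lin_boltzmann
begin

definition steps :: "nat \<Rightarrow> real \<Rightarrow> nat" where "steps m t = nat \<lfloor>t / tick m\<rfloor>"

definition norm_law :: "nat \<Rightarrow> real \<Rightarrow> real measure" where
  "norm_law m t = distr (chain m (steps m t)) borel norm"

lemma real_distribution_norm_law: "real_distribution (norm_law m t)"
proof -
  interpret M: prob_space "chain m (steps m t)" by (rule prob_space_chain)
  show ?thesis unfolding norm_law_def
    by (intro M.real_distribution_distr) simp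
qed

lemma steps_diff: "\<bar>real (steps m t) - real (steps m s)\<bar> * tick m \<le> \<bar>t - s\<bar> + tick m"
proof -
  have *: "\<bar>real (nat \<lfloor>x\<rfloor>) - real (nat \<lfloor>y\<rfloor>)\<bar> \<le> \<bar>x - y\<bar> + 1" for x y :: real
    by linarith
  have "\<bar>real (steps m t) - real (steps m s)\<bar> * tick m \<le> (\<bar>t / tick m - s / tick m\<bar> + 1) * tick m"
    unfolding steps_def using tick_pos[of m] * by (intro mult_right_mono) auto
  also have "\<dots> = \<bar>t - s\<bar> + tick m"
    using tick_pos[of m] by (simp add: distrib_right abs_divide flip: diff_divide_distrib)
  finally show ?thesis .
qed

lemma chain_increment_time:
  assumes L: "L-lipschitz_on UNIV \<phi>" and B: "\<And>v. \<bar>\<phi> v\<bar> \<le> B"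
  shows "\<bar>(LINT v|chain m (steps m t). \<phi> v) - (LINT v|chain m (steps m s). \<phi> v)\<bar> \<le> gbound L * (\<bar>t - s\<bar> + tick m)"
proof -
  have L0: "0 \<le> L" using lipschitz_on_nonneg[OF L] .
  have "\<bar>(LINT v|chain m j. \<phi> v) - (LINT v|chain m k. \<phi> v)\<bar> \<le> \<bar>real j - real k\<bar> * (tick m * gbound L)" for j k
    using chain_increment[OF L B, where j=j and k=k and m=m] chain_increment[OF L B, where j=k and k=j and m=m]
    by (cases "k \<le> j") (auto simp: abs_minus_commute of_nat_diff)
  then have "\<bar>(LINT v|chain m (steps m t). \<phi> v) - (LINT v|chain m (steps m s). \<phi> v)\<bar>
     \<le> gbound L * (\<bar>real (steps m t) - real (steps m s)\<bar> * tick m)" by (simp add: mult_ac)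
  also have "\<dots> \<le> gbound L * (\<bar>t - s\<bar> + tick m)"
    using gbound_nonneg[OF L0] by (intro mult_left_mono steps_diff)
  finally show ?thesis .
qed

lemma steps_0 [simp]: "steps m 0 = 0"
  by (simp add: steps_def)

lemma tick_le: "tick m \<le> 1 / \<Lambda>"
  using cutoff_radius[of m] Lambda_pos by (auto simp: tick_def divide_right_mono power_le_one)

text \<open>A truncated modulus is a bounded Lipschitz function, hence its mean grows at most linearly in time, and
Markov's inequality gives tightness.\<close>

lemma norm_law_tight: "tight (\<lambda>m. norm_law m t)"
  unfolding tight_def
proof (intro conjI allI impI real_distribution_norm_law)
  fix e :: real assume e: "0 < e"
  define K where "K = (r0 + gbound 1 * (\<bar>t\<bar> + 1 / \<Lambda>)) / e + 1"
  have num: "0 \<le> r0 + gbound 1 * (\<bar>t\<bar> + 1 / \<Lambda>)"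
    using r0_pos gbound_nonneg[of 1] Lambda_pos by auto
  then have K: "1 \<le> K" using e by (simp add: K_def)
  define \<phi> where "\<phi> v = min (norm v) K" for v :: "real ^ 2"
  have L: "1-lipschitz_on UNIV \<phi>"
  proof (rule lipschitz_onI)
    fix v w :: "real^2"
    have "\<bar>min a K - min b K\<bar> \<le> \<bar>a - b\<bar>" for a b :: real by linarith
    then show "dist (\<phi> v) (\<phi> w) \<le> 1 * dist v w"
      using norm_triangle_ineq3[of v w] by (auto simp: \<phi>_def dist_norm intro: order_trans)
  qed simp
  have [measurable]: "\<phi> \<in> borel_measurable borel" using L by (rule lipschitz_borel_measurable)
  have B: "\<bar>\<phi> v\<bar> \<le> K" for v using K by (auto simp: \<phi>_def)
  have "1 - e < measure (norm_law m t) {-1 <.. K}" for m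
  proof -
    interpret M: prob_space "chain m (steps m t)" by (rule prob_space_chain)
    have "(LINT v|f0. \<phi> v) \<le> (LINT v|f0. r0)"
    proof (rule integral_mono_AE)
      show "integrable f0 \<phi>" using B by (intro f0.integrable_const_bound[where B=K]) auto
      show "AE v in f0. \<phi> v \<le> r0"
        using AE_uniform_circle_norm[OF less_imp_le[OF r0_pos]] by eventually_elim (simp add: \<phi>_def)
    qed simp
    then have "(LINT v|f0. \<phi> v) \<le> r0" by (simp add: f0.prob_space[simplified])
    moreover have "\<bar>(LINT v|chain m (steps m t). \<phi> v) - (LINT v|f0. \<phi> v)\<bar> \<le> gbound 1 * (\<bar>t - 0\<bar> + tick m)"
      using chain_increment_time[OF L B, of m t 0] by simp
    moreover have "gbound 1 * (\<bar>t - 0\<bar> + tick m) \<le> gbound 1 * (\<bar>t\<bar> + 1 / \<Lambda>)"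
      using gbound_nonneg[of 1] tick_le[of m] by (intro mult_left_mono) auto
    ultimately have le: "(LINT v|chain m (steps m t). \<phi> v) \<le> r0 + gbound 1 * (\<bar>t\<bar> + 1 / \<Lambda>)"
      by linarith
    have int: "integrable (chain m (steps m t)) \<phi>"
      using B by (intro M.integrable_const_bound[where B=K]) auto
    have "K * measure (chain m (steps m t)) {v. K < norm v} = (LINT v|chain m (steps m t). K * indicator {v. K < norm v} v)"
      by simp
    also have "\<dots> \<le> (LINT v|chain m (steps m t). \<phi> v)"
      by (intro integral_mono int integrable_mult_right integrable_real_indicator)
         (use K in \<open>auto simp: \<phi>_def indicator_def M.emeasure_eq_measure\<close>)
    also have "\<dots> < K * e"
    proof -
      have "r0 + gbound 1 * (\<bar>t\<bar> + 1 / \<Lambda>) = (K - 1) * e" using e by (simp add: K_def)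
      then show ?thesis using le e by (simp add: algebra_simps)
    qed
    finally have "measure (chain m (steps m t)) {v. K < norm v} < e" using K by simp
    moreover have "measure (norm_law m t) {-1 <.. K} = measure (chain m (steps m t)) {v. norm v \<le> K}"
    proof -
      have "-1 < norm x" for x :: "real^2" using norm_ge_zero[of x] by linarith
      then show ?thesis unfolding norm_law_def by (subst measure_distr) (auto intro!: arg_cong[where f="measure _"])
    qed
    moreover have "measure (chain m (steps m t)) {v. norm v \<le> K} = 1 - measure (chain m (steps m t)) {v. K < norm v}"
      by (subst M.prob_compl[symmetric]) (auto intro!: arg_cong[where f="measure _"])
    ultimately show ?thesis by simp
  qed
  with K show "\<exists>a b. a < b \<and> (\<forall>m. 1 - e < measure (norm_law m t) {a<..b})"
    by (intro exI[of _ "-1"] exI[of _ K]) auto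
qed

lemma char_norm_law:
  "Re (char (norm_law m t) \<xi>) = (LINT v|chain m (steps m t). cos (\<xi> * norm v))"
  "Im (char (norm_law m t) \<xi>) = (LINT v|chain m (steps m t). sin (\<xi> * norm v))"
proof -
  interpret M: prob_space "chain m (steps m t)" by (rule prob_space_chain)
  have c: "char (norm_law m t) \<xi> = (CLINT v|chain m (steps m t). iexp (\<xi> * norm v))"
    unfolding char_def norm_law_def by (subst integral_distr) auto
  have i: "complex_integrable (chain m (steps m t)) (\<lambda>v. iexp (\<xi> * norm v))"
    by (intro M.integrable_const_bound[where B=1]) auto
  show "Re (char (norm_law m t) \<xi>) = (LINT v|chain m (steps m t). cos (\<xi> * norm v))"
    "Im (char (norm_law m t) \<xi>) = (LINT v|chain m (steps m t). sin (\<xi> * norm v))"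
    unfolding c integral_Re[OF i, symmetric] integral_Im[OF i, symmetric]
    by (simp_all only: Re_exp Im_exp) simp_all
qed

lemma char_norm_law_equicontinuous:
  "cmod (char (norm_law m t) \<xi> - char (norm_law m s) \<xi>) \<le> 2 * gbound \<bar>\<xi>\<bar> * (\<bar>t - s\<bar> + tick m)"
proof -
  have "cmod (char (norm_law m t) \<xi> - char (norm_law m s) \<xi>)
     \<le> \<bar>Re (char (norm_law m t) \<xi> - char (norm_law m s) \<xi>)\<bar> + \<bar>Im (char (norm_law m t) \<xi> - char (norm_law m s) \<xi>)\<bar>"
    by (rule cmod_le)
  also have "\<dots> \<le> gbound \<bar>\<xi>\<bar> * (\<bar>t - s\<bar> + tick m) + gbound \<bar>\<xi>\<bar> * (\<bar>t - s\<bar> + tick m)"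
    using chain_increment_time[OF lipschitz_cos_norm, of \<xi> 1 m t s] chain_increment_time[OF lipschitz_sin_norm, of \<xi> 1 m t s]
    by (intro add_mono) (simp_all add: char_norm_law)
  finally show ?thesis by simp
qed

end

section \<open>Passage to the limit\<close>

text \<open>The rotation invariant law in the plane that corresponds to a law \<open>\<mu>\<close> of the signed modulus.\<close>

definition spread :: "real measure \<Rightarrow> (real ^ 2) measure" where
  "spread \<mu> = distr (\<mu> \<Otimes>\<^sub>M angle_law) borel (\<lambda>x. rotation (snd x) (fst x *\<^sub>R east))"

lemma sets_spread [measurable_cong]: "sets (spread \<mu>) = sets borel" and space_spread [simp]: "space (spread \<mu>) = UNIV"
  by (simp_all add: spread_def)

lemma spread_measurable:
  assumes "real_distribution \<mu>"
  shows "(\<lambda>x. rotation (snd x) (fst x *\<^sub>R east)) \<in> borel_measurable (\<mu> \<Otimes>\<^sub>M angle_law)"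
proof -
  interpret real_distribution \<mu> by fact
  show ?thesis by measurable
qed

lemma prob_space_spread:
  assumes "real_distribution \<mu>"
  shows "prob_space (spread \<mu>)"
proof -
  interpret real_distribution \<mu> by fact
  interpret A: prob_space angle_law by (rule prob_space_angle_law)
  interpret P: pair_prob_space \<mu> angle_law ..
  show ?thesis unfolding spread_def by (rule P.prob_space_distr[OF spread_measurable[OF assms]])
qed

lemma nn_integral_spread:
  assumes "real_distribution \<mu>" and [measurable]: "f \<in> borel_measurable borel"
  shows "(\<integral>\<^sup>+v. f v \<partial>spread \<mu>) = (\<integral>\<^sup>+\<rho>. \<integral>\<^sup>+a. f (rotation a (\<rho> *\<^sub>R east)) \<partial>angle_law \<partial>\<mu>)"
proof -
  interpret real_distribution \<mu> by fact
  interpret A: prob_space angle_law by (rule prob_space_angle_law)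
  show ?thesis unfolding spread_def
    by (subst nn_integral_distr[OF spread_measurable[OF assms(1)]], simp, subst A.nn_integral_fst[symmetric]) auto
qed

lemma integral_spread:
  fixes \<phi> :: "real ^ 2 \<Rightarrow> real"
  assumes "real_distribution \<mu>" and [measurable]: "\<phi> \<in> borel_measurable borel" and B: "\<And>v. \<bar>\<phi> v\<bar> \<le> B"
  shows "(LINT v|spread \<mu>. \<phi> v) = (LINT \<rho>|\<mu>. circle_mean \<phi> \<rho>)"
proof -
  interpret real_distribution \<mu> by fact
  interpret A: prob_space angle_law by (rule prob_space_angle_law)
  interpret P: pair_prob_space \<mu> angle_law ..
  have i: "integrable (\<mu> \<Otimes>\<^sub>M angle_law) (\<lambda>x. \<phi> (rotation (snd x) (fst x *\<^sub>R east)))"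
    using B by (intro P.integrable_const_bound[where B=B]) auto
  have "(LINT v|spread \<mu>. \<phi> v) = (LINT x|(\<mu> \<Otimes>\<^sub>M angle_law). \<phi> (rotation (snd x) (fst x *\<^sub>R east)))"
    unfolding spread_def by (rule integral_distr[OF spread_measurable[OF assms(1)]]) simp
  also have "\<dots> = (LINT \<rho>|\<mu>. LINT a|angle_law. \<phi> (rotation a (\<rho> *\<^sub>R east)))"
    using P.integral_fst'[OF i] by simp
  finally show ?thesis by (simp add: circle_mean_altdef)
qed

lemma real_distribution_return: "real_distribution (return borel x)"
  by (intro real_distribution.intro real_distribution_axioms.intro prob_space_return) auto

lemma spread_return: "spread (return borel r) = uniform_circle r"
proof (rule measure_eqI)
  fix A assume "A \<in> sets (spread (return borel r))"
  then have [measurable]: "A \<in> sets borel" by (simp add: sets_spread)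
  interpret A: prob_space angle_law by (rule prob_space_angle_law)
  have "emeasure (spread (return borel r)) A = (\<integral>\<^sup>+v. indicator A v \<partial>spread (return borel r))" by simp
  also have "\<dots> = (\<integral>\<^sup>+a. indicator A (rotation a (r *\<^sub>R east)) \<partial>angle_law)"
    by (subst nn_integral_spread[OF real_distribution_return], simp, subst nn_integral_return) auto
  also have "\<dots> = emeasure (uniform_circle r) A"
    by (subst nn_integral_uniform_circle[symmetric]) auto
  finally show "emeasure (spread (return borel r)) A = emeasure (uniform_circle r) A" .
qed (simp add: sets_spread sets_uniform_circle)

lemma set_integrable_bounded:
  fixes g :: "real \<Rightarrow> real"
  assumes [measurable]: "g \<in> borel_measurable borel" and B: "\<And>s. \<bar>g s\<bar> \<le> B"
  shows "set_integrable lborel {0..t} g"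
proof -
  have "set_integrable lborel {0..t} (\<lambda>_. B)"
    unfolding set_integrable_def by (intro integrable_scaleR_left integrable_real_indicator) (auto simp: emeasure_lborel_Icc_eq)
  then show ?thesis
    by (rule set_integrable_bound)
       (use B in \<open>auto simp: set_borel_measurable_def intro: order_trans[OF _ abs_ge_self]\<close>)
qed

lemma set_integral_tendsto_bounded:
  fixes g :: "nat \<Rightarrow> real \<Rightarrow> real"
  assumes [measurable]: "\<And>n. g n \<in> borel_measurable borel" "f \<in> borel_measurable borel"
    and B: "\<And>n s. s \<in> {0..t} \<Longrightarrow> \<bar>g n s\<bar> \<le> B"
    and lim: "\<And>s. s \<in> {0..t} \<Longrightarrow> (\<lambda>n. g n s) \<longlonglongrightarrow> f s"
  shows "(\<lambda>n. LINT s:{0..t}|lborel. g n s) \<longlonglongrightarrow> (LINT s:{0..t}|lborel. f s)"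
  unfolding set_lebesgue_integral_def
proof (rule integral_dominated_convergence[where w="\<lambda>s. indicator {0..t} s * B"])
  show "integrable lborel (\<lambda>s. indicator {0..t} s * B)"
    by (intro integrable_mult_left integrable_real_indicator) (auto simp: emeasure_lborel_Icc_eq)
qed (use B lim in \<open>auto simp: indicator_def\<close>)

lemma integral_step_function:
  fixes c :: "nat \<Rightarrow> real"
  assumes h: "0 < h" and C: "\<And>k. \<bar>c k\<bar> \<le> C" and t: "0 \<le> t"
  shows "\<bar>h * (\<Sum>k<nat \<lfloor>t / h\<rfloor>. c k) - (LINT s:{0..t}|lborel. c (nat \<lfloor>s / h\<rfloor>))\<bar> \<le> C * h"
proof -
  define g where "g s = c (nat \<lfloor>s / h\<rfloor>)" for s
  define N where "N = nat \<lfloor>t / h\<rfloor>"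
  have [measurable]: "g \<in> borel_measurable borel"
    unfolding g_def by (rule measurable_compose[of _ _ "count_space UNIV"]) measurable
  have "real N \<le> t / h" "t / h < real N + 1" using t h by (simp_all add: N_def)
  then have N: "real N * h \<le> t" "t < (real N + 1) * h" using h by (simp_all add: field_simps)
  have gC: "\<bar>g s\<bar> \<le> C" for s unfolding g_def by (rule C)
  have int: "set_integrable lborel A g" if "A \<in> sets lborel" "emeasure lborel A < \<infinity>" for A
    unfolding set_integrable_def
  proof (rule Bochner_Integration.integrable_bound)
    show "integrable lborel (\<lambda>x. indicator A x * C)" using that by auto
  qed (use that gC in \<open>auto simp: indicator_def intro: order_trans[OF _ abs_ge_self]\<close>)
  have sum: "(LINT s:{0..<real n * h}|lborel. g s) = h * (\<Sum>k<n. c k)" for n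
  proof (induction n)
    case (Suc n)
    have *: "{0..<real (Suc n) * h} = {0..<real n * h} \<union> {real n * h..<real (Suc n) * h}"
      using h by (intro ivl_disj_un_two(3)[symmetric]) auto
    have "(LINT s:{real n * h..<real (Suc n) * h}|lborel. g s) = (LINT s:{real n * h..<real (Suc n) * h}|lborel. c n)"
    proof (rule set_lebesgue_integral_cong)
      show "\<forall>s. s \<in> {real n * h..<real (Suc n) * h} \<longrightarrow> g s = c n"
      proof (intro allI impI)
        fix s assume "s \<in> {real n * h..<real (Suc n) * h}"
        then have "of_int (int n) \<le> s / h" "s / h < of_int (int n) + 1" using h by (auto simp: field_simps)
        then have "\<lfloor>s / h\<rfloor> = int n" by (rule floor_unique)
        then show "g s = c n" by (simp add: g_def)
      qed
    qed auto
    also have "\<dots> = h * c n" using h by (simp add: set_lebesgue_integral_def algebra_simps)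
    finally show ?case using Suc h unfolding *
      by (subst set_integral_Un) (auto intro!: int simp: algebra_simps)
  qed (simp add: set_lebesgue_integral_def)
  have "{0..t} = {0..<real N * h} \<union> {real N * h..t}"
    using h N by (intro ivl_disj_un_two(7)[symmetric]) auto
  then have "(LINT s:{0..t}|lborel. g s) = h * (\<Sum>k<N. c k) + (LINT s:{real N * h..t}|lborel. g s)"
    unfolding sum[symmetric] using h N by (simp only:, subst set_integral_Un) (auto intro!: int)
  moreover have "\<bar>LINT s:{real N * h..t}|lborel. g s\<bar> \<le> C * h"
  proof -
    have "\<bar>LINT s:{real N * h..t}|lborel. g s\<bar> \<le> (LINT s:{real N * h..t}|lborel. \<bar>g s\<bar>)"
      unfolding set_lebesgue_integral_def by (rule order_trans[OF integral_abs_bound]) (simp add: abs_mult)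
    also have "\<dots> \<le> (LINT s:{real N * h..t}|lborel. C)"
    proof (intro set_integral_mono set_integrable_abs int)
      show "set_integrable lborel {real N * h..t} (\<lambda>_. C)"
        using N unfolding set_integrable_def
        by (intro integrable_scaleR_left integrable_real_indicator) auto
    qed (use gC N in auto)
    also have "\<dots> = (t - real N * h) * C" using N by (simp add: set_lebesgue_integral_def)
    also have "\<dots> \<le> h * C" using N gC[of 0] by (intro mult_right_mono) (auto simp: algebra_simps)
    finally show ?thesis by (simp add: mult.commute)
  qed
  ultimately show ?thesis by (simp add: g_def N_def)
qed

context lin_boltzmann
begin

lemma integral_gen_bound:
  assumes M: "prob_space M" "sets M = sets borel" and L: "L-lipschitz_on UNIV \<phi>" and k: "admissible \<gamma> k"
  shows "integrable M (gen k \<phi>)" "\<bar>LINT v|M. gen k \<phi> v\<bar> \<le> gbound L"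
proof -
  interpret prob_space M by fact
  note [measurable_cong] = M(2)
  have [measurable]: "\<phi> \<in> borel_measurable borel" "k \<in> borel_measurable borel"
    using lipschitz_borel_measurable[OF L] k by (auto simp: admissible_def)
  show "integrable M (gen k \<phi>)"
    using gen_bound[OF L k] by (intro integrable_const_bound[where B="gbound L"]) auto
  show "\<bar>LINT v|M. gen k \<phi> v\<bar> \<le> gbound L"
    using gen_bound[OF L k] by (intro abs_expectation_le) auto
qed

lemma chain_sum:
  assumes "\<phi> \<in> borel_measurable borel" "\<And>v. \<bar>\<phi> v\<bar> \<le> B"
  shows "(LINT v|chain m n. \<phi> v) = (LINT v|f0. \<phi> v) + tick m * (\<Sum>k<n. LINT v|chain m k. gen (kern m) \<phi> v)"
proof (induction n)
  case (Suc n)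
  then show ?case by (simp only: chain_step[OF assms] sum.lessThan_Suc distrib_left add.assoc)
qed simp

end

text \<open>A rotation invariant solution tested against bounded Lipschitz functions. These properties
suffice for the extension to all Lipschitz functions and for absolute continuity at almost every time.\<close>

locale radial_solution = lin_boltzmann +
  fixes \<mu> :: "real \<Rightarrow> real measure"
  assumes real_distribution_mu: "\<And>t. real_distribution (\<mu> t)"
    and initial: "spread (\<mu> 0) = f0"
    and measurable_in_time: "\<And>(\<phi> :: real ^ 2 \<Rightarrow> real) B. continuous_on UNIV \<phi> \<Longrightarrow> (\<And>v. \<bar>\<phi> v\<bar> \<le> B) \<Longrightarrow>
        (\<lambda>s. LINT v|spread (\<mu> s). \<phi> v) \<in> borel_measurable borel"
    and bounded_equation: "\<And>\<phi> L B t. L-lipschitz_on UNIV \<phi> \<Longrightarrow> (\<And>v. \<bar>\<phi> v\<bar> \<le> B) \<Longrightarrow> 0 \<le> t \<Longrightarrow>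
        (LINT v|spread (\<mu> t). \<phi> v) =
        (LINT v|f0. \<phi> v) + (LINT s:{0..t}|lborel. LINT v|spread (\<mu> s). gen full \<phi> v)"

context lin_boltzmann
begin

text \<open>The Euler scheme passes to the limit: the truncated generator converges uniformly on a fixed Lipschitz
function, the limiting generator maps it to a bounded continuous function, and all integrands in time are
bounded by the same constant.\<close>

lemma ex_radial_solution: "\<exists>\<mu>. radial_solution \<gamma> \<Lambda> r0 \<beta> \<mu>"
proof -
  obtain r \<nu> where r: "strict_mono (r :: nat \<Rightarrow> nat)" and \<nu>: "\<And>t. real_distribution (\<nu> t)"
    and conv: "\<And>t. weak_conv_m (\<lambda>i. norm_law (r i) t) (\<nu> t)"
    by (rule helly_selection_equicontinuous[OF real_distribution_norm_law norm_law_tight char_norm_law_equicontinuous tick_tendsto])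
       (use tick_pos in \<open>auto intro: less_imp_le\<close>)
  \<comment> \<open>at time \<open>0\<close> all chains have the law \<open>f0\<close>, so the limit there may be chosen as the point mass at \<open>r0\<close>\<close>
  define \<mu> where "\<mu> t = (if t = 0 then return borel r0 else \<nu> t)" for t
  have \<mu>: "real_distribution (\<mu> t)" for t
    using \<nu> real_distribution_return by (simp add: \<mu>_def)
  have \<mu>0: "spread (\<mu> 0) = f0" by (simp add: \<mu>_def spread_return)
  have lim: "(\<lambda>i. LINT v|chain (r i) (steps (r i) t). \<phi> v) \<longlonglongrightarrow> (LINT v|spread (\<mu> t). \<phi> v)"
    if c: "continuous_on UNIV \<phi>" and B: "\<And>v. \<bar>\<phi> v\<bar> \<le> B" for \<phi> :: "real ^ 2 \<Rightarrow> real" and B t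
  proof (cases "t = 0")
    case True then show ?thesis by (simp add: \<mu>0)
  next
    case False
    have [measurable]: "\<phi> \<in> borel_measurable borel" using c by (rule borel_measurable_continuous_onI)
    have cm [measurable]: "circle_mean \<phi> \<in> borel_measurable borel"
      using isCont_circle_mean[OF c B]
      by (intro borel_measurable_continuous_onI) (simp add: continuous_on_eq_continuous_at)
    have "(LINT v|chain m (steps m t). \<phi> v) = (LINT \<rho>|norm_law m t. circle_mean \<phi> \<rho>)" for m
      unfolding norm_law_def chain_circle_mean[OF c B] by (subst integral_distr) auto
    moreover have "(\<lambda>i. LINT \<rho>|norm_law (r i) t. circle_mean \<phi> \<rho>) \<longlonglongrightarrow> (LINT \<rho>|\<nu> t. circle_mean \<phi> \<rho>)"
      by (rule weak_conv_imp_integral_bdd_continuous_conv[OF real_distribution_norm_law \<nu> conv, of _ B])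
         (use isCont_circle_mean[OF c B] circle_mean_bound[OF _ B] in auto)
    ultimately show ?thesis
      using False by (simp add: \<mu>_def integral_spread[OF \<nu> _ B])
  qed
  have meas: "(\<lambda>s. LINT v|spread (\<mu> s). \<phi> v) \<in> borel_measurable borel"
    if c: "continuous_on UNIV \<phi>" and B: "\<And>v. \<bar>\<phi> v\<bar> \<le> B" for \<phi> :: "real ^ 2 \<Rightarrow> real" and B
  proof (rule borel_measurable_LIMSEQ_real[OF lim[OF that]])
    fix i
    show "(\<lambda>s. LINT v|chain (r i) (steps (r i) s). \<phi> v) \<in> borel_measurable borel"
      unfolding steps_def by (rule measurable_compose[of _ _ "count_space UNIV"]) measurable
  qed
  show ?thesis
  proof (intro exI[of _ \<mu>] radial_solution.intro radial_solution_axioms.intro lin_boltzmann_axioms)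
    show "real_distribution (\<mu> t)" for t by (rule \<mu>)
    show "spread (\<mu> 0) = f0" by (rule \<mu>0)
    fix \<phi> :: "real^2 \<Rightarrow> real" and B :: real
    assume "continuous_on UNIV \<phi>" "\<And>v. \<bar>\<phi> v\<bar> \<le> B"
    then show "(\<lambda>s. LINT v|spread (\<mu> s). \<phi> v) \<in> borel_measurable borel" by (rule meas)
  next
    fix \<phi> :: "real^2 \<Rightarrow> real" and L B t :: real
    assume L: "L-lipschitz_on UNIV \<phi>" and B: "\<And>v. \<bar>\<phi> v\<bar> \<le> B" and t: "0 \<le> t"
    have c: "continuous_on UNIV \<phi>" using L by (rule lipschitz_on_continuous_on)
    have m [measurable]: "\<phi> \<in> borel_measurable borel" using L by (rule lipschitz_borel_measurable)
    define a where "a m s = (LINT v|chain m (steps m s). gen (kern m) \<phi> v)" for m s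
    define b where "b s = (LINT v|spread (\<mu> s). gen full \<phi> v)" for s
    have aB: "\<bar>a m s\<bar> \<le> gbound L" for m s
      unfolding a_def by (rule integral_gen_bound[OF prob_space_chain sets_chain L admissible_kern])
    have ab: "(\<lambda>i. a (r i) s) \<longlonglongrightarrow> b s" for s
    proof -
      have "(\<lambda>i. a (r i) s - (LINT v|chain (r i) (steps (r i) s). gen full \<phi> v)) \<longlonglongrightarrow> 0"
      proof (rule Lim_null_comparison)
        let ?c = "L * (\<Lambda> * kappa (\<gamma> / 2))"
        show "(\<lambda>i. ?c * cutoff_radius (r i) powr ((\<gamma> + 2) / 2)) \<longlonglongrightarrow> 0"
          using LIMSEQ_subseq_LIMSEQ[OF cutoff_radius_tendsto r] gamma
          by (intro tendsto_mult_right_zero tendsto_zero_powrI[where b="(\<gamma> + 2) / 2"])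
             (auto simp: o_def intro!: always_eventually less_imp_le[OF cutoff_radius(1)])
        show "\<forall>\<^sub>F i in sequentially. norm (a (r i) s - (LINT v|chain (r i) (steps (r i) s). gen full \<phi> v))
            \<le> ?c * cutoff_radius (r i) powr ((\<gamma> + 2) / 2)"
        proof (intro always_eventually allI)
          fix i
          let ?M = "chain (r i) (steps (r i) s)"
          interpret M: prob_space ?M by (rule prob_space_chain)
          note i1 = integral_gen_bound(1)[OF prob_space_chain sets_chain L admissible_kern, of "r i" "steps (r i) s" "r i"]
          note i2 = integral_gen_bound(1)[OF prob_space_chain sets_chain L admissible_full, of "r i" "steps (r i) s"]
          have "a (r i) s - (LINT v|?M. gen full \<phi> v) = (LINT v|?M. gen (kern (r i)) \<phi> v - gen full \<phi> v)"
            unfolding a_def using i1 i2 by simp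
          then have "norm (a (r i) s - (LINT v|?M. gen full \<phi> v)) \<le> (LINT v|?M. \<bar>gen (kern (r i)) \<phi> v - gen full \<phi> v\<bar>)"
            by (metis integral_abs_bound real_norm_def)
          also have "\<dots> \<le> (LINT v|?M. ?c * cutoff_radius (r i) powr ((\<gamma> + 2) / 2))"
            using i1 i2 cutoff_close[OF L cutoff_radius(1)] by (intro integral_mono) auto
          finally show "norm (a (r i) s - (LINT v|?M. gen full \<phi> v)) \<le> ?c * cutoff_radius (r i) powr ((\<gamma> + 2) / 2)"
            by (simp add: M.prob_space[simplified])
        qed
      qed
      moreover have "(\<lambda>i. LINT v|chain (r i) (steps (r i) s). gen full \<phi> v) \<longlonglongrightarrow> b s"
        unfolding b_def
        by (rule lim[OF continuous_gen_full[OF L B] gen_bound[OF L admissible_full]])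
      ultimately show ?thesis using tendsto_add by fastforce
    qed
    have [measurable]: "a m \<in> borel_measurable borel" for m
      unfolding a_def steps_def by (rule measurable_compose[of _ _ "count_space UNIV"]) measurable
    have [measurable]: "b \<in> borel_measurable borel"
      by (rule borel_measurable_LIMSEQ_real[OF ab]) measurable
    have "(\<lambda>i. LINT s:{0..t}|lborel. a (r i) s) \<longlonglongrightarrow> (LINT s:{0..t}|lborel. b s)"
      by (rule set_integral_tendsto_bounded[OF _ _ aB ab]) measurable
    moreover have "(\<lambda>i. (LINT v|chain (r i) (steps (r i) t). \<phi> v) - (LINT v|f0. \<phi> v) - (LINT s:{0..t}|lborel. a (r i) s)) \<longlonglongrightarrow> 0"
    proof (rule Lim_null_comparison)
      show "(\<lambda>i. gbound L * tick (r i)) \<longlonglongrightarrow> 0"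
        using LIMSEQ_subseq_LIMSEQ[OF tick_tendsto r] by (intro tendsto_mult_right_zero) (simp add: o_def)
      show "\<forall>\<^sub>F i in sequentially. norm ((LINT v|chain (r i) (steps (r i) t). \<phi> v) - (LINT v|f0. \<phi> v) - (LINT s:{0..t}|lborel. a (r i) s)) \<le> gbound L * tick (r i)"
        unfolding a_def steps_def chain_sum[OF m B] 
        using integral_step_function[OF tick_pos integral_gen_bound(2)[OF prob_space_chain sets_chain L admissible_kern] t]
        by (intro always_eventually allI) (simp add: algebra_simps)
    qed
    ultimately have "(\<lambda>i. (LINT v|chain (r i) (steps (r i) t). \<phi> v) - (LINT v|f0. \<phi> v) - (LINT s:{0..t}|lborel. a (r i) s) + (LINT s:{0..t}|lborel. a (r i) s))
       \<longlonglongrightarrow> 0 + (LINT s:{0..t}|lborel. b s)" by (intro tendsto_add)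
    then have "(\<lambda>i. (LINT v|chain (r i) (steps (r i) t). \<phi> v) - (LINT v|f0. \<phi> v)) \<longlonglongrightarrow> (LINT s:{0..t}|lborel. b s)"
      by simp
    moreover have "(\<lambda>i. (LINT v|chain (r i) (steps (r i) t). \<phi> v) - (LINT v|f0. \<phi> v)) \<longlonglongrightarrow> (LINT v|spread (\<mu> t). \<phi> v) - (LINT v|f0. \<phi> v)"
      by (intro tendsto_diff tendsto_const lim[OF c B])
    ultimately have "(LINT v|spread (\<mu> t). \<phi> v) - (LINT v|f0. \<phi> v) = (LINT s:{0..t}|lborel. b s)"
      by (rule LIMSEQ_unique[rotated])
    then show "(LINT v|spread (\<mu> t). \<phi> v) =
        (LINT v|f0. \<phi> v) + (LINT s:{0..t}|lborel. LINT v|spread (\<mu> s). gen full \<phi> v)"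
      by (simp add: b_def)
  qed
qed

end

section \<open>The weak equation for Lipschitz functions\<close>

lemma lipschitz_clamp:
  fixes \<phi> :: "'a :: metric_space \<Rightarrow> real"
  assumes L: "L-lipschitz_on UNIV \<phi>"
  shows "L-lipschitz_on UNIV (\<lambda>v. max (- K) (min K (\<phi> v)))"
proof (rule lipschitz_onI)
  fix v w
  have "\<bar>max (- K) (min K a) - max (- K) (min K b)\<bar> \<le> \<bar>a - b\<bar>" for a b :: real by linarith
  then show "dist (max (- K) (min K (\<phi> v))) (max (- K) (min K (\<phi> w))) \<le> L * dist v w"
    using lipschitz_onD[OF L, of v w] by (auto simp: dist_real_def intro: order_trans)
qed (rule lipschitz_on_nonneg[OF L])

context radial_solution
begin

abbreviation flow :: "real \<Rightarrow> (real ^ 2) measure" where "flow t \<equiv> spread (\<mu> t)"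

sublocale flow: prob_space "flow t" for t
  by (rule prob_space_spread[OF real_distribution_mu])

text \<open>Clamping a Lipschitz function keeps its Lipschitz constant, so the bounds for the generator stay
uniform and dominated convergence removes the boundedness of the test function.\<close>

lemma clamp_approximation:
  assumes L: "L-lipschitz_on UNIV \<phi>"
  defines "\<psi> \<equiv> \<lambda>n v. max (- real n) (min (real n) (\<phi> v))"
  shows "L-lipschitz_on UNIV (\<psi> n)" "\<bar>\<psi> n v\<bar> \<le> real n" "(\<lambda>n. \<psi> n v) \<longlonglongrightarrow> \<phi> v"
    "(\<lambda>n. gen full (\<psi> n) v) \<longlonglongrightarrow> gen full \<phi> v"
proof -
  show lip: "L-lipschitz_on UNIV (\<psi> n)" for n
    unfolding \<psi>_def by (rule lipschitz_clamp[OF L])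
  show "\<bar>\<psi> n v\<bar> \<le> real n" by (auto simp: \<psi>_def)
  show lim: "(\<lambda>n. \<psi> n v) \<longlonglongrightarrow> \<phi> v" for v
  proof (rule tendsto_eventually, rule eventually_mono[OF eventually_ge_at_top[of "nat \<lceil>\<bar>\<phi> v\<bar>\<rceil>"]])
    fix n assume "nat \<lceil>\<bar>\<phi> v\<bar>\<rceil> \<le> n"
    then have "\<bar>\<phi> v\<bar> \<le> real n" by linarith
    then show "\<psi> n v = \<phi> v" unfolding \<psi>_def by linarith
  qed
  have [measurable]: "\<phi> \<in> borel_measurable borel" "\<psi> n \<in> borel_measurable borel" for n
    using lipschitz_borel_measurable[OF L] lipschitz_borel_measurable[OF lip] by auto
  show "(\<lambda>n. gen full (\<psi> n) v) \<longlonglongrightarrow> gen full \<phi> v"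
    unfolding gen_def
  proof (rule integral_dominated_convergence[where w="\<lambda>z. L * norm (v - fst z) powr (\<gamma> + 1)"])
    show "integrable marks (\<lambda>z. L * norm (v - fst z) powr (\<gamma> + 1))"
      using gamma by (intro integrable_mult_right marks_power) auto
    show "AE z in marks. (\<lambda>n. norm (v - fst z) powr \<gamma> * (\<psi> n (post_velocity v (fst z) (snd z)) - \<psi> n v))
        \<longlonglongrightarrow> norm (v - fst z) powr \<gamma> * (\<phi> (post_velocity v (fst z) (snd z)) - \<phi> v)"
      by (intro AE_I2 tendsto_intros lim)
    show "AE z in marks. norm (norm (v - fst z) powr \<gamma> * (\<psi> n (post_velocity v (fst z) (snd z)) - \<psi> n v))
        \<le> L * norm (v - fst z) powr (\<gamma> + 1)" for n
      using collision_integrand_bound[OF lip admissible_full] by simp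
  qed auto
qed

text \<open>The bounded equation for the truncated modulus bounds its mean uniformly in the truncation.\<close>

lemma integrable_norm_flow:
  assumes t: "0 \<le> t" shows "integrable (flow t) norm"
proof (rule integrableI_nonneg)
  have L: "1-lipschitz_on UNIV (norm :: real ^ 2 \<Rightarrow> real)"
    by (rule lipschitz_onI) (simp_all add: dist_norm norm_triangle_ineq3)
  let ?\<psi> = "\<lambda>n v. max (- real n) (min (real n) (norm (v :: real ^ 2)))"
  note cl = clamp_approximation[OF L]
  have [measurable]: "?\<psi> n \<in> borel_measurable borel" for n by measurable
  have le: "(LINT v|flow t. ?\<psi> n v) \<le> r0 + gbound 1 * t" for n
  proof -
    have i: "integrable f0 (?\<psi> n)" using cl(2) by (intro f0.integrable_const_bound[where B="real n"]) auto
    have "(LINT v|f0. ?\<psi> n v) \<le> (LINT v|f0. r0)"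
    proof (rule integral_mono_AE[OF i])
      show "AE v in f0. ?\<psi> n v \<le> r0"
        using AE_uniform_circle_norm[OF less_imp_le[OF r0_pos]] by eventually_elim (use r0_pos in auto)
    qed simp
    moreover have "(LINT s:{0..t}|lborel. LINT v|flow s. gen full (?\<psi> n) v) \<le> (LINT s:{0..t}|lborel. gbound 1)"
    proof (rule set_integral_mono)
      let ?b = "\<lambda>s. LINT v|flow s. gen full (?\<psi> n) v"
      have [measurable]: "?b \<in> borel_measurable borel"
        by (rule measurable_in_time[OF continuous_gen_full[OF cl(1,2)] gen_bound[OF cl(1) admissible_full]])
      have b: "\<bar>?b s\<bar> \<le> gbound 1" for s
        by (rule integral_gen_bound[OF flow.prob_space_axioms sets_spread cl(1) admissible_full])
      show "set_integrable lborel {0..t} (\<lambda>_. gbound 1)"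
        by (rule set_integrable_bounded[where B="gbound 1"]) (use gbound_nonneg[of 1] in auto)
      show "set_integrable lborel {0..t} ?b"
        by (rule set_integrable_bounded[OF _ b]) measurable
      show "?b s \<le> gbound 1" for s using b[of s] by linarith
    qed
    ultimately show ?thesis
      unfolding bounded_equation[OF cl(1,2) t]
      using t by (simp add: f0.prob_space[simplified] set_lebesgue_integral_def mult.commute)
  qed
  have nonneg: "0 \<le> ?\<psi> n v" for n v
    using norm_ge_zero[of v] of_nat_0_le_iff[of n] by linarith
  have mono: "?\<psi> n v \<le> ?\<psi> (Suc n) v" for n v
  proof -
    have "0 \<le> norm v" "0 \<le> real n" "real n \<le> real (Suc n)" by simp_all
    then show ?thesis by linarith
  qed
  have "(\<integral>\<^sup>+v. ennreal (norm v) \<partial>flow t) = (\<integral>\<^sup>+v. (SUP n. ennreal (?\<psi> n v)) \<partial>flow t)"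
  proof (rule nn_integral_cong)
    fix v :: "real^2"
    have "(\<lambda>n. ennreal (?\<psi> n v)) \<longlonglongrightarrow> ennreal (norm v)" by (rule tendsto_ennrealI[OF cl(3)])
    moreover have "incseq (\<lambda>n. ennreal (?\<psi> n v))"
      by (intro incseq_SucI ennreal_leI mono)
    ultimately show "ennreal (norm v) = (SUP n. ennreal (?\<psi> n v))"
      using LIMSEQ_SUP LIMSEQ_unique by blast
  qed
  also have "\<dots> = (SUP n. \<integral>\<^sup>+v. ennreal (?\<psi> n v) \<partial>flow t)"
    by (rule nn_integral_monotone_convergence_SUP)
       (auto intro!: incseq_SucI le_funI ennreal_leI mono simp del: of_nat_Suc)
  also have "\<dots> \<le> ennreal (r0 + gbound 1 * t)"
  proof (rule SUP_least)
    fix n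
    have "integrable (flow t) (?\<psi> n)" using cl(2) by (intro flow.integrable_const_bound[where B="real n"]) auto
    then have "(\<integral>\<^sup>+v. ennreal (?\<psi> n v) \<partial>flow t) = ennreal (LINT v|flow t. ?\<psi> n v)"
      by (rule nn_integral_eq_integral) (rule AE_I2, rule nonneg)
    then show "(\<integral>\<^sup>+v. ennreal (?\<psi> n v) \<partial>flow t) \<le> ennreal (r0 + gbound 1 * t)"
      using le[of n] by (simp add: ennreal_leI)
  qed
  finally show "(\<integral>\<^sup>+v. ennreal (norm v) \<partial>flow t) < \<infinity>"
    by (rule le_less_trans) simp
qed auto

lemma integrable_Lip_flow:
  fixes \<phi> :: "real ^ 2 \<Rightarrow> real"
  assumes L: "L-lipschitz_on UNIV \<phi>" and t: "0 \<le> t"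
  shows "integrable (flow t) \<phi>"
proof (rule Bochner_Integration.integrable_bound)
  show "integrable (flow t) (\<lambda>v. \<bar>\<phi> 0\<bar> + L * norm v)"
    using integrable_norm_flow[OF t] by auto
  show "\<phi> \<in> borel_measurable (flow t)" using lipschitz_borel_measurable[OF L] by measurable
  have "\<bar>\<phi> v\<bar> \<le> \<bar>\<bar>\<phi> 0\<bar> + L * norm v\<bar>" for v
    using lipschitz_onD[OF L, of v 0] by (simp add: dist_norm)
  then show "AE v in flow t. norm (\<phi> v) \<le> norm (\<bar>\<phi> 0\<bar> + L * norm v)" by simp
qed

lemma
  assumes L: "L-lipschitz_on UNIV \<phi>"
  shows flow_gen_measurable: "(\<lambda>s. LINT v|flow s. gen full \<phi> v) \<in> borel_measurable borel"
    and flow_gen_clamp_tendsto: "(\<lambda>n. LINT v|flow s. gen full (\<lambda>v. max (- real n) (min (real n) (\<phi> v))) v) \<longlonglongrightarrow> (LINT v|flow s. gen full \<phi> v)"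
proof -
  note cl = clamp_approximation[OF L]
  let ?\<psi> = "\<lambda>n v. max (- real n) (min (real n) (\<phi> v))"
  have [measurable]: "\<phi> \<in> borel_measurable borel" by (rule lipschitz_borel_measurable[OF L])
  show *: "(\<lambda>n. LINT v|flow s. gen full (?\<psi> n) v) \<longlonglongrightarrow> (LINT v|flow s. gen full \<phi> v)" for s
  proof (rule integral_dominated_convergence[where w="\<lambda>_. gbound L"])
    show "AE v in flow s. (\<lambda>n. gen full (?\<psi> n) v) \<longlonglongrightarrow> gen full \<phi> v"
      using cl(4) by simp
    show "AE v in flow s. norm (gen full (?\<psi> n) v) \<le> gbound L" for n
      using gen_bound[OF cl(1) admissible_full] by simp
  qed auto
  show "(\<lambda>s. LINT v|flow s. gen full \<phi> v) \<in> borel_measurable borel"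
  proof (rule borel_measurable_LIMSEQ_real[OF *])
    show "(\<lambda>s. LINT v|flow s. gen full (?\<psi> n) v) \<in> borel_measurable borel" for n
      by (rule measurable_in_time[OF continuous_gen_full[OF cl(1,2)] gen_bound[OF cl(1) admissible_full]])
  qed
qed

lemma flow_gen_bound:
  assumes L: "L-lipschitz_on UNIV \<phi>"
  shows "\<bar>LINT v|flow s. gen full \<phi> v\<bar> \<le> gbound L"
  by (rule integral_gen_bound[OF flow.prob_space_axioms sets_spread L admissible_full])

lemma flow_equation:
  assumes L: "L-lipschitz_on UNIV \<phi>" and t: "0 \<le> t"
  shows "(LINT v|flow t. \<phi> v) = (LINT v|f0. \<phi> v) + (LINT s:{0..t}|lborel. LINT v|flow s. gen full \<phi> v)"
proof -
  note cl = clamp_approximation[OF L]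
  let ?\<psi> = "\<lambda>n v. max (- real n) (min (real n) (\<phi> v))"
  have [measurable]: "\<phi> \<in> borel_measurable borel" by (rule lipschitz_borel_measurable[OF L])
  have lim: "(\<lambda>n. LINT v|flow s. ?\<psi> n v) \<longlonglongrightarrow> (LINT v|flow s. \<phi> v)" if "0 \<le> s" for s
  proof (rule integral_dominated_convergence[where w="\<lambda>v. \<bar>\<phi> v\<bar>"])
    show "integrable (flow s) (\<lambda>v. \<bar>\<phi> v\<bar>)" using integrable_Lip_flow[OF L that] by simp
  qed (use cl(3) in auto)
  have [measurable]: "(\<lambda>s. LINT v|flow s. gen full \<phi> v) \<in> borel_measurable borel"
    by (rule flow_gen_measurable[OF L])
  have [measurable]: "(\<lambda>s. LINT v|flow s. gen full (?\<psi> n) v) \<in> borel_measurable borel" for n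
    by (rule flow_gen_measurable[OF cl(1)])
  have "(\<lambda>n. LINT s:{0..t}|lborel. LINT v|flow s. gen full (?\<psi> n) v)
      \<longlonglongrightarrow> (LINT s:{0..t}|lborel. LINT v|flow s. gen full \<phi> v)"
    by (rule set_integral_tendsto_bounded[OF _ _ flow_gen_bound[OF cl(1)] flow_gen_clamp_tendsto[OF L]]) measurable
  then have "(\<lambda>n. (LINT v|f0. ?\<psi> n v) + (LINT s:{0..t}|lborel. LINT v|flow s. gen full (?\<psi> n) v))
      \<longlonglongrightarrow> (LINT v|f0. \<phi> v) + (LINT s:{0..t}|lborel. LINT v|flow s. gen full \<phi> v)"
    using lim[of 0] by (intro tendsto_add) (simp_all add: initial)
  then have "(\<lambda>n. LINT v|flow t. ?\<psi> n v) \<longlonglongrightarrow> (LINT v|f0. \<phi> v) + (LINT s:{0..t}|lborel. LINT v|flow s. gen full \<phi> v)"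
    by (simp only: bounded_equation[OF cl(1,2) t])
  with lim[OF t] show ?thesis by (rule LIMSEQ_unique)
qed

lemma integrable_collision_op:
  assumes L: "L-lipschitz_on UNIV \<phi>"
  shows "integrable (flow t \<Otimes>\<^sub>M f0) (\<lambda>(v, w). collision_op \<gamma> \<beta> \<phi> v w)"
proof (rule integrableI_bounded)
  have L0: "0 \<le> L" using lipschitz_on_nonneg[OF L] .
  have [measurable]: "\<phi> \<in> borel_measurable borel" by (rule lipschitz_borel_measurable[OF L])
  show m: "(\<lambda>(v, w). collision_op \<gamma> \<beta> \<phi> v w) \<in> borel_measurable (flow t \<Otimes>\<^sub>M f0)"
    unfolding collision_op_eq case_prod_unfold by measurable
  have mb: "measure \<beta> (space \<beta>) = \<Lambda>" using mass_beta Lambda_pos by (simp add: measure_def)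
  have bd: "\<bar>collision_op \<gamma> \<beta> \<phi> v w\<bar> \<le> \<Lambda> * L * norm (v - w) powr (\<gamma> + 1)" for v w
  proof -
    have b: "\<bar>norm (v - w) powr \<gamma> * (\<phi> (post_velocity v w \<theta>) - \<phi> v)\<bar> \<le> L * norm (v - w) powr (\<gamma> + 1)" for \<theta>
      by (rule collision_integrand_bound[OF L admissible_full])
    have "\<bar>collision_op \<gamma> \<beta> \<phi> v w\<bar> \<le> (LINT \<theta>|\<beta>. \<bar>norm (v - w) powr \<gamma> * (\<phi> (post_velocity v w \<theta>) - \<phi> v)\<bar>)"
      unfolding collision_op_eq by (rule integral_abs_bound)
    also have "\<dots> \<le> (LINT \<theta>|\<beta>. L * norm (v - w) powr (\<gamma> + 1))"
    proof (rule integral_mono)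
      show "integrable \<beta> (\<lambda>\<theta>. \<bar>norm (v - w) powr \<gamma> * (\<phi> (post_velocity v w \<theta>) - \<phi> v)\<bar>)"
        using b by (intro beta.integrable_const_bound[where B="L * norm (v - w) powr (\<gamma> + 1)"]) auto
    qed (use b in auto)
    finally show ?thesis by (simp add: mb mult_ac)
  qed
  have "(\<integral>\<^sup>+x. ennreal (norm (case x of (v, w) \<Rightarrow> collision_op \<gamma> \<beta> \<phi> v w)) \<partial>(flow t \<Otimes>\<^sub>M f0))
     \<le> (\<integral>\<^sup>+x. ennreal (\<Lambda> * L * norm (fst x - snd x) powr (\<gamma> + 1)) \<partial>(flow t \<Otimes>\<^sub>M f0))"
    using bd by (intro nn_integral_mono ennreal_leI) (auto simp: case_prod_unfold)
  also have "\<dots> = (\<integral>\<^sup>+v. \<integral>\<^sup>+w. ennreal (\<Lambda> * L * norm (v - w) powr (\<gamma> + 1)) \<partial>f0 \<partial>flow t)"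
    by (subst f0.nn_integral_fst[symmetric]) auto
  also have "\<dots> \<le> (\<integral>\<^sup>+v. ennreal (\<Lambda> * L) * ennreal (kappa (\<gamma> + 1)) \<partial>flow t)"
    using L0 Lambda_pos gamma
    by (intro nn_integral_mono) (auto simp: ennreal_mult nn_integral_cmult intro!: mult_left_mono kappa(2))
  also have "\<dots> < \<infinity>"
    by (simp add: flow.emeasure_space_1[simplified] ennreal_mult_less_top)
  finally show "(\<integral>\<^sup>+x. ennreal (norm (case x of (v, w) \<Rightarrow> collision_op \<gamma> \<beta> \<phi> v w)) \<partial>(flow t \<Otimes>\<^sub>M f0)) < \<infinity>" .
qed

theorem flow_solves_LB: "solves_LB f0 \<gamma> \<beta> flow"
  unfolding solves_LB_def
proof (intro conjI allI impI ballI)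
  show "flow 0 = f0" by (rule initial)
  show "prob_space (flow t)" "sets (flow t) = sets borel" for t
    by (rule flow.prob_space_axioms, rule sets_spread)
  fix \<phi> and t :: real assume "\<phi> \<in> Lip" and t: "0 \<le> t"
  then obtain L where L: "L-lipschitz_on UNIV \<phi>" by (auto simp: Lip_def)
  have [measurable]: "\<phi> \<in> borel_measurable borel" by (rule lipschitz_borel_measurable[OF L])
  show "integrable (flow t) \<phi>" by (rule integrable_Lip_flow[OF L t])
  show "integrable (flow t \<Otimes>\<^sub>M f0) (\<lambda>(v, w). collision_op \<gamma> \<beta> \<phi> v w)" by (rule integrable_collision_op[OF L])
  show "set_integrable lborel {0..t} (\<lambda>s. LINT v|flow s. LINT w|f0. collision_op \<gamma> \<beta> \<phi> v w)"
    unfolding integral_collision_op[OF L]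
    by (rule set_integrable_bounded[OF flow_gen_measurable[OF L] flow_gen_bound[OF L]])
  show "(LINT v|flow t. \<phi> v) = (LINT v|f0. \<phi> v) + (LINT s:{0..t}|lborel. LINT v|flow s. LINT w|f0. collision_op \<gamma> \<beta> \<phi> v w)"
    unfolding integral_collision_op[OF L] by (rule flow_equation[OF L t])
  fix v w :: "real^2"
  have "\<bar>\<phi> (post_velocity v w \<theta>) - \<phi> v\<bar> \<le> L * norm (v - w)" for \<theta>
  proof -
    have "\<bar>\<phi> (post_velocity v w \<theta>) - \<phi> v\<bar> \<le> L * norm (post_velocity v w \<theta> - v)"
      using lipschitz_onD[OF L, of "post_velocity v w \<theta>" v] by (simp add: dist_norm)
    also have "\<dots> \<le> L * norm (v - w)"
      using norm_post_velocity_minus(1) lipschitz_on_nonneg[OF L] by (intro mult_left_mono)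
    finally show ?thesis .
  qed
  then show "integrable \<beta> (\<lambda>\<theta>. \<phi> (post_velocity v w \<theta>) - \<phi> v)"
    by (intro beta.integrable_const_bound[where B="L * norm (v - w)"]) auto
qed

end

section \<open>Absolute continuity off the circle\<close>

text \<open>In complex notation, \<open>(1 + exp (\<i> \<theta>)) / 2 = cos (\<theta>/2) exp (\<i> \<theta>/2)\<close> and
\<open>(1 - exp (\<i> \<theta>)) / 2 = sin (\<theta>/2) exp (\<i> (\<theta>/2 - \<pi>/2))\<close>.\<close>

lemma post_velocity_polar:
  "post_velocity v w \<theta> = cos (\<theta> / 2) *\<^sub>R rotation (\<theta> / 2) v + sin (\<theta> / 2) *\<^sub>R rotation (\<theta> / 2 - pi / 2) w"
proof -
  define c s where "c = cos (\<theta> / 2)" and "s = sin (\<theta> / 2)"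
  have "cos \<theta> = c\<^sup>2 - s\<^sup>2" "sin \<theta> = 2 * s * c" "c\<^sup>2 + s\<^sup>2 = 1"
    using cos_double[of "\<theta>/2"] sin_double[of "\<theta>/2"] by (simp_all add: c_def s_def)
  moreover have "cos (\<theta> / 2 - pi / 2) = s" "sin (\<theta> / 2 - pi / 2) = - c"
    by (simp_all add: c_def s_def cos_diff sin_diff)
  ultimately show ?thesis
    unfolding post_velocity_def vec_eq_iff forall_2
    by (simp flip: c_def s_def) (intro conjI; algebra)
qed

text \<open>One collision is enough to produce a density: if \<open>v\<close> has a uniform direction and a nonzero modulus, the
velocity after the collision is a sum of two independent uniform points on circles with nonzero radii.\<close>

lemma nn_integral_post_velocity_null:
  assumes \<rho>: "\<rho> \<noteq> 0" and r: "r \<noteq> 0" and \<theta>: "\<theta> \<noteq> 0" "\<bar>\<theta>\<bar> \<le> pi / 2" and K: "K \<in> null_sets lborel"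
  shows "(\<integral>\<^sup>+a. \<integral>\<^sup>+w. indicator K (post_velocity (rotation a (\<rho> *\<^sub>R east)) w \<theta>) \<partial>uniform_circle r \<partial>angle_law) = 0"
proof -
  have [measurable]: "K \<in> sets borel" using K by auto
  interpret A: prob_space angle_law by (rule prob_space_angle_law)
  define p q where "p = \<rho> * cos (\<theta> / 2)" and "q = r * sin (\<theta> / 2)"
  have pq: "p \<noteq> 0" "q \<noteq> 0"
  proof -
    have "- (pi / 2) < \<theta> / 2" "\<theta> / 2 < pi / 2" using \<theta>(2) pi_gt_zero by linarith+
    then have "0 < cos (\<theta> / 2)" by (rule cos_gt_zero_pi)
    moreover have "sin (\<theta> / 2) \<noteq> 0"
      using \<theta> sin_gt_zero[of "\<theta> / 2"] sin_gt_zero[of "- \<theta> / 2"] by (cases "\<theta> > 0") auto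
    ultimately show "p \<noteq> 0" "q \<noteq> 0" using \<rho> r by (auto simp: p_def q_def)
  qed
  let ?I = "\<lambda>a b. indicator K (rotation a (p *\<^sub>R east) + rotation b (q *\<^sub>R east)) :: ennreal"
  have pv: "post_velocity (rotation a (\<rho> *\<^sub>R east)) (rotation b (r *\<^sub>R east)) \<theta>
     = rotation (a + \<theta> / 2) (p *\<^sub>R east) + rotation (b + (\<theta> / 2 - pi / 2)) (q *\<^sub>R east)" for a b
    by (simp add: post_velocity_polar rotation_rotation p_def q_def add.commute mult.commute flip: rotation_scaleR)
  have "(\<integral>\<^sup>+a. \<integral>\<^sup>+w. indicator K (post_velocity (rotation a (\<rho> *\<^sub>R east)) w \<theta>) \<partial>uniform_circle r \<partial>angle_law)
     = (\<integral>\<^sup>+a. \<integral>\<^sup>+b. ?I (a + \<theta> / 2) (b + (\<theta> / 2 - pi / 2)) \<partial>angle_law \<partial>angle_law)"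
    by (intro nn_integral_cong) (simp add: nn_integral_uniform_circle pv)
  also have "\<dots> = (\<integral>\<^sup>+a. \<integral>\<^sup>+b. ?I (a + \<theta> / 2) b \<partial>angle_law \<partial>angle_law)"
    by (intro nn_integral_cong nn_integral_angle_law_shift) (auto simp: rotation_periodic)
  also have "\<dots> = (\<integral>\<^sup>+a. \<integral>\<^sup>+b. ?I a b \<partial>angle_law \<partial>angle_law)"
    by (rule nn_integral_angle_law_shift[where f="\<lambda>a. \<integral>\<^sup>+b. ?I a b \<partial>angle_law"]) (auto simp: rotation_periodic)
  also have "\<dots> = 0" by (rule nn_integral_two_circles_null[OF pq K])
  finally show ?thesis .
qed

lemma post_velocity_inj:
  assumes "post_velocity v w \<theta> = post_velocity v w' \<theta>" "\<theta> \<noteq> 0" "\<bar>\<theta>\<bar> < 2 * pi"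
  shows "w = w'"
proof (rule ccontr)
  assume "w \<noteq> w'"
  have "rotation \<theta> (w - w') $ i = (w - w') $ i" for i
    using arg_cong[OF assms(1), of "\<lambda>x. x $ i"]
    by (simp add: post_velocity_def rotation_diff rotation_scaleR field_simps)
  then have "rotation \<theta> (w - w') = rotation 0 (w - w')" by (simp add: vec_eq_iff)
  with \<open>w \<noteq> w'\<close> assms(2,3) rotation_inj[of "w - w'" \<theta> 0] show False by simp
qed

lemma lipschitz_peak:
  fixes K :: "'a :: metric_space set"
  assumes "0 \<le> c"
  shows "c-lipschitz_on UNIV (\<lambda>v. max 0 (1 - c * infdist v K))"
proof (rule lipschitz_onI)
  fix v w
  have "\<bar>max 0 (1 - x) - max 0 (1 - y)\<bar> \<le> \<bar>x - y\<bar>" for x y :: real by linarith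
  then have "dist (max 0 (1 - c * infdist v K)) (max 0 (1 - c * infdist w K)) \<le> \<bar>c * infdist v K - c * infdist w K\<bar>"
    by (simp add: dist_real_def)
  also have "\<dots> \<le> c * dist v w"
    using assms infdist_triangle_abs[of v K w] by (simp add: abs_mult mult_left_mono flip: right_diff_distrib)
  finally show "dist (max 0 (1 - c * infdist v K)) (max 0 (1 - c * infdist w K)) \<le> c * dist v w" .
qed fact

context radial_solution
begin

text \<open>A compact set off the circle can only be charged through collisions that end in it. Test functions that
decrease to the indicator of \<open>K\<close> are nonnegative, so the loss term may be dropped; they vanish near the
circle, so there is no initial mass and the gain involves only collisions whose rate is at most \<open>\<delta> powr \<gamma>\<close>. The gain
therefore tends to zero when a single collision started from the law at time \<open>s\<close> misses \<open>K\<close>.\<close>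

lemma flow_compact_eq_0:
  assumes K: "compact K" and off: "\<And>v. v \<in> K \<Longrightarrow> norm v \<noteq> r0" and t: "0 \<le> t"
    and gain: "\<And>s. 0 \<le> s \<Longrightarrow> AE v in flow s. (\<integral>\<^sup>+z. indicator K (post_velocity v (fst z) (snd z)) \<partial>marks) = 0"
  shows "emeasure (flow t) K = 0"
proof (cases "K = {}")
  case False
  have [measurable]: "K \<in> sets borel" using K by (simp add: compact_imp_closed)
  have "continuous_on K (\<lambda>v. \<bar>norm v - r0\<bar>)" by (intro continuous_intros)
  then obtain v0 where v0: "v0 \<in> K" "\<And>v. v \<in> K \<Longrightarrow> \<bar>norm v0 - r0\<bar> \<le> \<bar>norm v - r0\<bar>"
    using continuous_attains_inf[OF K False] by metis
  define \<delta> where "\<delta> = \<bar>norm v0 - r0\<bar> / 2"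
  have \<delta>: "0 < \<delta>" using off[OF v0(1)] by (simp add: \<delta>_def)
  have far: "2 * \<delta> \<le> \<bar>norm v - r0\<bar>" if "v \<in> K" for v using v0(2)[OF that] by (simp add: \<delta>_def)
  define c where "c n = real (Suc n) / \<delta>" for n
  have c: "0 < c n" "1 / \<delta> \<le> c n" for n using \<delta> by (auto simp: c_def divide_right_mono)
  define \<phi> where "\<phi> n v = max 0 (1 - c n * infdist v K)" for n v
  have L: "(c n)-lipschitz_on UNIV (\<phi> n)" for n
    unfolding \<phi>_def using c(1)[of n] by (intro lipschitz_peak) simp
  have \<phi>01: "0 \<le> \<phi> n v" "\<phi> n v \<le> 1" for n v
    using c(1)[of n] infdist_nonneg[of v K] by (auto simp: \<phi>_def)
  have m [measurable]: "\<phi> n \<in> borel_measurable borel" for n by (rule lipschitz_borel_measurable[OF L])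
  have near: "\<delta> < \<bar>norm v - r0\<bar>" if "\<phi> n v \<noteq> 0" for n v
  proof -
    have "c n * infdist v K < 1" using that by (auto simp: \<phi>_def max_def split: if_splits)
    moreover have "1 / \<delta> * infdist v K \<le> c n * infdist v K"
      using c(2)[of n] infdist_nonneg[of v K] by (intro mult_right_mono)
    ultimately have "1 / \<delta> * infdist v K < 1" by linarith
    then have "infdist v K < \<delta>" using \<delta> by (simp add: field_simps)
    then obtain x where x: "x \<in> K" "dist v x < \<delta>" using infdist_attains_inf[OF compact_imp_closed[OF K] False] by metis
    have "\<bar>norm v - norm x\<bar> < \<delta>" using x(2) norm_triangle_ineq3[of v x] by (simp add: dist_norm)
    with far[OF x(1)] show ?thesis by linarith
  qed
  have lim: "(\<lambda>n. \<phi> n v) \<longlonglongrightarrow> indicator K v" for v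
  proof (cases "v \<in> K")
    case True then show ?thesis by (simp add: \<phi>_def)
  next
    case False
    then have i: "0 < infdist v K" using \<open>K \<noteq> {}\<close> compact_imp_closed[OF K] by (simp add: infdist_pos_not_in_closed)
    have "\<phi> n v = 0" if "nat \<lceil>\<delta> / infdist v K\<rceil> \<le> n" for n
    proof -
      have "\<delta> / infdist v K \<le> real (Suc n)" using that by linarith
      then have "1 \<le> c n * infdist v K" using \<delta> i by (simp add: c_def field_simps)
      then show ?thesis by (simp add: \<phi>_def)
    qed
    then have "\<forall>\<^sub>F n in sequentially. \<phi> n v = 0"
      unfolding eventually_sequentially by blast
    then show ?thesis using False by (simp add: tendsto_eventually)
  qed
  let ?H = "\<lambda>n v. LINT z|marks. \<phi> n (post_velocity v (fst z) (snd z))"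
  have Hi: "integrable marks (\<lambda>z. \<phi> n (post_velocity v (fst z) (snd z)))" for n v
    using \<phi>01 by (intro marks.integrable_const_bound[where B=1]) auto
  have H: "0 \<le> ?H n v" "?H n v \<le> \<Lambda>" for n v
  proof -
    show "0 \<le> ?H n v" using \<phi>01 by simp
    have "?H n v \<le> (LINT z|marks. 1)" using \<phi>01 by (intro integral_mono Hi) auto
    then show "?H n v \<le> \<Lambda>" by (simp add: measure_marks)
  qed
  have Hm [measurable]: "?H n \<in> borel_measurable borel" for n by measurable
  have gen_le: "gen full (\<phi> n) v \<le> \<delta> powr \<gamma> * ?H n v" for n v
  proof -
    have "AE z in marks. norm (fst z) = r0"
      using AE_uniform_circle_norm[OF less_imp_le[OF r0_pos]] by (intro AE_marks_fst) auto
    then have "AE z in marks. norm (v - fst z) powr \<gamma> * (\<phi> n (post_velocity v (fst z) (snd z)) - \<phi> n v)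
        \<le> \<delta> powr \<gamma> * \<phi> n (post_velocity v (fst z) (snd z))"
    proof eventually_elim
      case (elim z)
      let ?v' = "post_velocity v (fst z) (snd z)"
      have "norm (v - fst z) powr \<gamma> * (\<phi> n ?v' - \<phi> n v) \<le> norm (v - fst z) powr \<gamma> * \<phi> n ?v'"
        using \<phi>01(1)[of n v] by (intro mult_left_mono) auto
      also have "\<dots> \<le> \<delta> powr \<gamma> * \<phi> n ?v'"
      proof (cases "\<phi> n ?v' = 0")
        case False
        have "\<delta> < \<bar>norm ?v' - norm (fst z)\<bar>" using near[OF False] elim by simp
        also have "\<dots> \<le> norm (v - fst z)"
          using norm_triangle_ineq3[of ?v' "fst z"] norm_post_velocity_minus(2)[of v "fst z" "snd z"] by linarith
        finally show ?thesis
          using \<delta> gamma \<phi>01 by (intro mult_right_mono powr_mono2') auto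
      qed simp
      finally show ?case .
    qed
    then have "gen full (\<phi> n) v \<le> (LINT z|marks. \<delta> powr \<gamma> * \<phi> n (post_velocity v (fst z) (snd z)))"
      unfolding gen_def
      by (intro integral_mono_AE collision_integrand_integrable[OF L admissible_full] integrable_mult_right Hi)
    then show ?thesis by simp
  qed
  \<comment> \<open>the Lipschitz constants \<open>c n\<close> are unbounded, so only the positive part of \<open>b n\<close> is controlled uniformly in \<open>n\<close>\<close>
  define b where "b n s = (LINT v|flow s. gen full (\<phi> n) v)" for n s
  have bm [measurable]: "b n \<in> borel_measurable borel" for n
    unfolding b_def by (rule flow_gen_measurable[OF L])
  have Hf: "integrable (flow s) (?H n)" for s n
    using H[of n] by (intro flow.integrable_const_bound[where B=\<Lambda>]) auto
  have b_le: "b n s \<le> \<delta> powr \<gamma> * (LINT v|flow s. ?H n v)" for n s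
  proof -
    have "b n s \<le> (LINT v|flow s. \<delta> powr \<gamma> * ?H n v)"
      unfolding b_def
      by (intro integral_mono integral_gen_bound(1)[OF flow.prob_space_axioms sets_spread L admissible_full]
           integrable_mult_right Hf gen_le)
    then show ?thesis by simp
  qed
  have HL: "(LINT v|flow s. ?H n v) \<le> \<Lambda>" "0 \<le> (LINT v|flow s. ?H n v)" for n s
  proof -
    have "(LINT v|flow s. ?H n v) \<le> (LINT v|flow s. \<Lambda>)"
      by (intro integral_mono Hf H) auto
    then show "(LINT v|flow s. ?H n v) \<le> \<Lambda>" by (simp add: flow.prob_space[simplified])
    show "0 \<le> (LINT v|flow s. ?H n v)" using H by simp
  qed
  have Hlim: "(\<lambda>n. LINT v|flow s. ?H n v) \<longlonglongrightarrow> 0" if "0 \<le> s" for s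
  proof -
    have "(\<lambda>n. LINT v|flow s. ?H n v) \<longlonglongrightarrow> (LINT v|flow s. 0)"
    proof (rule integral_dominated_convergence[where w="\<lambda>_. \<Lambda>"])
      show "AE v in flow s. (\<lambda>n. ?H n v) \<longlonglongrightarrow> 0"
        using gain[OF that]
      proof eventually_elim
        case (elim v)
        have "(\<lambda>n. ?H n v) \<longlonglongrightarrow> (LINT z|marks. indicator K (post_velocity v (fst z) (snd z)))"
          by (rule integral_dominated_convergence[where w="\<lambda>_. 1"]) (use lim \<phi>01 in auto)
        moreover have "(LINT z|marks. indicator K (post_velocity v (fst z) (snd z)) :: real) = 0"
          using elim by (subst integral_eq_nn_integral) (auto simp: ennreal_indicator)
        ultimately show ?case by simp
      qed
      show "AE v in flow s. norm (?H n v) \<le> \<Lambda>" for n using H[of n] by auto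
    qed auto
    then show ?thesis by simp
  qed
  have meas_le: "measure (flow t) K \<le> (LINT s:{0..t}|lborel. max 0 (b n s))" for n
  proof -
    have "measure (flow t) K = (LINT v|flow t. indicator K v)" by simp
    also have "\<dots> \<le> (LINT v|flow t. \<phi> n v)"
    proof (rule integral_mono)
      show "integrable (flow t) (\<phi> n)" by (rule integrable_Lip_flow[OF L t])
      show "indicator K v \<le> \<phi> n v" for v using \<phi>01[of n v] by (auto simp: indicator_def \<phi>_def)
      show "integrable (flow t) (indicator K :: _ \<Rightarrow> real)"
        by (intro integrable_real_indicator) (auto simp: flow.emeasure_eq_measure)
    qed
    also have "\<dots> = (LINT v|f0. \<phi> n v) + (LINT s:{0..t}|lborel. b n s)"
      unfolding b_def by (rule flow_equation[OF L t])
    also have "(LINT v|f0. \<phi> n v) = 0"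
    proof (rule integral_eq_zero_AE)
      show "AE v in f0. \<phi> n v = 0"
        using AE_uniform_circle_norm[OF less_imp_le[OF r0_pos]] 
      proof eventually_elim
        case (elim v) then show ?case using near[of n v] \<delta> by auto
      qed
    qed
    also have "(LINT s:{0..t}|lborel. b n s) \<le> (LINT s:{0..t}|lborel. max 0 (b n s))"
    proof (intro set_integral_mono set_integrable_bounded[where B="gbound (c n)"])
      show b1: "\<bar>b n s\<bar> \<le> gbound (c n)" for s
        unfolding b_def by (rule flow_gen_bound[OF L])
      show "\<bar>max 0 (b n s)\<bar> \<le> gbound (c n)" for s using b1[of s] by linarith
    qed auto
    finally show ?thesis by simp
  qed
  have "(\<lambda>n. LINT s:{0..t}|lborel. max 0 (b n s)) \<longlonglongrightarrow> (LINT s:{0..t}|lborel. 0)"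
  proof (rule set_integral_tendsto_bounded[where B="\<delta> powr \<gamma> * \<Lambda>"])
    have ub: "max 0 (b n s) \<le> \<delta> powr \<gamma> * (LINT v|flow s. ?H n v)" for n s
      using b_le[of n s] HL(2)[of s n] by simp
    show "\<bar>max 0 (b n s)\<bar> \<le> \<delta> powr \<gamma> * \<Lambda>" for n s
    proof -
      have "\<delta> powr \<gamma> * (LINT v|flow s. ?H n v) \<le> \<delta> powr \<gamma> * \<Lambda>" using HL(1) by (intro mult_left_mono) auto
      then show ?thesis using ub[of n s] by linarith
    qed
    fix s assume "s \<in> {0..t}"
    then have H0: "(\<lambda>n. \<delta> powr \<gamma> * (LINT v|flow s. ?H n v)) \<longlonglongrightarrow> 0"
      by (intro tendsto_mult_right_zero Hlim) auto
    show "(\<lambda>n. max 0 (b n s)) \<longlonglongrightarrow> 0"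
      by (rule tendsto_sandwich[OF _ _ tendsto_const H0]) (use ub in auto)
  qed auto
  then have "(\<lambda>n. LINT s:{0..t}|lborel. max 0 (b n s)) \<longlonglongrightarrow> 0" by simp
  then have "measure (flow t) K \<le> 0"
    by (rule LIMSEQ_le_const) (use meas_le in auto)
  then show ?thesis by (simp add: flow.emeasure_eq_measure measure_le_0_iff)
qed simp

text \<open>For given \<open>v\<close> and \<open>\<theta>\<close> at most one partner \<open>w\<close> leads to the velocity \<open>0\<close>, and the circle law has
no atoms. The origin has to be excluded first because a collision from the origin yields no density.\<close>

lemma flow_singleton_0:
  assumes t: "0 \<le> t" shows "emeasure (flow t) {0} = 0"
proof (rule flow_compact_eq_0[OF _ _ t])
  fix s show "AE v in flow s. (\<integral>\<^sup>+z. indicator {0} (post_velocity v (fst z) (snd z)) \<partial>marks) = 0"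
  proof (rule AE_I2)
    fix v
    have "(\<integral>\<^sup>+z. indicator {0} (post_velocity v (fst z) (snd z)) \<partial>marks)
       = (\<integral>\<^sup>+\<theta>. \<integral>\<^sup>+w. indicator {0} (post_velocity v w \<theta>) \<partial>f0 \<partial>\<beta>)"
      unfolding marks_def by (subst f0_beta.nn_integral_snd[symmetric]) auto
    also have "\<dots> = (\<integral>\<^sup>+\<theta>. 0 \<partial>\<beta>)"
    proof (rule nn_integral_cong)
      fix \<theta> assume "\<theta> \<in> space \<beta>"
      then have \<theta>: "\<theta> \<noteq> 0" "\<bar>\<theta>\<bar> < 2 * pi" using pi_gt_zero by (auto simp: space_beta abs_if)
      have "AE w in f0. post_velocity v w \<theta> \<noteq> 0"
      proof (cases "\<exists>w. post_velocity v w \<theta> = 0")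
        case True
        then obtain w0 where w0: "post_velocity v w0 \<theta> = 0" by blast
        show ?thesis using AE_uniform_circle_neq[OF r0_pos, of w0]
          by eventually_elim (use w0 post_velocity_inj[OF _ \<theta>] in metis)
      qed auto
      then show "(\<integral>\<^sup>+w. indicator {0} (post_velocity v w \<theta>) \<partial>f0) = 0"
        by (subst nn_integral_0_iff_AE) (auto elim!: eventually_mono simp: indicator_def)
    qed
    finally show "(\<integral>\<^sup>+z. indicator {0} (post_velocity v (fst z) (snd z)) \<partial>marks) = 0" by simp
  qed
qed (use r0_pos in auto)

lemma flow_compact_null:
  assumes K: "compact K" "K \<in> null_sets lborel" and off: "\<And>v. v \<in> K \<Longrightarrow> norm v \<noteq> r0" and t: "0 \<le> t"
  shows "emeasure (flow t) K = 0"
proof (rule flow_compact_eq_0[OF K(1) off t])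
  fix s :: real assume s: "0 \<le> s"
  have [measurable]: "K \<in> sets borel" using K by auto
  interpret A: prob_space angle_law by (rule prob_space_angle_law)
  interpret M: real_distribution "\<mu> s" by (rule real_distribution_mu)
  interpret AB: pair_sigma_finite angle_law \<beta> ..
  let ?H = "\<lambda>v. \<integral>\<^sup>+z. indicator K (post_velocity v (fst z) (snd z)) \<partial>marks"
  have [measurable]: "?H \<in> borel_measurable borel" by measurable
  have "(\<integral>\<^sup>+v. indicator {0} v \<partial>flow s) = 0" using flow_singleton_0[OF s] by simp
  then have "(\<integral>\<^sup>+\<rho>. \<integral>\<^sup>+a. indicator {0} (rotation a (\<rho> *\<^sub>R east)) \<partial>angle_law \<partial>\<mu> s) = 0"
    by (subst (asm) nn_integral_spread[OF real_distribution_mu]) auto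
  then have "AE \<rho> in \<mu> s. (\<integral>\<^sup>+a. indicator {0} (rotation a (\<rho> *\<^sub>R east)) \<partial>angle_law) = 0"
    by (subst (asm) nn_integral_0_iff_AE) auto
  then have nz: "AE \<rho> in \<mu> s. \<rho> \<noteq> 0"
    by eventually_elim (auto simp: A.emeasure_space_1[simplified])
  have "(\<integral>\<^sup>+v. ?H v \<partial>flow s) = (\<integral>\<^sup>+\<rho>. \<integral>\<^sup>+a. ?H (rotation a (\<rho> *\<^sub>R east)) \<partial>angle_law \<partial>\<mu> s)"
    by (rule nn_integral_spread[OF real_distribution_mu]) simp
  also have "\<dots> = (\<integral>\<^sup>+\<rho>. 0 \<partial>\<mu> s)"
  proof (rule nn_integral_cong_AE, use nz in eventually_elim)
    fix \<rho> :: real assume \<rho>: "\<rho> \<noteq> 0"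
    have "(\<integral>\<^sup>+a. ?H (rotation a (\<rho> *\<^sub>R east)) \<partial>angle_law)
      = (\<integral>\<^sup>+a. \<integral>\<^sup>+\<theta>. \<integral>\<^sup>+w. indicator K (post_velocity (rotation a (\<rho> *\<^sub>R east)) w \<theta>) \<partial>f0 \<partial>\<beta> \<partial>angle_law)"
      unfolding marks_def by (subst f0_beta.nn_integral_snd[symmetric]) auto
    also have "\<dots> = (\<integral>\<^sup>+\<theta>. \<integral>\<^sup>+a. \<integral>\<^sup>+w. indicator K (post_velocity (rotation a (\<rho> *\<^sub>R east)) w \<theta>) \<partial>f0 \<partial>angle_law \<partial>\<beta>)"
      by (rule AB.Fubini'[symmetric]) measurable
    also have "\<dots> = (\<integral>\<^sup>+\<theta>. 0 \<partial>\<beta>)"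
      using \<rho> r0_pos K(2)
      by (intro nn_integral_cong nn_integral_post_velocity_null) (auto simp: space_beta abs_if)
    finally show "(\<integral>\<^sup>+a. ?H (rotation a (\<rho> *\<^sub>R east)) \<partial>angle_law) = 0" by simp
  qed
  finally have "(\<integral>\<^sup>+v. ?H v \<partial>flow s) = 0" by simp
  then show "AE v in flow s. ?H v = 0"
    by (subst (asm) nn_integral_0_iff_AE) auto
qed

text \<open>Inner regularity reduces the claim to compact sets.\<close>

lemma flow_null_off_circle:
  assumes N: "N \<in> null_sets lborel" and t: "0 \<le> t"
  shows "emeasure (flow t) (N - {v. norm v = r0}) = 0"
proof -
  let ?B = "N - {v. norm v = r0}"
  have [measurable]: "N \<in> sets borel" using N by auto
  have B: "?B \<in> sets borel" by measurable
  have "emeasure (flow t) ?B = (SUP K \<in> {K. K \<subseteq> ?B \<and> compact K}. emeasure (flow t) K)"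
    by (rule inner_regular) (use B flow.emeasure_finite in \<open>auto simp: sets_spread\<close>)
  also have "\<dots> \<le> 0"
  proof (rule SUP_least)
    fix K assume "K \<in> {K. K \<subseteq> ?B \<and> compact K}"
    then have K: "compact K" "K \<subseteq> N" "\<And>v. v \<in> K \<Longrightarrow> norm v \<noteq> r0" by auto
    have "K \<in> null_sets lborel"
      by (rule null_sets_subset[OF N _ K(2)]) (use K(1) in \<open>simp add: compact_imp_closed\<close>)
    then show "emeasure (flow t) K \<le> 0" using flow_compact_null[OF K(1) _ K(3) t] by simp
  qed
  finally show ?thesis by simp
qed

end

section \<open>No mass on the circle\<close>

text \<open>The power \<open>x powr a\<close> with \<open>a < 1\<close>, replaced below \<open>\<eta>\<close> by the chord from the origin. The result is
Lipschitz, stays below \<open>x powr a\<close>, and agrees with it from \<open>\<eta>\<close> on.\<close>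

definition chopped_powr :: "real \<Rightarrow> real \<Rightarrow> real \<Rightarrow> real" where
  "chopped_powr a \<eta> x = min (x powr a) (\<eta> powr (a - 1) * x)"

lemma chopped_powr_bounds:
  assumes "0 < a" "a < 1" "0 < \<eta>" "0 \<le> x"
  shows "0 \<le> chopped_powr a \<eta> x" "chopped_powr a \<eta> x \<le> x powr a" "chopped_powr a \<eta> x \<le> 1 + x"
    "chopped_powr a \<eta> 0 = 0"
proof -
  show "0 \<le> chopped_powr a \<eta> x" "chopped_powr a \<eta> x \<le> x powr a" "chopped_powr a \<eta> 0 = 0"
    using assms by (auto simp: chopped_powr_def)
  have "x powr a \<le> 1 + x"
  proof (cases "x \<le> 1")
    case True
    then have "x powr a \<le> 1 powr a" using assms by (intro powr_mono2) auto
    then show ?thesis using assms by simp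
  next
    case False
    then have "x powr a \<le> x powr 1" using assms by (intro powr_mono) auto
    then show ?thesis using False by simp
  qed
  then show "chopped_powr a \<eta> x \<le> 1 + x" by (simp add: chopped_powr_def min_le_iff_disj)
qed

lemma chopped_powr_eq:
  assumes "a < 1" "0 < \<eta>" "\<eta> \<le> x"
  shows "chopped_powr a \<eta> x = x powr a"
proof -
  have "x powr a = x powr (a - 1) * x powr 1"
    unfolding powr_add[symmetric] by simp
  also have "\<dots> = x powr (a - 1) * x" using assms by simp
  also have "\<dots> \<le> \<eta> powr (a - 1) * x"
    using assms by (intro mult_right_mono powr_mono2') auto
  finally show ?thesis by (simp add: chopped_powr_def)
qed

text \<open>The quotient by \<open>x\<close> is nonincreasing, and it is at most \<open>\<eta> powr (a - 1)\<close>.\<close>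

lemma chopped_powr_lipschitz:
  assumes a: "0 < a" "a < 1" and \<eta>: "0 < \<eta>" and xy: "0 \<le> x" "x \<le> y"
  shows "0 \<le> chopped_powr a \<eta> y - chopped_powr a \<eta> x"
    and "chopped_powr a \<eta> y - chopped_powr a \<eta> x \<le> \<eta> powr (a - 1) * (y - x)"
proof -
  show "0 \<le> chopped_powr a \<eta> y - chopped_powr a \<eta> x"
    using assms powr_mono2[of a x y] mult_left_mono[of x y "\<eta> powr (a - 1)"]
    by (auto simp: chopped_powr_def min_le_iff_disj)
  show "chopped_powr a \<eta> y - chopped_powr a \<eta> x \<le> \<eta> powr (a - 1) * (y - x)"
  proof (cases "x = 0")
    case True then show ?thesis using xy by (simp add: chopped_powr_def)
  next
    case False
    then have x: "0 < x" using xy by simp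
    have q: "1 \<le> y / x" using x xy by simp
    have "y powr a = (y / x) powr a * x powr a"
      using x xy by (simp flip: powr_mult)
    also have "\<dots> \<le> (y / x) powr 1 * x powr a"
      using q a by (intro mult_right_mono powr_mono) auto
    also have "(y / x) powr 1 = y / x" using q by (intro powr_one) linarith
    finally have 1: "y powr a \<le> (y / x) * x powr a" .
    have "chopped_powr a \<eta> y \<le> (y / x) * chopped_powr a \<eta> x"
    proof (cases "x powr a \<le> \<eta> powr (a - 1) * x")
      case True
      then show ?thesis using 1 by (simp add: chopped_powr_def min_def)
    next
      case False
      have "chopped_powr a \<eta> y \<le> \<eta> powr (a - 1) * y" by (simp add: chopped_powr_def)
      also have "\<dots> = (y / x) * chopped_powr a \<eta> x"
        using False x by (simp add: chopped_powr_def min_def)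
      finally show ?thesis .
    qed
    then have "chopped_powr a \<eta> y - chopped_powr a \<eta> x \<le> (y / x - 1) * chopped_powr a \<eta> x"
      by (simp add: algebra_simps)
    also have "\<dots> \<le> (y / x - 1) * (\<eta> powr (a - 1) * x)"
      using q by (intro mult_left_mono) (auto simp: chopped_powr_def)
    also have "\<dots> = \<eta> powr (a - 1) * (y - x)" using x by (simp add: field_simps)
    finally show ?thesis .
  qed
qed

lemma lipschitz_chopped_powr_norm:
  assumes a: "0 < a" "a < 1" and \<eta>: "0 < \<eta>"
  shows "(\<eta> powr (a - 1))-lipschitz_on UNIV (\<lambda>v :: 'a :: real_normed_vector. chopped_powr a \<eta> \<bar>norm v - r\<bar>)"
proof (rule lipschitz_onI)
  fix v w :: 'a
  have "\<bar>chopped_powr a \<eta> x - chopped_powr a \<eta> y\<bar> \<le> \<eta> powr (a - 1) * \<bar>x - y\<bar>" if "0 \<le> x" "0 \<le> y" for x y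
    using chopped_powr_lipschitz[OF a \<eta>, of x y] chopped_powr_lipschitz[OF a \<eta>, of y x] that
    by (cases "x \<le> y") (auto simp: abs_if)
  then have "dist (chopped_powr a \<eta> \<bar>norm v - r\<bar>) (chopped_powr a \<eta> \<bar>norm w - r\<bar>)
      \<le> \<eta> powr (a - 1) * \<bar>\<bar>norm v - r\<bar> - \<bar>norm w - r\<bar>\<bar>" by (simp add: dist_real_def)
  also have "\<dots> \<le> \<eta> powr (a - 1) * dist v w"
  proof (intro mult_left_mono)
    have "\<bar>\<bar>norm v - r\<bar> - \<bar>norm w - r\<bar>\<bar> \<le> \<bar>norm v - norm w\<bar>" by linarith
    also have "\<dots> \<le> dist v w" unfolding dist_norm by (rule norm_triangle_ineq3)
    finally show "\<bar>\<bar>norm v - r\<bar> - \<bar>norm w - r\<bar>\<bar> \<le> dist v w" .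
  qed simp
  finally show "dist (chopped_powr a \<eta> \<bar>norm v - r\<bar>) (chopped_powr a \<eta> \<bar>norm w - r\<bar>) \<le> \<eta> powr (a - 1) * dist v w" .
qed simp

text \<open>For two points of the circle at angular distance \<open>b\<close>, the squared modulus after the collision is
\<open>r^2 (1 + sin \<theta> sin b)\<close>: the collision leaves the circle by an amount proportional to \<open>b\<close>.\<close>

lemma post_velocity_circle:
  assumes r: "0 < r" and b: "0 \<le> b" "b \<le> 1" and \<theta>: "s \<le> \<bar>sin \<theta>\<bar>" "0 \<le> s"
  defines "v \<equiv> r *\<^sub>R east" and "w \<equiv> rotation b (r *\<^sub>R east)"
  shows "r * s / 9 * b \<le> \<bar>norm (post_velocity v w \<theta>) - r\<bar>" and "norm (v - w) \<le> r * b"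
    and "0 < b \<Longrightarrow> v \<noteq> w"
proof -
  let ?n = "norm (post_velocity v w \<theta>)"
  have sq: "?n\<^sup>2 = r\<^sup>2 * (1 + sin \<theta> * sin b)"
  proof -
    define c k where "c = cos \<theta>" and "k = sin \<theta>"
    define C S where "C = cos b" and "S = sin b"
    have 1: "c\<^sup>2 + k\<^sup>2 = 1" "C\<^sup>2 + S\<^sup>2 = 1" by (simp_all add: c_def k_def C_def S_def)
    have "?n\<^sup>2 = (r / 2 + r * C / 2 + c * (r / 2 - r * C / 2) + k * (r * S / 2))\<^sup>2
        + (r * S / 2 + k * (r / 2 - r * C / 2) - c * (r * S / 2))\<^sup>2"
      by (simp add: norm_vec_def L2_set_def sum_2 post_velocity_def v_def w_def c_def k_def C_def S_def algebra_simps)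
    also have "\<dots> = r\<^sup>2 / 4 * ((1 + C + c * (1 - C) + k * S)\<^sup>2 + (S + k * (1 - C) - c * S)\<^sup>2)"
      by (simp add: power2_eq_square field_simps)
    also have "(1 + C + c * (1 - C) + k * S)\<^sup>2 + (S + k * (1 - C) - c * S)\<^sup>2 = 4 * (1 + k * S)"
      using 1 by algebra
    also have "r\<^sup>2 / 4 * (4 * (1 + k * S)) = r\<^sup>2 * (1 + k * S)" by simp
    finally show ?thesis by (simp only: k_def S_def)
  qed
  have "?n\<^sup>2 \<le> r\<^sup>2 * (1 + 1)"
  proof -
    have "\<bar>sin \<theta> * sin b\<bar> \<le> 1" by (simp add: abs_mult mult_le_one)
    then show ?thesis unfolding sq by (intro mult_left_mono add_left_mono) auto
  qed
  also have "\<dots> \<le> (2 * r)\<^sup>2" using r by (simp add: power2_eq_square)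
  finally have n2: "?n \<le> 2 * r" by (rule power2_le_imp_le) (use r in simp)
  have "r\<^sup>2 * (s * (b / 3)) \<le> r\<^sup>2 * (\<bar>sin \<theta>\<bar> * \<bar>sin b\<bar>)"
    using b \<theta> sin_ge_third[of b] by (intro mult_left_mono mult_mono) auto
  also have "\<dots> = \<bar>?n\<^sup>2 - r\<^sup>2\<bar>" unfolding sq by (simp add: algebra_simps abs_mult)
  also have "\<dots> = \<bar>?n - r\<bar> * (?n + r)"
  proof -
    have "?n\<^sup>2 - r\<^sup>2 = (?n - r) * (?n + r)" by algebra
    then show ?thesis using r by (simp add: abs_mult)
  qed
  also have "\<dots> \<le> \<bar>?n - r\<bar> * (3 * r)" using n2 by (intro mult_left_mono) auto
  finally have "r * (r * s / 9 * b) \<le> r * \<bar>?n - r\<bar>" by (simp add: power2_eq_square mult_ac)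
  then show "r * s / 9 * b \<le> \<bar>?n - r\<bar>" using r by simp
  have "norm (v - w) ^ 2 = r\<^sup>2 * (2 - 2 * cos b)"
  proof -
    have "(r - r * cos b)\<^sup>2 + (r * sin b)\<^sup>2 = r\<^sup>2 * (((sin b)\<^sup>2 + (cos b)\<^sup>2) + 1 - 2 * cos b)" by algebra
    then show ?thesis by (simp add: norm_vec_def L2_set_def sum_2 v_def w_def mult.commute)
  qed
  also have "2 - 2 * cos b = (2 * sin (b / 2))\<^sup>2"
    using cos_double_sin[of "b / 2"] by (simp add: power2_eq_square)
  also have "r\<^sup>2 * \<dots> = (r * (2 * sin (b / 2)))\<^sup>2" by (simp add: power_mult_distrib)
  finally have eq: "norm (v - w) = \<bar>r * (2 * sin (b / 2))\<bar>" by (metis power2_eq_iff_nonneg abs_ge_zero norm_ge_zero power2_abs)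
  also have "\<dots> \<le> r * b"
    using r b abs_sin_x_le_abs_x[of "b / 2"] by (simp add: abs_mult)
  finally show "norm (v - w) \<le> r * b" .
  show "v \<noteq> w" if "0 < b"
    using eq r b that sin_ge_third[of "b / 2"] by auto
qed

context lin_boltzmann
begin

text \<open>A partner at angular distance \<open>b\<close> collides at rate at least of order \<open>b powr \<gamma>\<close> and then contributes a
value of order \<open>b powr (- \<gamma> - 1)\<close>. The exponent is critical: the product is of order \<open>1 / b\<close>, whose
integral over \<open>[\<eta> / c0, 1]\<close> diverges logarithmically as \<open>\<eta>\<close> tends to \<open>0\<close>.\<close>

lemma gain_on_circle:
  assumes \<theta>0: "0 < \<theta>0" "\<theta>0 < pi / 2" "AE \<theta> in \<beta>. \<theta>0 \<le> \<bar>\<theta>\<bar>" and \<eta>: "0 < \<eta>"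
  defines "c0 \<equiv> r0 * sin \<theta>0 / 9"
  defines "\<phi> \<equiv> \<lambda>v :: real ^ 2. chopped_powr (- \<gamma> - 1) \<eta> \<bar>norm v - r0\<bar>"
  assumes small: "\<eta> \<le> c0"
  assumes v: "norm v = r0"
  shows "\<Lambda> * r0 powr \<gamma> * c0 powr (- \<gamma> - 1) / (2 * pi) * ln (c0 / \<eta>) \<le> gen full \<phi> v"
proof -
  define a where "a = - \<gamma> - 1"
  have a: "0 < a" "a < 1" using gamma by (auto simp: a_def)
  have sin0: "0 < sin \<theta>0" using \<theta>0 by (intro sin_gt_zero) auto
  have c0: "0 < c0" using sin0 r0_pos by (simp add: c0_def)
  have L: "(\<eta> powr (a - 1))-lipschitz_on UNIV \<phi>"
    unfolding \<phi>_def a_def[symmetric] by (rule lipschitz_chopped_powr_norm[OF a \<eta>])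
  have [measurable]: "\<phi> \<in> borel_measurable borel" by (rule lipschitz_borel_measurable[OF L])
  have \<phi>0: "0 \<le> \<phi> u" for u unfolding \<phi>_def a_def[symmetric] using a \<eta> by (intro chopped_powr_bounds) auto
  let ?e = "r0 *\<^sub>R east"
  have \<phi>e: "\<phi> ?e = 0" using chopped_powr_bounds(4)[OF a \<eta>, of 0] r0_pos by (simp add: \<phi>_def a_def)
  obtain \<alpha> where "v = rotation \<alpha> (norm v *\<^sub>R east)" by (rule polar_form)
  then have "gen full \<phi> v = gen full (\<lambda>u. \<phi> (rotation \<alpha> u)) ?e"
    using v gen_rotation[of \<phi> full \<alpha> ?e] by simp
  also have "(\<lambda>u. \<phi> (rotation \<alpha> u)) = \<phi>" by (simp add: \<phi>_def norm_rotation)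
  \<comment> \<open>\<open>\<phi>\<close> is radial, so \<open>v\<close> may be replaced by the point of the circle on the first axis\<close>
  finally have gv: "gen full \<phi> v = gen full \<phi> ?e" .
  let ?F = "\<lambda>w \<theta>. norm (?e - w) powr \<gamma> * \<phi> (post_velocity ?e w \<theta>)"
  have int: "integrable marks (\<lambda>z. ?F (fst z) (snd z))"
    using collision_integrand_integrable[OF L admissible_full, of ?e] by (simp add: \<phi>e)
  define A where "A = \<Lambda> * r0 powr \<gamma> * c0 powr a / (2 * pi)"
  have A0: "0 \<le> A" using Lambda_pos by (simp add: A_def)
  have "ennreal (gen full \<phi> ?e) = (\<integral>\<^sup>+z. ennreal (?F (fst z) (snd z)) \<partial>marks)"
    unfolding gen_def using \<phi>e \<phi>0 by (subst nn_integral_eq_integral[OF int]) auto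
  also have "\<dots> = (\<integral>\<^sup>+w. \<integral>\<^sup>+\<theta>. ennreal (?F w \<theta>) \<partial>\<beta> \<partial>f0)"
    unfolding marks_def by (subst beta.nn_integral_fst[symmetric]) auto
  also have "\<dots> = (\<integral>\<^sup>+b. (\<integral>\<^sup>+\<theta>. ennreal (?F (rotation b ?e) \<theta>) \<partial>\<beta>) * indicator {0..2*pi} b \<partial>lborel) / ennreal (2 * pi)"
    by (subst nn_integral_uniform_circle, simp, subst nn_integral_angle_law) auto
  also have "\<dots> \<ge> (\<integral>\<^sup>+b. ennreal (2 * pi * A) * (ennreal (1 / b) * indicator {\<eta> / c0..1} b) \<partial>lborel) / ennreal (2 * pi)"
  proof (intro divide_right_mono_ennreal nn_integral_mono)
    fix b :: real
    show "ennreal (2 * pi * A) * (ennreal (1 / b) * indicator {\<eta> / c0..1} b)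
      \<le> (\<integral>\<^sup>+\<theta>. ennreal (?F (rotation b ?e) \<theta>) \<partial>\<beta>) * indicator {0..2*pi} b"
    proof (cases "b \<in> {\<eta> / c0..1}")
      case True
      have b: "0 < b" "b \<le> 1" "\<eta> \<le> c0 * b"
        using True c0 \<eta> by (auto simp: field_simps intro: less_le_trans[of 0 "\<eta> / c0"])
      have "ennreal (2 * pi * A) * ennreal (1 / b) = ennreal (r0 powr \<gamma> * c0 powr a * (1 / b)) * ennreal \<Lambda>"
        using Lambda_pos b A0 by (simp add: A_def flip: ennreal_mult)
      also have "\<dots> = (\<integral>\<^sup>+\<theta>. ennreal (r0 powr \<gamma> * c0 powr a * (1 / b)) \<partial>\<beta>)"
        by (simp add: mass_beta)
      also have "\<dots> \<le> (\<integral>\<^sup>+\<theta>. ennreal (?F (rotation b ?e) \<theta>) \<partial>\<beta>)"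
      proof (rule nn_integral_mono_AE)
        show "AE \<theta> in \<beta>. ennreal (r0 powr \<gamma> * c0 powr a * (1 / b)) \<le> ennreal (?F (rotation b ?e) \<theta>)"
          using \<theta>0(3) AE_space
        proof eventually_elim
          case (elim \<theta>)
          have "sin \<theta>0 \<le> sin \<bar>\<theta>\<bar>" using elim \<theta>0 by (intro sin_monotone_2pi_le) (auto simp: space_beta)
          also have "\<dots> \<le> \<bar>sin \<theta>\<bar>" by (cases "\<theta> \<ge> 0") (auto simp: abs_if)
          finally have s: "sin \<theta>0 \<le> \<bar>sin \<theta>\<bar>" .
          note pc = post_velocity_circle[OF r0_pos less_imp_le[OF b(1)] b(2) s less_imp_le[OF sin0]]
          let ?v' = "post_velocity ?e (rotation b ?e) \<theta>"
          have q: "c0 * b \<le> \<bar>norm ?v' - r0\<bar>" using pc(1) by (simp add: c0_def)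
          have "r0 powr \<gamma> * c0 powr a * (1 / b) = (r0 * b) powr \<gamma> * (c0 * b) powr a"
          proof -
            have "b powr \<gamma> * b powr a = 1 / b"
              using b by (simp add: a_def powr_minus_divide flip: powr_add)
            moreover have "(r0 * b) powr \<gamma> * (c0 * b) powr a = r0 powr \<gamma> * c0 powr a * (b powr \<gamma> * b powr a)"
              using r0_pos c0 b by (simp add: powr_mult)
            ultimately show ?thesis by simp
          qed
          also have "\<dots> \<le> norm (?e - rotation b ?e) powr \<gamma> * \<phi> ?v'"
          proof (intro mult_mono)
            show "(r0 * b) powr \<gamma> \<le> norm (?e - rotation b ?e) powr \<gamma>"
              using pc(2,3) b gamma by (intro powr_mono2') auto
            have "(c0 * b) powr a \<le> \<bar>norm ?v' - r0\<bar> powr a"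
              using q a c0 b by (intro powr_mono2) auto
            also have "\<dots> = \<phi> ?v'"
              unfolding \<phi>_def a_def[symmetric] using q b(3) by (intro chopped_powr_eq[symmetric] a \<eta>) auto
            finally show "(c0 * b) powr a \<le> \<phi> ?v'" .
          qed auto
          finally show ?case by (rule ennreal_leI)
        qed
      qed
      also have "\<dots> = (\<integral>\<^sup>+\<theta>. ennreal (?F (rotation b ?e) \<theta>) \<partial>\<beta>) * indicator {0..2*pi} b"
        using b pi_gt3 by (simp add: indicator_def)
      finally show ?thesis using True by simp
    qed simp
  qed
  finally have "(\<integral>\<^sup>+b. ennreal (2 * pi * A) * (ennreal (1 / b) * indicator {\<eta> / c0..1} b) \<partial>lborel) / ennreal (2 * pi)
     \<le> ennreal (gen full \<phi> ?e)" .
  moreover have "(\<integral>\<^sup>+b. ennreal (1 / b) * indicator {\<eta> / c0..1} b \<partial>lborel) = ennreal (ln (c0 / \<eta>))"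
  proof -
    have "(\<integral>\<^sup>+b. ennreal (1 / b) * indicator {\<eta> / c0..1} b \<partial>lborel) = ennreal (ln 1 - ln (\<eta> / c0))"
    proof (rule nn_integral_FTC_Icc)
      have pos: "0 < x" if "x \<in> {\<eta> / c0..1}" for x
        using that divide_pos_pos[OF \<eta> c0] by simp
      show "DERIV ln x :> 1 / x" if "x \<in> {\<eta> / c0..1}" for x
        using pos[OF that] by (auto intro!: derivative_eq_intros)
      show "0 \<le> 1 / x" if "x \<in> {\<eta> / c0..1}" for x using pos[OF that] by simp
    qed (use \<eta> c0 small in auto)
    then show ?thesis using \<eta> c0 by (simp add: ln_div)
  qed
  moreover have "0 \<le> ln (c0 / \<eta>)" using \<eta> c0 small by simp
  ultimately have "ennreal (2 * pi * A * ln (c0 / \<eta>)) / ennreal (2 * pi) \<le> ennreal (gen full \<phi> ?e)"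
    using A0 by (subst (asm) nn_integral_cmult) (auto simp: ennreal_mult)
  then have "ennreal (A * ln (c0 / \<eta>)) \<le> ennreal (gen full \<phi> ?e)"
    using A0 \<open>0 \<le> ln (c0 / \<eta>)\<close> by (subst (asm) divide_ennreal) auto
  moreover have "0 \<le> gen full \<phi> ?e"
    unfolding gen_def using \<phi>e \<phi>0 by (intro integral_nonneg_AE) auto
  ultimately have "A * ln (c0 / \<eta>) \<le> gen full \<phi> ?e" by (simp add: ennreal_le_iff)
  then show ?thesis unfolding gv A_def a_def by simp
qed

text \<open>Off the circle the total collision rate at distance \<open>x\<close> is of order \<open>x powr (\<gamma> + 1)\<close>, which is exactly
compensated by a test function below \<open>x powr (- \<gamma> - 1)\<close>.\<close>

lemma loss_off_circle:
  obtains C where "0 \<le> C"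
    "\<And>\<phi> L v. L-lipschitz_on UNIV \<phi> \<Longrightarrow> (\<And>u. 0 \<le> \<phi> u) \<Longrightarrow> \<phi> v \<le> \<bar>norm v - r0\<bar> powr (- \<gamma> - 1) \<Longrightarrow>
        norm v \<noteq> r0 \<Longrightarrow> - C \<le> gen full \<phi> v"
proof -
  obtain c where c: "0 \<le> c" "\<And>v. norm v \<noteq> r0 \<Longrightarrow>
      (\<integral>\<^sup>+w. ennreal (norm (v - w) powr \<gamma>) \<partial>f0) \<le> ennreal (c * \<bar>norm v - r0\<bar> powr (\<gamma> + 1))"
    by (rule uniform_circle_singular_potential[OF r0_pos gamma(2)]) blast
  have "- (\<Lambda> * c) \<le> gen full \<phi> v"
    if L: "L-lipschitz_on UNIV \<phi>" and \<phi>0: "\<And>u. 0 \<le> \<phi> u" and le: "\<phi> v \<le> \<bar>norm v - r0\<bar> powr (- \<gamma> - 1)"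
      and v: "norm v \<noteq> r0" for \<phi> :: "real ^ 2 \<Rightarrow> real" and L v
  proof -
    let ?x = "\<bar>norm v - r0\<bar>"
    have x: "0 < ?x" using v by simp
    have nn: "(\<integral>\<^sup>+z. ennreal (norm (v - fst z) powr \<gamma>) \<partial>marks) \<le> ennreal (\<Lambda> * (c * ?x powr (\<gamma> + 1)))"
      using c Lambda_pos v by (subst nn_integral_marks_fst) (auto simp: ennreal_mult intro!: mult_left_mono)
    then have int: "integrable marks (\<lambda>z. norm (v - fst z) powr \<gamma>)"
      by (intro integrableI_nonneg) (auto simp: less_top[symmetric] top_unique)
    have I: "(LINT z|marks. norm (v - fst z) powr \<gamma>) \<le> \<Lambda> * (c * ?x powr (\<gamma> + 1))"
      using nn c Lambda_pos by (subst (asm) nn_integral_eq_integral[OF int]) auto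
    have "\<phi> v * (LINT z|marks. norm (v - fst z) powr \<gamma>) \<le> ?x powr (- \<gamma> - 1) * (\<Lambda> * (c * ?x powr (\<gamma> + 1)))"
      using I le \<phi>0 by (intro mult_mono) auto
    also have "\<dots> = \<Lambda> * c * (?x powr (- \<gamma> - 1) * ?x powr (\<gamma> + 1))" by (simp add: mult_ac)
    also have "?x powr (- \<gamma> - 1) * ?x powr (\<gamma> + 1) = 1" using x by (simp flip: powr_add)
    finally have "- (\<Lambda> * c) \<le> (LINT z|marks. - (\<phi> v * norm (v - fst z) powr \<gamma>))" by simp
    also have "\<dots> \<le> gen full \<phi> v"
      unfolding gen_def
    proof (rule integral_mono)
      show "integrable marks (\<lambda>z. - (\<phi> v * norm (v - fst z) powr \<gamma>))" using int by auto
      show "integrable marks (\<lambda>z. norm (v - fst z) powr \<gamma> * (\<phi> (post_velocity v (fst z) (snd z)) - \<phi> v))"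
        by (rule collision_integrand_integrable[OF L admissible_full])
      show "- (\<phi> v * norm (v - fst z) powr \<gamma>) \<le> norm (v - fst z) powr \<gamma> * (\<phi> (post_velocity v (fst z) (snd z)) - \<phi> v)" for z
        using \<phi>0 by (simp add: algebra_simps)
    qed
    finally show ?thesis .
  qed
  with c(1) Lambda_pos show ?thesis by (intro that[of "\<Lambda> * c"]) auto
qed

text \<open>The lower bound for the gain on the circle equals \<open>X\<close> for a suitable \<open>\<eta>\<close>, while the constant \<open>C\<close> comes from the loss term
and does not depend on \<open>\<eta>\<close>, hence not on \<open>X\<close>.\<close>

lemma lyapunov_function:
  assumes \<theta>0: "0 < \<theta>0" "\<theta>0 < pi / 2" "AE \<theta> in \<beta>. \<theta>0 \<le> \<bar>\<theta>\<bar>"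
  obtains C where "0 \<le> C" "\<And>X. 0 \<le> X \<Longrightarrow> \<exists>\<phi> L. L-lipschitz_on UNIV \<phi> \<and>
      (\<forall>v. 0 \<le> \<phi> v \<and> \<phi> v \<le> 1 + \<bar>norm v - r0\<bar>) \<and> (\<forall>v. norm v = r0 \<longrightarrow> \<phi> v = 0) \<and>
      (\<forall>v. X * indicator {v. norm v = r0} v - C \<le> gen full \<phi> v)"
proof -
  obtain C where C: "0 \<le> C"
    "\<And>\<phi> L v. L-lipschitz_on UNIV \<phi> \<Longrightarrow> (\<And>u. 0 \<le> \<phi> u) \<Longrightarrow> \<phi> v \<le> \<bar>norm v - r0\<bar> powr (- \<gamma> - 1) \<Longrightarrow>
        norm v \<noteq> r0 \<Longrightarrow> - C \<le> gen full \<phi> v"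
    by (rule loss_off_circle) blast
  define a where "a = - \<gamma> - 1"
  have a: "0 < a" "a < 1" using gamma by (auto simp: a_def)
  define c0 where "c0 = r0 * sin \<theta>0 / 9"
  have "0 < sin \<theta>0" using \<theta>0 by (intro sin_gt_zero) auto
  then have c0: "0 < c0" using r0_pos by (simp add: c0_def)
  define A where "A = \<Lambda> * r0 powr \<gamma> * c0 powr a / (2 * pi)"
  have A: "0 < A" using Lambda_pos r0_pos c0 by (simp add: A_def)
  show ?thesis
  proof (rule that[OF C(1)])
    fix X :: real assume X: "0 \<le> X"
    define \<eta> where "\<eta> = c0 * exp (- X / A)"
    have \<eta>: "0 < \<eta>" "\<eta> \<le> c0" "A * ln (c0 / \<eta>) = X"
      using c0 A X by (auto simp: \<eta>_def ln_div ln_mult mult_le_cancel_left2)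
    define \<phi> where "\<phi> v = chopped_powr a \<eta> \<bar>norm v - r0\<bar>" for v :: "real ^ 2"
    have L: "(\<eta> powr (a - 1))-lipschitz_on UNIV \<phi>"
      unfolding \<phi>_def by (rule lipschitz_chopped_powr_norm[OF a \<eta>(1)])
    have p: "0 \<le> \<phi> v" "\<phi> v \<le> \<bar>norm v - r0\<bar> powr a" "\<phi> v \<le> 1 + \<bar>norm v - r0\<bar>" for v
      unfolding \<phi>_def using chopped_powr_bounds[OF a \<eta>(1), of "\<bar>norm v - r0\<bar>"] by auto
    have z: "\<phi> v = 0" if "norm v = r0" for v
      using that chopped_powr_bounds(4)[OF a \<eta>(1), of 0] by (simp add: \<phi>_def)
    have "X * indicator {v. norm v = r0} v - C \<le> gen full \<phi> v" for v
    proof (cases "norm v = r0")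
      case True
      have "X \<le> gen full \<phi> v"
        using gain_on_circle[OF \<theta>0 \<eta>(1), folded c0_def, OF \<eta>(2) True, folded a_def, folded A_def \<phi>_def] \<eta>(3)
        by simp
      then show ?thesis using True C(1) by simp
    next
      case False
      then show ?thesis using C(2)[OF L p(1) p(2)[of v, unfolded a_def]] by simp
    qed
    with L p z show "\<exists>\<phi> L. L-lipschitz_on UNIV \<phi> \<and>
      (\<forall>v. 0 \<le> \<phi> v \<and> \<phi> v \<le> 1 + \<bar>norm v - r0\<bar>) \<and> (\<forall>v. norm v = r0 \<longrightarrow> \<phi> v = 0) \<and>
      (\<forall>v. X * indicator {v. norm v = r0} v - C \<le> gen full \<phi> v)" by blast
  qed
qed

end

context radial_solution
begin

lemma flow_circle_measurable: "(\<lambda>s. measure (flow s) {v. norm v = r0}) \<in> borel_measurable borel"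
proof (rule borel_measurable_LIMSEQ_real)
  define peak where "peak n v = max 0 (1 - real n * \<bar>norm v - r0\<bar>)" for n and v :: "real ^ 2"
  have [measurable]: "peak n \<in> borel_measurable borel" for n unfolding peak_def by measurable
  have bd: "\<bar>peak n v\<bar> \<le> 1" for n v by (auto simp: peak_def)
  show "(\<lambda>s. LINT v|flow s. peak n v) \<in> borel_measurable borel" for n
    by (rule measurable_in_time[OF _ bd]) (auto simp: peak_def intro!: continuous_intros)
  have lim: "(\<lambda>n. peak n v) \<longlonglongrightarrow> indicator {v. norm v = r0} v" for v
  proof (cases "norm v = r0")
    case False
    have "peak n v = 0" if "nat \<lceil>1 / \<bar>norm v - r0\<bar>\<rceil> \<le> n" for n
    proof -
      have "1 / \<bar>norm v - r0\<bar> \<le> real n" using that by linarith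
      then have "1 \<le> real n * \<bar>norm v - r0\<bar>" using False by (simp add: field_simps)
      then show ?thesis by (simp add: peak_def)
    qed
    then have "\<forall>\<^sub>F n in sequentially. peak n v = 0"
      unfolding eventually_sequentially by blast
    then show ?thesis using False by (simp add: tendsto_eventually)
  qed (simp add: peak_def)
  fix s
  have "(\<lambda>n. LINT v|flow s. peak n v) \<longlonglongrightarrow> (LINT v|flow s. indicator {v. norm v = r0} v)"
    by (rule integral_dominated_convergence[where w="\<lambda>_. 1"]) (use lim bd in auto)
  then show "(\<lambda>n. LINT v|flow s. peak n v) \<longlonglongrightarrow> measure (flow s) {v. norm v = r0}" by simp
qed

text \<open>Integrating a Lyapunov function along the flow bounds \<open>X\<close> times the mean time spent on the circle by a
quantity that is independent of \<open>X\<close>.\<close>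

lemma flow_circle_integral_0:
  assumes \<theta>0: "0 < \<theta>0" "\<theta>0 < pi / 2" "AE \<theta> in \<beta>. \<theta>0 \<le> \<bar>\<theta>\<bar>" and t: "0 \<le> t"
  shows "(LINT s:{0..t}|lborel. measure (flow s) {v. norm v = r0}) = 0"
proof -
  let ?C = "{v :: real ^ 2. norm v = r0}"
  let ?p = "\<lambda>s. measure (flow s) ?C"
  obtain C where C: "0 \<le> C" "\<And>X. 0 \<le> X \<Longrightarrow> \<exists>\<phi> L. L-lipschitz_on UNIV \<phi> \<and>
      (\<forall>v. 0 \<le> \<phi> v \<and> \<phi> v \<le> 1 + \<bar>norm v - r0\<bar>) \<and> (\<forall>v. norm v = r0 \<longrightarrow> \<phi> v = 0) \<and>
      (\<forall>v. X * indicator ?C v - C \<le> gen full \<phi> v)"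
    by (rule lyapunov_function[OF \<theta>0]) blast
  note [measurable] = flow_circle_measurable
  have ip: "set_integrable lborel {0..t} ?p"
    by (rule set_integrable_bounded[where B=1]) auto
  have in1: "integrable (flow t) (\<lambda>v. 1 + \<bar>norm v - r0\<bar>)"
    using integrable_norm_flow[OF t] by auto
  define M where "M = (LINT v|flow t. 1 + \<bar>norm v - r0\<bar>) + C * t"
  define I where "I = (LINT s:{0..t}|lborel. ?p s)"
  have I0: "0 \<le> I" unfolding I_def set_lebesgue_integral_def by (intro Bochner_Integration.integral_nonneg) auto
  have XI: "X * I \<le> M" if X: "0 \<le> X" for X
  proof -
    obtain \<phi> L where \<phi>: "L-lipschitz_on UNIV \<phi>" "\<And>v. 0 \<le> \<phi> v" "\<And>v. \<phi> v \<le> 1 + \<bar>norm v - r0\<bar>"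
      "\<And>v. norm v = r0 \<Longrightarrow> \<phi> v = 0" "\<And>v. X * indicator ?C v - C \<le> gen full \<phi> v"
      using C(2)[OF X] by blast
    have "X * ?p s - C \<le> (LINT v|flow s. gen full \<phi> v)" for s
    proof -
      have ii: "integrable (flow s) (\<lambda>v. X * indicator ?C v - C)"
        by (intro Bochner_Integration.integrable_diff integrable_mult_right integrable_real_indicator)
           (auto simp: flow.emeasure_eq_measure)
      have "(LINT v|flow s. X * indicator ?C v - C) \<le> (LINT v|flow s. gen full \<phi> v)"
        by (intro integral_mono ii integral_gen_bound(1)[OF flow.prob_space_axioms sets_spread \<phi>(1) admissible_full] \<phi>(5))
      also have "(LINT v|flow s. X * indicator ?C v - C) = X * ?p s - C"
        by (subst Bochner_Integration.integral_diff)
           (auto simp: flow.emeasure_eq_measure flow.prob_space[simplified] intro!: integrable_mult_right integrable_real_indicator)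
      finally show ?thesis .
    qed
    then have "(LINT s:{0..t}|lborel. X * ?p s - C) \<le> (LINT s:{0..t}|lborel. LINT v|flow s. gen full \<phi> v)"
      by (intro set_integral_mono set_integral_diff set_integrable_mult_right ip
            set_integrable_bounded[OF flow_gen_measurable[OF \<phi>(1)] flow_gen_bound[OF \<phi>(1)]]
            set_integrable_bounded[where B=C]) (use C(1) in auto)
    also have "\<dots> = (LINT v|flow t. \<phi> v) - (LINT v|f0. \<phi> v)"
      unfolding flow_equation[OF \<phi>(1) t] by simp
    also have "(LINT v|f0. \<phi> v) = 0"
      by (rule integral_eq_zero_AE)
         (use AE_uniform_circle_norm[OF less_imp_le[OF r0_pos]] \<phi>(4) in \<open>auto elim!: eventually_mono\<close>)
    also have "(LINT v|flow t. \<phi> v) - 0 \<le> (LINT v|flow t. 1 + \<bar>norm v - r0\<bar>)"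
      using \<phi>(3) by (auto intro!: integral_mono integrable_Lip_flow[OF \<phi>(1) t] in1)
    also have "(LINT s:{0..t}|lborel. X * ?p s - C) = X * I - C * t"
    proof -
      have "(LINT s:{0..t}|lborel. X * ?p s - C) = (LINT s:{0..t}|lborel. X * ?p s) - (LINT s:{0..t}|lborel. C)"
        by (intro set_integral_diff set_integrable_mult_right ip set_integrable_bounded[where B=C]) (use C(1) in auto)
      moreover have "(LINT s:{0..t}|lborel. C) = C * t"
        using t by (simp add: set_lebesgue_integral_def mult.commute)
      ultimately show ?thesis by (simp add: I_def)
    qed
    finally show ?thesis by (simp add: M_def)
  qed
  have "I = 0"
  proof (rule ccontr)
    assume "I \<noteq> 0"
    with I0 have I: "0 < I" by simp
    have "0 \<le> M" using XI[of 0] by simp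
    then have "(M + 1) / I * I \<le> M" using I by (intro XI) auto
    with I show False by simp
  qed
  then show ?thesis by (simp add: I_def)
qed

lemma AE_flow_circle:
  assumes \<theta>0: "0 < \<theta>0" "\<theta>0 < pi / 2" "AE \<theta> in \<beta>. \<theta>0 \<le> \<bar>\<theta>\<bar>"
  shows "AE s in lborel. 0 \<le> s \<longrightarrow> emeasure (flow s) {v. norm v = r0} = 0"
proof -
  let ?p = "\<lambda>s. measure (flow s) {v. norm v = r0}"
  note [measurable] = flow_circle_measurable
  have "AE s in lborel. indicator {0..real n} s * ?p s = 0" for n
  proof -
    have "integrable lborel (\<lambda>s. indicator {0..real n} s * ?p s)"
      using set_integrable_bounded[of ?p 1 "real n"] by (simp add: set_integrable_def)
    moreover have "(LINT s|lborel. indicator {0..real n} s * ?p s) = 0"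
      using flow_circle_integral_0[OF \<theta>0, of "real n"] by (simp add: set_lebesgue_integral_def)
    ultimately show ?thesis
      by (subst (asm) integral_nonneg_eq_0_iff_AE) auto
  qed
  then have "AE s in lborel. \<forall>n. indicator {0..real n} s * ?p s = 0"
    unfolding AE_all_countable by (rule allI)
  then show ?thesis
  proof eventually_elim
    case (elim s)
    show ?case
    proof
      assume "0 \<le> s"
      moreover obtain n where "s \<le> real n" using real_arch_simple by blast
      ultimately show "emeasure (flow s) {v. norm v = r0} = 0"
        using elim[rule_format, of n] by (simp add: flow.emeasure_eq_measure)
    qed
  qed
qed

theorem AE_flow_density:
  assumes \<theta>0: "0 < \<theta>0" "\<theta>0 < pi / 2" "AE \<theta> in \<beta>. \<theta>0 \<le> \<bar>\<theta>\<bar>"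
  shows "AE t in lborel. 0 < t \<longrightarrow> has_lebesgue_density (flow t)"
  using AE_flow_circle[OF \<theta>0]
proof eventually_elim
  case (elim t)
  show ?case
  proof
    assume t: "0 < t"
    have "absolutely_continuous lborel (flow t)"
      unfolding absolutely_continuous_def
    proof
      fix N :: "(real ^ 2) set" assume N: "N \<in> null_sets lborel"
      then have [measurable]: "N \<in> sets borel" by auto
      have "emeasure (flow t) N \<le> emeasure (flow t) ((N - {v. norm v = r0}) \<union> {v. norm v = r0})"
        by (intro emeasure_mono) auto
      also have "\<dots> \<le> emeasure (flow t) (N - {v. norm v = r0}) + emeasure (flow t) {v. norm v = r0}"
        by (intro emeasure_subadditive) auto
      also have "\<dots> = 0" using flow_null_off_circle[OF N] elim t by simp
      finally show "N \<in> null_sets (flow t)" by (auto simp: null_sets_def sets_spread)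
    qed
    then obtain g where "g \<in> borel_measurable lborel" "density lborel g = flow t"
      using sigma_finite_measure.Radon_Nikodym[OF sigma_finite_lborel, of "flow t"] by (auto simp: sets_spread)
    then show "has_lebesgue_density (flow t)" unfolding has_lebesgue_density_def by metis
  qed
qed

end

theorem theorem2:
  fixes \<gamma> \<Lambda> \<theta>0 r0 :: real and \<beta> :: "real measure" and f0 :: "(real ^ 2) measure"
  assumes "- 2 < \<gamma>" and "\<gamma> < - 1"
    and "sets \<beta> = sets angles"
    and "\<And>A. A \<in> sets \<beta> \<Longrightarrow> emeasure \<beta> (uminus ` A) = emeasure \<beta> A"
    and "emeasure \<beta> (space \<beta>) = ennreal \<Lambda>" and "0 < \<Lambda>"
    and "0 < \<theta>0" and "\<theta>0 < pi / 2"
    and "emeasure \<beta> ({- \<theta>0 <..< \<theta>0} - {0}) = 0"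
    and "0 < r0" and "f0 = uniform_circle r0"
  shows "\<exists>f. solves_LB f0 \<gamma> \<beta> f \<and>
             (AE t in lborel. 0 < t \<longrightarrow> has_lebesgue_density (f t))"
proof -
  interpret lin_boltzmann \<gamma> \<Lambda> r0 \<beta>
    using assms by unfold_locales
  obtain \<mu> where \<mu>: "radial_solution \<gamma> \<Lambda> r0 \<beta> \<mu>"
    using ex_radial_solution by blast
  interpret radial_solution \<gamma> \<Lambda> r0 \<beta> \<mu> by (rule \<mu>)
  have "AE \<theta> in \<beta>. \<theta>0 \<le> \<bar>\<theta>\<bar>"
  proof (rule AE_I[where N="{- \<theta>0 <..< \<theta>0} - {0}"])
    show "{\<theta> \<in> space \<beta>. \<not> \<theta>0 \<le> \<bar>\<theta>\<bar>} \<subseteq> {- \<theta>0 <..< \<theta>0} - {0}"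
      by (auto simp: space_beta)
    have "{- \<theta>0 <..< \<theta>0} - {0} \<subseteq> {- pi / 2 .. pi / 2} - {0}"
      using assms(8) by auto
    then show "{- \<theta>0 <..< \<theta>0} - {0} \<in> sets \<beta>"
      unfolding assms(3) angles_def by (subst sets_restrict_space_iff) simp_all
  qed fact
  then have "AE t in lborel. 0 < t \<longrightarrow> has_lebesgue_density (flow t)"
    using assms(7,8) by (intro AE_flow_density)
  with flow_solves_LB show ?thesis unfolding assms(11) by blast
qed

end
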